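(* Let $(d_1,\partial_1)$ and $(d_2,\partial_2)$ be coherent derivations on a finite-dimensional commutative and cocommutative ASI bialgebra $(A,\circ,\Delta)$. Suppose that $d_1$ commutes with $d_2$, that $\partial_1$ commutes with $\partial_2$, and that $$d_1(x)\circ d_2(y)=\partial_2(x\circ d_1(y)),\qquad d_1(x)\circ d_2(y)=\partial_1(d_2(x)\circ y),\qquad\forall x,y\in A,$$ $$(\partial_1\otimes\partial_2)\Delta=(\mathrm{id}_A\otimes\partial_1)\Delta d_2,\qquad(\partial_1\otimes\partial_2)\Delta=(\partial_2\otimes\mathrm{id}_A)\Delta d_1.$$ Let $(A_h,\circ_h,\Delta_h)$ be the ASI bialgebra deformation induced by $(A,\circ,d_1,d_2,\Delta,\partial_1,\partial_2)$ and $(A,\{,\},\circ,\delta,\Delta)$ be its QCL. Let $[,]$ and $\cdot$ be the dual operations on $A^*$ of $\delta$ and $\Delta$. Let $((A_h,\circ_h),(A_h^\star,\cdot_h),l_{\circ_h},r_{\circ_h},l_{\cdot_h},r_{\cdot_h})$ be the associative matched pair deformation induced by $((A,\circ),(A^*,\cdot),R_\circ^*,L_\circ^*,R_\cdot^*,L_\cdot^*,d_1\dotplus\partial_1^*,d_2\dotplus\partial_2^* )$. Then the matched pair of topologically free associative algebras corresponding to $(A_h,\circ_h,\Delta_h)$ coincides with $((A_h,\circ_h),(A_h^\star,\cdot_h),l_{\circ_h},r_{\circ_h},l_{\cdot_h},r_{\cdot_h})$. Moreover, the matched pair of Poisson algebras corresponding to $(A,\{,\},\circ,\delta,\Delta)$,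 namely $((A,\{,\},\circ),(A^*,[,],\cdot),-\mathrm{ad}^*_{\{,\}},R_\circ^*,-\mathrm{ad}^*_{[,]},R_\cdot^* )$, is exactly the QCL of $((A_h,\circ_h),(A_h^\star,\cdot_h),l_{\circ_h},r_{\circ_h},l_{\cdot_h},r_{\cdot_h})$.
   Context: Conventions. $\mathbf{k}$ is a field of characteristic $0$, $\mathbf{K}=\mathbf{k}[[h]]$; vector spaces, algebras, tensor products are over $\mathbf{k}$; no units/counits required. $V_h:=V[[h]]\supset V$; $\equiv\pmod h$ means equality modulo $hV_h$. $\hat\otimes$ is the $h$-adic completion of $\otimes_{\mathbf{K}}$, so $V_h\hat\otimes W_h\cong(V\otimes W)[[h]]$. $\sigma,\sigma_{\mathbf{K}}$ are the flips on $A\otimes A$, $A_h\hat\otimes A_h$. $L_\circ(x)y=x\circ y$, $R_\circ(x)y=y\circ x$, $\mathrm{ad}_{\{,\}}(x)y=\{x,y\}$. Duals. $V^*=\mathrm{Hom}_{\mathbf{k}}(V,\mathbf{k})$ with pairing $\langle,\rangle$; $T^*$ is the transpose of $T$. For $\varrho:A\to\mathrm{End}(V)$, $\langle\varrho^*(x)u^*,v\rangle=\langle u^*,\varrho(x)v\rangle$ (no sign). $V_h^\star:=(V^* )_h\cong\mathrm{Hom}_{\mathbf{K}}(V_h,\mathbf{K})$ with $\mathbf{K}$-bilinear pairing $\langle,\rangle_{\mathbf{K}}$ extending $\langle,\rangle$; $\langle\varrho_h^\star(x')u^\star,v'\rangle_{\mathbf{K}}=\langle u^\star,\varrho_h(x')v'\rangle_{\mathbf{K}}$.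 For $A$ finite-dimensional, $A^{**}=A$, $(A_h^\star)^\star=A_h$. Dual operation of $\Delta$: $\langle a^*\cdot b^*,x\rangle=\langle a^*\otimes b^*,\Delta(x)\rangle$ (similarly $[,]$ for $\delta$). Topological dual operation $\cdot'_h$ of $\Delta_h$: $\langle a^\star\cdot'_h b^\star,x_h\rangle_{\mathbf{K}}=\langle a^\star\hat\otimes b^\star,\Delta_h(x_h)\rangle_{\mathbf{K}}$. ASI bialgebra $(A,\circ,\Delta)$: $\circ$ associative, $\Delta$ coassociative, and for all $x,y$: $\Delta(x\circ y)=(\mathrm{id}\otimes L_\circ(x))\Delta(y)+(R_\circ(y)\otimes\mathrm{id})\Delta(x)$, $(L_\circ(y)\otimes\mathrm{id}-\mathrm{id}\otimes R_\circ(y))\Delta(x)+\sigma\big((L_\circ(x)\otimes\mathrm{id}-\mathrm{id}\otimes R_\circ(x))\Delta(y)\big)=0$; commutative and cocommutative if $\circ$ is commutative and $\Delta=\sigma\Delta$. Coderivation: linear $\partial$ with $\Delta\partial=(\partial\otimes\mathrm{id}+\mathrm{id}\otimes\partial)\Delta$. Coherent derivation: a pair $(d,\partial)$, $d$ a derivation on $(A,\circ)$, $\partial$ a coderivation on $(A,\Delta)$, with $\partial(x)\circ y=x\circ d(y)+\partial(x\circ y)$, $x\circ\partial(y)=d(x)\circ y+\partial(x\circ y)$ for all $x,y\in A$, $(d\otimes\mathrm{id})\Delta=(\mathrm{id}\otimes\partial)\Delta+\Delta d$, $(\mathrm{id}\otimes d)\Delta=(\partial\otimes\mathrm{id})\Delta+\Delta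 d$. Under the four displayed conditions, the ASI bialgebra deformation induced by $(A,\circ,d_1,d_2,\Delta,\partial_1,\partial_2)$ is $(A_h,\circ_h,\Delta_h)$ with $A_h=A[[h]]$, $x\circ_h y=\sum_{s\ge0}d_1^s(x)\circ d_2^s(y)\frac{h^s}{s!}$, $\Delta_h(x)=\sum_{s\ge0}(\partial_1^s\otimes\partial_2^s)\Delta(x)\frac{h^s}{s!}$ for $x,y\in A$, extended $\mathbf{K}$-(bi)linearly. Its QCL is $(A,\{,\},\circ,\delta,\Delta)$ with $\{x,y\}\equiv\frac{x\circ_h y-y\circ_h x}{h}$, $\delta(x)\equiv\frac{\Delta_h(x)-\sigma_{\mathbf{K}}\Delta_h(x)}{h}\pmod h$. Matched pair of associative algebras $((A,\circ),(B,\cdot),l_\circ,r_\circ,l_\cdot,r_\cdot)$: associative algebras and linear maps $l_\circ,r_\circ:A\to\mathrm{End}(B)$, $l_\cdot,r_\cdot:B\to\mathrm{End}(A)$ such that $(x,u)\odot(y,v)=(x\circ y+l_\cdot(u)y+r_\cdot(v)x,\ l_\circ(x)v+r_\circ(y)u+u\cdot v)$ is associative on $A\oplus B$ (algebra $A\bowtie_{l_\cdot,r_\cdot}^{l_\circ,r_\circ}B$). Matched pair of topologically free associative algebras: the same over $\mathbf{K}$, with $\mathbf{K}$-modules isomorphic to some $V[[h]]$ and $\mathbf{K}$-linear maps. $(f\dotplus g)(x,v)=(f(x),g(v))$. Known: $((A,\circ),(A^*,\cdot),R_\circ^*,L_\circ^*,R_\cdot^*,L_\cdot^* )$ is a matched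 pair and $d_i\dotplus\partial_i^*$ are commuting derivations of $A\bowtie_{R_\cdot^*,L_\cdot^*}^{R_\circ^*,L_\circ^*}A^*$. Given a matched pair and commuting derivations $D_1,D_2$ of $A\bowtie_{l_\cdot,r_\cdot}^{l_\circ,r_\circ}B$ preserving $A$ and $B$, the induced associative matched pair deformation is $((A_h,\circ_h),(B_h,\cdot_h),l_{\circ_h},r_{\circ_h},l_{\cdot_h},r_{\cdot_h})$ with $x\circ_h y=\sum_s D_1^s(x)\circ D_2^s(y)\frac{h^s}{s!}$, $u\cdot_h v=\sum_s D_1^s(u)\cdot D_2^s(v)\frac{h^s}{s!}$, $l_{\circ_h}(x)v=\sum_s l_\circ(D_1^s(x))D_2^s(v)\frac{h^s}{s!}$, $r_{\circ_h}(x)v=\sum_s r_\circ(D_2^s(x))D_1^s(v)\frac{h^s}{s!}$, $l_{\cdot_h}(v)x=\sum_s l_\cdot(D_1^s(v))D_2^s(x)\frac{h^s}{s!}$, $r_{\cdot_h}(v)x=\sum_s r_\cdot(D_2^s(v))D_1^s(x)\frac{h^s}{s!}$, extended $\mathbf{K}$-linearly. In the commutative case ($l_\circ=r_\circ=\rho_\circ$, $l_\cdot=r_\cdot=\rho_\cdot$) its QCL is $((A,\{,\},\circ),(B,[,],\cdot),\rho_{\{,\}},\rho_\circ,\rho_{[,]},\rho_\cdot)$ with $\{x,y\}\equiv\frac{x\circ_hy-y\circ_hx}{h}$, $[u,v]\equiv\frac{u\cdot_hv-v\cdot_hu}{h}$, $\rho_{\{,\}}(x)v\equiv\frac{l_{\circ_h}(x)v-r_{\circ_h}(x)v}{h}$,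 $\rho_{[,]}(v)x\equiv\frac{l_{\cdot_h}(v)x-r_{\cdot_h}(v)x}{h}\pmod h$. Poisson algebra: Lie bracket $\{,\}$ and commutative associative $\circ$ with $\{x,y\circ z\}=\{x,y\}\circ z+y\circ\{x,z\}$. Matched pair of Poisson algebras $((P,\{,\},\circ),(Q,[,],\cdot),\rho_{\{,\}},\rho_\circ,\rho_{[,]},\rho_\cdot)$: $P\oplus Q$ with $\llbracket(x,u),(y,v)\rrbracket=(\{x,y\}+\rho_{[,]}(u)y-\rho_{[,]}(v)x,\rho_{\{,\}}(x)v-\rho_{\{,\}}(y)u+[u,v])$ and $(x,u)\odot(y,v)=(x\circ y+\rho_\cdot(u)y+\rho_\cdot(v)x,\rho_\circ(x)v+\rho_\circ(y)u+u\cdot v)$ is a Poisson algebra. "Corresponding": the matched pair of topologically free associative algebras corresponding to a topologically free ASI bialgebra $(A_h,\circ_h,\Delta_h)$ is $((A_h,\circ_h),(A_h^\star,\cdot'_h),R^\star_{\circ_h},L^\star_{\circ_h},R^\star_{\cdot'_h},L^\star_{\cdot'_h})$; the matched pair of Poisson algebras corresponding to the (Poisson bialgebra) $(A,\{,\},\circ,\delta,\Delta)$ is the one displayed in the claim. *)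

theory Defs
  imports
    "HOL-Computational_Algebra.Formal_Power_Series"
    "HOL-Library.Function_Algebras"
    "HOL-Library.Product_Plus"
begin

unbundle fps_syntax

section \<open>Linear algebra on subspaces\<close>

text \<open>
  Dual spaces are sets of functions, so they are proper subspaces of a function type.  The
  structures that involve a dual are therefore stated for a subspace \<open>V\<close> of a module given by its
  scalar multiplication.
\<close>

definition linear_on ::
  "('r::comm_ring_1 \<Rightarrow> 'a::ab_group_add \<Rightarrow> 'a) \<Rightarrow> 'a set \<Rightarrow>
   ('r \<Rightarrow> 'b::ab_group_add \<Rightarrow> 'b) \<Rightarrow> 'b set \<Rightarrow> ('a \<Rightarrow> 'b) \<Rightarrow> bool" where
  "linear_on s V t W f \<longleftrightarrow>
     (\<forall>x\<in>V. f x \<in> W) \<and> (\<forall>x\<in>V. \<forall>y\<in>V. f (x + y) = f x + f y) \<and>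
     (\<forall>c. \<forall>x\<in>V. f (s c x) = t c (f x))"

definition bilinear_on ::
  "('r::comm_ring_1 \<Rightarrow> 'a::ab_group_add \<Rightarrow> 'a) \<Rightarrow> 'a set \<Rightarrow>
   ('r \<Rightarrow> 'b::ab_group_add \<Rightarrow> 'b) \<Rightarrow> 'b set \<Rightarrow>
   ('r \<Rightarrow> 'c::ab_group_add \<Rightarrow> 'c) \<Rightarrow> 'c set \<Rightarrow> ('a \<Rightarrow> 'b \<Rightarrow> 'c) \<Rightarrow> bool" where
  "bilinear_on s V t W r U f \<longleftrightarrow>
     (\<forall>y\<in>W. linear_on s V r U (\<lambda>x. f x y)) \<and> (\<forall>x\<in>V. linear_on t W r U (f x))"

definition func_scale :: "'k::times \<Rightarrow> ('x \<Rightarrow> 'k) \<Rightarrow> 'x \<Rightarrow> 'k" where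
  "func_scale c f = (\<lambda>x. c * f x)"

definition dual :: "('k::field \<Rightarrow> 'a::ab_group_add \<Rightarrow> 'a) \<Rightarrow> ('a \<Rightarrow> 'k) set" where
  "dual s = {u. Vector_Spaces.linear s (*) u}"

text \<open>
  The transpose of \<open>f : T \<rightarrow> T\<close> with respect to a perfect pairing \<open>pr\<close> of \<open>S\<close> with \<open>T\<close>; it sends
  \<open>u \<in> S\<close> to the \<open>w \<in> S\<close> with \<open>\<langle>w, v\<rangle> = \<langle>u, f v\<rangle>\<close> for all \<open>v \<in> T\<close>.  Taking for \<open>pr\<close> the evaluation
  pairing with its arguments swapped gives the transpose under the identification of the bidual of a
  finite-dimensional space with the space itself.
\<close>

definition transpose_wrt ::
  "('b \<Rightarrow> 'a \<Rightarrow> 'c) \<Rightarrow> 'b set \<Rightarrow> 'a set \<Rightarrow> ('a \<Rightarrow> 'a) \<Rightarrow> 'b \<Rightarrow> 'b" where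
  "transpose_wrt pr S T f u = (THE w. w \<in> S \<and> (\<forall>v\<in>T. pr w v = pr u (f v)))"

definition eval_pairing :: "('a \<Rightarrow> 'k) \<Rightarrow> 'a \<Rightarrow> 'k" where
  "eval_pairing u x = u x"

section \<open>The tensor square\<close>

definition bilinear_form ::
  "('k::field \<Rightarrow> 'a::ab_group_add \<Rightarrow> 'a) \<Rightarrow> ('a \<Rightarrow> 'a \<Rightarrow> 'k) \<Rightarrow> bool" where
  "bilinear_form s \<beta> \<longleftrightarrow> bilinear_on s UNIV s UNIV (*) UNIV \<beta>"

definition trilinear_form ::
  "('k::field \<Rightarrow> 'a::ab_group_add \<Rightarrow> 'a) \<Rightarrow> ('a \<Rightarrow> 'a \<Rightarrow> 'a \<Rightarrow> 'k) \<Rightarrow> bool" where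
  "trilinear_form s \<gamma> \<longleftrightarrow>
     (\<forall>a. bilinear_form s (\<gamma> a)) \<and> (\<forall>b c. linear_on s UNIV (*) UNIV (\<lambda>a. \<gamma> a b c))"

text \<open>
  \<open>A \<otimes> A\<close> is modelled inside the dual of the space of bilinear forms on \<open>A\<close>: a tensor is a function
  on bilinear forms (extended by 0 to all functions \<open>A \<times> A \<rightarrow> k\<close>), \<open>x \<otimes> y\<close> is the evaluation at
  \<open>(x, y)\<close>, and \<open>A \<otimes> A\<close> is the span of the pure tensors.  The universal property is proved below.
\<close>

type_synonym ('k, 'a) tensor2 = "('a \<Rightarrow> 'a \<Rightarrow> 'k) \<Rightarrow> 'k"

definition pure_tensor ::
  "('k::field \<Rightarrow> 'a::ab_group_add \<Rightarrow> 'a) \<Rightarrow> 'a \<Rightarrow> 'a \<Rightarrow> ('k, 'a) tensor2" where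
  "pure_tensor s x y = (\<lambda>\<beta>. if bilinear_form s \<beta> then \<beta> x y else 0)"

definition tensor_square ::
  "('k::field \<Rightarrow> 'a::ab_group_add \<Rightarrow> 'a) \<Rightarrow> ('k, 'a) tensor2 set" where
  "tensor_square s = module.span func_scale {pure_tensor s x y | x y. True}"

text \<open>\<open>f \<otimes> g\<close> for linear maps \<open>f\<close> and \<open>g\<close>.\<close>

definition tensor_map ::
  "('k::field \<Rightarrow> 'a::ab_group_add \<Rightarrow> 'a) \<Rightarrow> ('a \<Rightarrow> 'a) \<Rightarrow> ('a \<Rightarrow> 'a) \<Rightarrow>
   ('k, 'a) tensor2 \<Rightarrow> ('k, 'a) tensor2" where
  "tensor_map s f g t =
     (\<lambda>\<beta>. if bilinear_form s \<beta> then t (\<lambda>x y. \<beta> (f x) (g y)) else 0)"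

definition tensor_flip :: "('k, 'a) tensor2 \<Rightarrow> ('k, 'a) tensor2" where
  "tensor_flip t = (\<lambda>\<beta>. t (\<lambda>x y. \<beta> y x))"

text \<open>\<open>u \<otimes> v\<close> for functionals \<open>u\<close>, \<open>v\<close>, as a functional on \<open>A \<otimes> A\<close>.\<close>

definition functional_tensor ::
  "('a \<Rightarrow> 'k::times) \<Rightarrow> ('a \<Rightarrow> 'k) \<Rightarrow> ('k, 'a) tensor2 \<Rightarrow> 'k" where
  "functional_tensor u v = (\<lambda>t. t (\<lambda>x y. u x * v y))"

lemma vector_space_func_scale:
  "vector_space (func_scale :: 'k::field \<Rightarrow> ('x \<Rightarrow> 'k) \<Rightarrow> 'x \<Rightarrow> 'k)"
  by unfold_locales (auto simp: func_scale_def algebra_simps fun_eq_iff)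

lemma pure_tensor_bilinear:
  assumes "vector_space s"
  shows "bilinear_on s UNIV s UNIV func_scale (tensor_square s) (pure_tensor s)"
proof -
  interpret fs: vector_space "func_scale :: _ \<Rightarrow> (_ \<Rightarrow> 'a) \<Rightarrow> _" by (rule vector_space_func_scale)
  have mem: "pure_tensor s x y \<in> tensor_square s" for x y
    unfolding tensor_square_def by (rule fs.span_base) auto
  have "pure_tensor s (x + x') y = pure_tensor s x y + pure_tensor s x' y"
    "pure_tensor s x (y + y') = pure_tensor s x y + pure_tensor s x y'"
    "pure_tensor s (s c x) y = func_scale c (pure_tensor s x y)"
    "pure_tensor s x (s c y) = func_scale c (pure_tensor s x y)" for x x' y y' c
    by (auto simp: pure_tensor_def func_scale_def fun_eq_iff bilinear_form_def
        bilinear_on_def linear_on_def)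
  then show ?thesis
    unfolding bilinear_on_def linear_on_def by (simp add: mem)
qed

lemma tensor_map_pure:
  assumes "Vector_Spaces.linear s s f" "Vector_Spaces.linear s s g"
  shows "tensor_map s f g (pure_tensor s x y) = pure_tensor s (f x) (g y)"
proof -
  interpret f: Vector_Spaces.linear s s f by fact
  interpret g: Vector_Spaces.linear s s g by fact
  have "bilinear_form s (\<lambda>x y. \<beta> (f x) (g y))" if "bilinear_form s \<beta>" for \<beta>
    using that by (auto simp: bilinear_form_def bilinear_on_def linear_on_def f.add f.scale g.add g.scale)
  then show ?thesis by (auto simp: tensor_map_def pure_tensor_def fun_eq_iff)
qed

lemma tensor_flip_pure: "tensor_flip (pure_tensor s x y) = pure_tensor s y x"
proof -
  have "bilinear_form s (\<lambda>x y. \<beta> y x) \<longleftrightarrow> bilinear_form s \<beta>" for \<beta>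
    by (auto simp: bilinear_form_def bilinear_on_def)
  then show ?thesis unfolding tensor_flip_def pure_tensor_def by metis
qed

theorem tensor_square_universal:
  fixes s :: "'k::field \<Rightarrow> 'a::ab_group_add \<Rightarrow> 'a" and r :: "'k \<Rightarrow> 'c::ab_group_add \<Rightarrow> 'c"
  assumes r: "vector_space r" and B: "bilinear_on s UNIV s UNIV r UNIV B"
  shows "\<exists>\<phi>. linear_on func_scale (tensor_square s) r UNIV \<phi> \<and>
             (\<forall>x y. \<phi> (pure_tensor s x y) = B x y)"
proof -
  interpret r: vector_space r by (rule r)
  interpret fs: vector_space "func_scale :: 'k \<Rightarrow> (('a \<Rightarrow> 'a \<Rightarrow> 'k) \<Rightarrow> 'k) \<Rightarrow> _"
    by (rule vector_space_func_scale)
  interpret rk: vector_space_pair r "(*) :: 'k \<Rightarrow> 'k \<Rightarrow> 'k"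
    by unfold_locales (auto simp: algebra_simps)
  define P where "P t c \<longleftrightarrow> (\<forall>l. Vector_Spaces.linear r (*) l \<longrightarrow> t (\<lambda>x y. l (B x y)) = l c)"
    for t :: "('k, 'a) tensor2" and c
  have uniq: "c = c'" if "P t c" "P t c'" for t c c'
  proof (rule ccontr)
    assume "c \<noteq> c'"
    then have "r.independent {c - c'}" by (simp add: r.dependent_single)
    then obtain l where l: "Vector_Spaces.linear r (*) l" "l (c - c') = (1::'k)"
      using rk.linear_independent_extend[of "{c - c'}" "\<lambda>_. 1"] by auto
    interpret l: Vector_Spaces.linear r "(*)" l by (rule l(1))
    show False using that l by (auto simp: P_def l.diff)
  qed
  have bil: "bilinear_form s (\<lambda>x y. l (B x y))" if "Vector_Spaces.linear r (*) l" for l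
  proof -
    interpret l: Vector_Spaces.linear r "(*)" l by fact
    show ?thesis using B
      by (auto simp: bilinear_form_def bilinear_on_def linear_on_def l.add l.scale)
  qed
  have pure: "P (pure_tensor s x y) (B x y)" for x y
    by (auto simp: P_def pure_tensor_def bil)
  have add: "P (t + t') (c + c')" if "P t c" "P t' c'" for t t' c c'
    using that by (auto simp: P_def rk.linear_add)
  have scale: "P (func_scale a t) (r a c)" if "P t c" for a t c
    using that by (auto simp: P_def func_scale_def rk.linear_scale)
  have zero: "P 0 0" by (auto simp: P_def rk.linear_0)
  have ex: "\<exists>c. P t c" if "t \<in> tensor_square s" for t
    using that unfolding tensor_square_def
  proof (induction rule: fs.span_induct_alt)
    case base then show ?case using zero by blast
  next
    case (step c x y) then show ?case using add scale pure by blast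
  qed
  define \<phi> where "\<phi> t = (THE c. P t c)" for t
  have phi: "\<phi> t = c" if "P t c" for t c
    unfolding \<phi>_def using that uniq by (blast intro: the_equality)
  have "linear_on func_scale (tensor_square s) r UNIV \<phi>"
    unfolding linear_on_def
  proof (intro conjI ballI allI)
    fix t t' assume "t \<in> tensor_square s" "t' \<in> tensor_square s"
    then obtain c c' where "P t c" "P t' c'" using ex by blast
    then show "\<phi> (t + t') = \<phi> t + \<phi> t'" using add phi by metis
  next
    fix a t assume "t \<in> tensor_square s"
    then obtain c where "P t c" using ex by blast
    then show "\<phi> (func_scale a t) = r a (\<phi> t)" using scale phi by metis
  qed simp
  then show ?thesis using phi pure by blast
qed

section \<open>ASI bialgebras and coherent derivations\<close>

definition assoc_algebra ::
  "('r::comm_ring_1 \<Rightarrow> 'a::ab_group_add \<Rightarrow> 'a) \<Rightarrow> 'a set \<Rightarrow> ('a \<Rightarrow> 'a \<Rightarrow> 'a) \<Rightarrow> bool" where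
  "assoc_algebra s V m \<longleftrightarrow>
     module s \<and> module.subspace s V \<and> bilinear_on s V s V s V m \<and>
     (\<forall>x\<in>V. \<forall>y\<in>V. \<forall>z\<in>V. m (m x y) z = m x (m y z))"

text \<open>
  In the last clause both sides are elements of \<open>A \<otimes> A \<otimes> A\<close>, viewed as functions on trilinear
  forms: \<open>(\<Delta> \<otimes> id) \<Delta> x\<close> on the left and \<open>(id \<otimes> \<Delta>) \<Delta> x\<close> on the right.
\<close>

definition coassoc_coalgebra ::
  "('k::field \<Rightarrow> 'a::ab_group_add \<Rightarrow> 'a) \<Rightarrow> ('a \<Rightarrow> ('k, 'a) tensor2) \<Rightarrow> bool" where
  "coassoc_coalgebra s \<Delta> \<longleftrightarrow>
     vector_space s \<and> linear_on s UNIV func_scale (tensor_square s) \<Delta> \<and>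
     (\<forall>x \<gamma>. trilinear_form s \<gamma> \<longrightarrow>
        \<Delta> x (\<lambda>a b. \<Delta> a (\<lambda>p q. \<gamma> p q b)) = \<Delta> x (\<lambda>a b. \<Delta> b (\<lambda>p q. \<gamma> a p q)))"

definition asi_bialgebra ::
  "('k::field \<Rightarrow> 'a::ab_group_add \<Rightarrow> 'a) \<Rightarrow> ('a \<Rightarrow> 'a \<Rightarrow> 'a) \<Rightarrow>
   ('a \<Rightarrow> ('k, 'a) tensor2) \<Rightarrow> bool" where
  "asi_bialgebra s m \<Delta> \<longleftrightarrow>
     assoc_algebra s UNIV m \<and> coassoc_coalgebra s \<Delta> \<and>
     (\<forall>x y. \<Delta> (m x y) =
        tensor_map s id (\<lambda>z. m x z) (\<Delta> y) + tensor_map s (\<lambda>z. m z y) id (\<Delta> x)) \<and>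
     (\<forall>x y.
        (tensor_map s (\<lambda>z. m y z) id (\<Delta> x) - tensor_map s id (\<lambda>z. m z y) (\<Delta> x)) +
        tensor_flip
          (tensor_map s (\<lambda>z. m x z) id (\<Delta> y) - tensor_map s id (\<lambda>z. m z x) (\<Delta> y)) = 0)"

definition comm_cocomm_asi_bialgebra ::
  "('k::field \<Rightarrow> 'a::ab_group_add \<Rightarrow> 'a) \<Rightarrow> ('a \<Rightarrow> 'a \<Rightarrow> 'a) \<Rightarrow>
   ('a \<Rightarrow> ('k, 'a) tensor2) \<Rightarrow> bool" where
  "comm_cocomm_asi_bialgebra s m \<Delta> \<longleftrightarrow>
     asi_bialgebra s m \<Delta> \<and> (\<forall>x y. m x y = m y x) \<and> (\<forall>x. \<Delta> x = tensor_flip (\<Delta> x))"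

definition derivation ::
  "('k::field \<Rightarrow> 'a::ab_group_add \<Rightarrow> 'a) \<Rightarrow> ('a \<Rightarrow> 'a \<Rightarrow> 'a) \<Rightarrow> ('a \<Rightarrow> 'a) \<Rightarrow> bool" where
  "derivation s m d \<longleftrightarrow>
     Vector_Spaces.linear s s d \<and> (\<forall>x y. d (m x y) = m (d x) y + m x (d y))"

definition coderivation ::
  "('k::field \<Rightarrow> 'a::ab_group_add \<Rightarrow> 'a) \<Rightarrow> ('a \<Rightarrow> ('k, 'a) tensor2) \<Rightarrow> ('a \<Rightarrow> 'a) \<Rightarrow> bool" where
  "coderivation s \<Delta> e \<longleftrightarrow>
     Vector_Spaces.linear s s e \<and>
     (\<forall>x. \<Delta> (e x) = tensor_map s e id (\<Delta> x) + tensor_map s id e (\<Delta> x))"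

definition coherent_derivation ::
  "('k::field \<Rightarrow> 'a::ab_group_add \<Rightarrow> 'a) \<Rightarrow> ('a \<Rightarrow> 'a \<Rightarrow> 'a) \<Rightarrow>
   ('a \<Rightarrow> ('k, 'a) tensor2) \<Rightarrow> ('a \<Rightarrow> 'a) \<Rightarrow> ('a \<Rightarrow> 'a) \<Rightarrow> bool" where
  "coherent_derivation s m \<Delta> d e \<longleftrightarrow>
     derivation s m d \<and> coderivation s \<Delta> e \<and>
     (\<forall>x y. m (e x) y = m x (d y) + e (m x y)) \<and>
     (\<forall>x y. m x (e y) = m (d x) y + e (m x y)) \<and>
     (\<forall>x. tensor_map s d id (\<Delta> x) = tensor_map s id e (\<Delta> x) + \<Delta> (d x)) \<and>
     (\<forall>x. tensor_map s id d (\<Delta> x) = tensor_map s e id (\<Delta> x) + \<Delta> (d x))"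

text \<open>Dual operation of a (co)bracket or (co)product on the dual space.\<close>

definition dual_op ::
  "('a \<Rightarrow> ('k::field, 'a) tensor2) \<Rightarrow> ('a \<Rightarrow> 'k) \<Rightarrow> ('a \<Rightarrow> 'k) \<Rightarrow> ('a \<Rightarrow> 'k)" where
  "dual_op \<Delta> u v = (\<lambda>x. functional_tensor u v (\<Delta> x))"

section \<open>Topologically free modules over power series\<close>

text \<open>
  \<open>V[[h]]\<close> is the set of series with coefficients in \<open>V\<close>, inside the type of formal power series over
  the ambient type; it is a module over \<open>k[[h]]\<close> by the Cauchy product.  In particular
  \<open>(A \<otimes> A)[[h]]\<close> serves as the completed tensor square of \<open>A[[h]]\<close>, and series with coefficients in
  the dual of \<open>A\<close> as the topological dual of \<open>A[[h]]\<close>.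
\<close>

definition power_series_over :: "'a set \<Rightarrow> 'a fps set" where
  "power_series_over V = {F. \<forall>n. F $ n \<in> V}"

definition fps_scale ::
  "('k \<Rightarrow> 'a::ab_group_add \<Rightarrow> 'a) \<Rightarrow> 'k fps \<Rightarrow> 'a fps \<Rightarrow> 'a fps" where
  "fps_scale s c F = Abs_fps (\<lambda>n. \<Sum>i\<le>n. s (c $ i) (F $ (n - i)))"

text \<open>
  The \<open>k\<close>-space \<open>V\<close> in an isomorphism \<open>M \<cong> V[[h]]\<close> embeds into \<open>M\<close> as constant series, so it can be
  taken to be a \<open>k\<close>-subspace of \<open>M\<close>.
\<close>

definition topologically_free ::
  "('k::field fps \<Rightarrow> 'm::ab_group_add \<Rightarrow> 'm) \<Rightarrow> 'm set \<Rightarrow> bool" where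
  "topologically_free s M \<longleftrightarrow>
     module s \<and> module.subspace s M \<and>
     (\<exists>V f. module.subspace (\<lambda>c. s (fps_const c)) V \<and>
        bij_betw f (power_series_over V) M \<and>
        linear_on (fps_scale (\<lambda>c. s (fps_const c))) (power_series_over V) s M f)"

text \<open>\<open>k[[h]]\<close>-linear and \<open>k[[h]]\<close>-bilinear extension of maps with values in power series.\<close>

definition fps_linear_ext :: "('a \<Rightarrow> 'b::ab_group_add fps) \<Rightarrow> 'a fps \<Rightarrow> 'b fps" where
  "fps_linear_ext f F = Abs_fps (\<lambda>n. \<Sum>i\<le>n. f (F $ i) $ (n - i))"

definition fps_bilinear_ext ::
  "('a \<Rightarrow> 'b \<Rightarrow> 'c::ab_group_add fps) \<Rightarrow> 'a fps \<Rightarrow> 'b fps \<Rightarrow> 'c fps" where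
  "fps_bilinear_ext f F G =
     Abs_fps (\<lambda>n. \<Sum>i\<le>n. \<Sum>j\<le>n - i. f (F $ i) (G $ j) $ (n - i - j))"

text \<open>The series with terms \<open>a i * h^i / i!\<close>.\<close>

definition divided_power_series ::
  "('k::field_char_0 \<Rightarrow> 'a::ab_group_add \<Rightarrow> 'a) \<Rightarrow> (nat \<Rightarrow> 'a) \<Rightarrow> 'a fps" where
  "divided_power_series s a = Abs_fps (\<lambda>i. s (inverse (fact i)) (a i))"

text \<open>\<open>F / h\<close> modulo \<open>h\<close>, for \<open>F\<close> divisible by \<open>h\<close>.\<close>

definition div_h_mod_h :: "'a::zero fps \<Rightarrow> 'a" where
  "div_h_mod_h F = fps_shift 1 F $ 0"

text \<open>
  The \<open>k[[h]]\<close>-bilinear extension of the evaluation pairing.  It is used for the pairing of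
  \<open>A[[h]]\<close> with its topological dual, and for the pairing of \<open>(A \<otimes> A)[[h]]\<close> with series of functionals
  on \<open>A \<otimes> A\<close>.
\<close>

definition fps_pairing :: "('x \<Rightarrow> 'k::field) fps \<Rightarrow> 'x fps \<Rightarrow> 'k fps" where
  "fps_pairing = fps_bilinear_ext (\<lambda>u x. fps_const (eval_pairing u x))"

definition fps_functional_tensor ::
  "('a \<Rightarrow> 'k::field) fps \<Rightarrow> ('a \<Rightarrow> 'k) fps \<Rightarrow> (('k, 'a) tensor2 \<Rightarrow> 'k) fps" where
  "fps_functional_tensor = fps_bilinear_ext (\<lambda>u v. fps_const (functional_tensor u v))"

definition fps_dual_op ::
  "('k::field \<Rightarrow> 'a::ab_group_add \<Rightarrow> 'a) \<Rightarrow> ('a fps \<Rightarrow> ('k, 'a) tensor2 fps) \<Rightarrow>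
   ('a \<Rightarrow> 'k) fps \<Rightarrow> ('a \<Rightarrow> 'k) fps \<Rightarrow> ('a \<Rightarrow> 'k) fps" where
  "fps_dual_op s \<Delta>h u v =
     (THE w. w \<in> power_series_over (dual s) \<and>
        (\<forall>x. fps_pairing w x = fps_pairing (fps_functional_tensor u v) (\<Delta>h x)))"

section \<open>The induced ASI bialgebra deformation and its quasiclassical limit\<close>

definition deformed_product ::
  "('k::field_char_0 \<Rightarrow> 'a::ab_group_add \<Rightarrow> 'a) \<Rightarrow> ('a \<Rightarrow> 'a \<Rightarrow> 'a) \<Rightarrow>
   ('a \<Rightarrow> 'a) \<Rightarrow> ('a \<Rightarrow> 'a) \<Rightarrow> 'a fps \<Rightarrow> 'a fps \<Rightarrow> 'a fps" where
  "deformed_product s m d1 d2 =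
     fps_bilinear_ext (\<lambda>x y. divided_power_series s (\<lambda>i. m ((d1 ^^ i) x) ((d2 ^^ i) y)))"

definition deformed_coproduct ::
  "('k::field_char_0 \<Rightarrow> 'a::ab_group_add \<Rightarrow> 'a) \<Rightarrow> ('a \<Rightarrow> ('k, 'a) tensor2) \<Rightarrow>
   ('a \<Rightarrow> 'a) \<Rightarrow> ('a \<Rightarrow> 'a) \<Rightarrow> 'a fps \<Rightarrow> ('k, 'a) tensor2 fps" where
  "deformed_coproduct s \<Delta> e1 e2 =
     fps_linear_ext
       (\<lambda>x. divided_power_series func_scale (\<lambda>i. tensor_map s (e1 ^^ i) (e2 ^^ i) (\<Delta> x)))"

definition fps_tensor_flip :: "('k::zero, 'a) tensor2 fps \<Rightarrow> ('k, 'a) tensor2 fps" where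
  "fps_tensor_flip T = Abs_fps (\<lambda>n. tensor_flip (T $ n))"

definition qcl_bracket ::
  "('a::ab_group_add fps \<Rightarrow> 'a fps \<Rightarrow> 'a fps) \<Rightarrow> 'a \<Rightarrow> 'a \<Rightarrow> 'a" where
  "qcl_bracket mh x y =
     div_h_mod_h (mh (fps_const x) (fps_const y) - mh (fps_const y) (fps_const x))"

definition qcl_cobracket ::
  "('a::zero fps \<Rightarrow> ('k::ab_group_add, 'a) tensor2 fps) \<Rightarrow> 'a \<Rightarrow> ('k, 'a) tensor2" where
  "qcl_cobracket \<Delta>h x = div_h_mod_h (\<Delta>h (fps_const x) - fps_tensor_flip (\<Delta>h (fps_const x)))"

section \<open>Matched pairs of associative algebras\<close>

record ('r, 'a, 'b) assoc_pair =
  scaleA :: "'r \<Rightarrow> 'a \<Rightarrow> 'a"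
  carrierA :: "'a set"
  multA :: "'a \<Rightarrow> 'a \<Rightarrow> 'a"
  scaleB :: "'r \<Rightarrow> 'b \<Rightarrow> 'b"
  carrierB :: "'b set"
  multB :: "'b \<Rightarrow> 'b \<Rightarrow> 'b"
  leftA :: "'a \<Rightarrow> 'b \<Rightarrow> 'b"
  rightA :: "'a \<Rightarrow> 'b \<Rightarrow> 'b"
  leftB :: "'b \<Rightarrow> 'a \<Rightarrow> 'a"
  rightB :: "'b \<Rightarrow> 'a \<Rightarrow> 'a"

definition bowtie_product ::
  "('r, 'a::ab_group_add, 'b::ab_group_add) assoc_pair \<Rightarrow> 'a \<times> 'b \<Rightarrow> 'a \<times> 'b \<Rightarrow> 'a \<times> 'b" where
  "bowtie_product M = (\<lambda>(x, u) (y, v).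
     (multA M x y + leftB M u y + rightB M v x, leftA M x v + rightA M y u + multB M u v))"

definition assoc_matched_pair ::
  "('r::comm_ring_1, 'a::ab_group_add, 'b::ab_group_add) assoc_pair \<Rightarrow> bool" where
  "assoc_matched_pair M \<longleftrightarrow>
     assoc_algebra (scaleA M) (carrierA M) (multA M) \<and>
     assoc_algebra (scaleB M) (carrierB M) (multB M) \<and>
     (\<forall>\<rho>\<in>{leftA M, rightA M}.
        bilinear_on (scaleA M) (carrierA M) (scaleB M) (carrierB M) (scaleB M) (carrierB M) \<rho>) \<and>
     (\<forall>\<rho>\<in>{leftB M, rightB M}.
        bilinear_on (scaleB M) (carrierB M) (scaleA M) (carrierA M) (scaleA M) (carrierA M) \<rho>) \<and>
     assoc_algebra (\<lambda>c. map_prod (scaleA M c) (scaleB M c)) (carrierA M \<times> carrierB M)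
       (bowtie_product M)"

definition topologically_free_assoc_matched_pair ::
  "('k::field fps, 'a::ab_group_add, 'b::ab_group_add) assoc_pair \<Rightarrow> bool" where
  "topologically_free_assoc_matched_pair M \<longleftrightarrow>
     topologically_free (scaleA M) (carrierA M) \<and> topologically_free (scaleB M) (carrierB M) \<and>
     assoc_matched_pair M"

text \<open>Equality of the underlying modules and, on these, of all operations.\<close>

definition assoc_pairs_coincide ::
  "('r, 'a, 'b) assoc_pair \<Rightarrow> ('r, 'a, 'b) assoc_pair \<Rightarrow> bool" where
  "assoc_pairs_coincide M N \<longleftrightarrow>
     scaleA M = scaleA N \<and> carrierA M = carrierA N \<and>
     scaleB M = scaleB N \<and> carrierB M = carrierB N \<and>
     (\<forall>x\<in>carrierA M. \<forall>y\<in>carrierA M. multA M x y = multA N x y) \<and>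
     (\<forall>u\<in>carrierB M. \<forall>v\<in>carrierB M. multB M u v = multB N u v) \<and>
     (\<forall>x\<in>carrierA M. \<forall>v\<in>carrierB M. leftA M x v = leftA N x v \<and> rightA M x v = rightA N x v) \<and>
     (\<forall>v\<in>carrierB M. \<forall>x\<in>carrierA M. leftB M v x = leftB N v x \<and> rightB M v x = rightB N v x)"

text \<open>
  The tuple \<open>((A,\<circ>), (B,\<cdot>), R\<^sub>\<circ>*, L\<^sub>\<circ>*, R\<^sub>\<cdot>*, L\<^sub>\<cdot>*)\<close> for algebras \<open>A\<close> and \<open>B\<close> in duality via a
  pairing \<open>pr\<close> of \<open>B\<close> with \<open>A\<close>, where \<open>L(x) y = x \<circ> y\<close> and \<open>R(x) y = y \<circ> x\<close>.
\<close>

definition duality_pair ::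
  "('r \<Rightarrow> 'a \<Rightarrow> 'a) \<Rightarrow> 'a set \<Rightarrow> ('a \<Rightarrow> 'a \<Rightarrow> 'a) \<Rightarrow>
   ('r \<Rightarrow> 'b \<Rightarrow> 'b) \<Rightarrow> 'b set \<Rightarrow> ('b \<Rightarrow> 'b \<Rightarrow> 'b) \<Rightarrow> ('b \<Rightarrow> 'a \<Rightarrow> 'c) \<Rightarrow>
   ('r, 'a, 'b) assoc_pair" where
  "duality_pair sA A mA sB B mB pr = \<lparr>
     scaleA = sA, carrierA = A, multA = mA, scaleB = sB, carrierB = B, multB = mB,
     leftA = (\<lambda>x. transpose_wrt pr B A (\<lambda>y. mA y x)),
     rightA = (\<lambda>x. transpose_wrt pr B A (\<lambda>y. mA x y)),
     leftB = (\<lambda>u. transpose_wrt (\<lambda>x w. pr w x) A B (\<lambda>w. mB w u)),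
     rightB = (\<lambda>u. transpose_wrt (\<lambda>x w. pr w x) A B (\<lambda>w. mB u w)) \<rparr>"

definition asi_assoc_pair ::
  "('k::field \<Rightarrow> 'a::ab_group_add \<Rightarrow> 'a) \<Rightarrow> ('a \<Rightarrow> 'a \<Rightarrow> 'a) \<Rightarrow>
   ('a \<Rightarrow> ('k, 'a) tensor2) \<Rightarrow> ('k, 'a, 'a \<Rightarrow> 'k) assoc_pair" where
  "asi_assoc_pair s m \<Delta> =
     duality_pair s UNIV m func_scale (dual s) (dual_op \<Delta>) eval_pairing"

text \<open>The tuple corresponding to \<open>(A[[h]], mh, \<Delta>h)\<close>.\<close>

definition fps_asi_assoc_pair ::
  "('k::field \<Rightarrow> 'a::ab_group_add \<Rightarrow> 'a) \<Rightarrow> ('a fps \<Rightarrow> 'a fps \<Rightarrow> 'a fps) \<Rightarrow>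
   ('a fps \<Rightarrow> ('k, 'a) tensor2 fps) \<Rightarrow> ('k fps, 'a fps, ('a \<Rightarrow> 'k) fps) assoc_pair" where
  "fps_asi_assoc_pair s mh \<Delta>h =
     duality_pair (fps_scale s) (power_series_over UNIV) mh
       (fps_scale func_scale) (power_series_over (dual s)) (fps_dual_op s \<Delta>h) fps_pairing"

text \<open>
  The deformation induced by operators \<open>D1\<close>, \<open>D2\<close> on \<open>A \<oplus> B\<close> that preserve \<open>A\<close> and \<open>B\<close>; \<open>a i x\<close>
  and \<open>b i u\<close> below are the restrictions of the powers of \<open>D1\<close> (likewise \<open>a'\<close>, \<open>b'\<close> for \<open>D2\<close>).
\<close>

definition assoc_pair_deformation ::
  "('k::field_char_0, 'a::ab_group_add, 'b::ab_group_add) assoc_pair \<Rightarrow>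
   ('a \<times> 'b \<Rightarrow> 'a \<times> 'b) \<Rightarrow> ('a \<times> 'b \<Rightarrow> 'a \<times> 'b) \<Rightarrow> ('k fps, 'a fps, 'b fps) assoc_pair" where
  "assoc_pair_deformation M D1 D2 =
    (let a = (\<lambda>i x. fst ((D1 ^^ i) (x, 0))); a' = (\<lambda>i x. fst ((D2 ^^ i) (x, 0)));
         b = (\<lambda>i u. snd ((D1 ^^ i) (0, u))); b' = (\<lambda>i u. snd ((D2 ^^ i) (0, u)));
         expA = divided_power_series (scaleA M); expB = divided_power_series (scaleB M)
     in \<lparr>
       scaleA = fps_scale (scaleA M),
       carrierA = power_series_over (carrierA M),
       multA = fps_bilinear_ext (\<lambda>x y. expA (\<lambda>i. multA M (a i x) (a' i y))),
       scaleB = fps_scale (scaleB M),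
       carrierB = power_series_over (carrierB M),
       multB = fps_bilinear_ext (\<lambda>u v. expB (\<lambda>i. multB M (b i u) (b' i v))),
       leftA = fps_bilinear_ext (\<lambda>x v. expB (\<lambda>i. leftA M (a i x) (b' i v))),
       rightA = fps_bilinear_ext (\<lambda>x v. expB (\<lambda>i. rightA M (a' i x) (b i v))),
       leftB = fps_bilinear_ext (\<lambda>v x. expA (\<lambda>i. leftB M (b i v) (a' i x))),
       rightB = fps_bilinear_ext (\<lambda>v x. expA (\<lambda>i. rightB M (b' i v) (a i x))) \<rparr>)"

section \<open>Matched pairs of Poisson algebras\<close>

definition poisson_algebra ::
  "('k::field \<Rightarrow> 'a::ab_group_add \<Rightarrow> 'a) \<Rightarrow> 'a set \<Rightarrow> ('a \<Rightarrow> 'a \<Rightarrow> 'a) \<Rightarrow>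
   ('a \<Rightarrow> 'a \<Rightarrow> 'a) \<Rightarrow> bool" where
  "poisson_algebra s V br m \<longleftrightarrow>
     assoc_algebra s V m \<and> (\<forall>x\<in>V. \<forall>y\<in>V. m x y = m y x) \<and>
     bilinear_on s V s V s V br \<and> (\<forall>x\<in>V. br x x = 0) \<and>
     (\<forall>x\<in>V. \<forall>y\<in>V. \<forall>z\<in>V. br x (br y z) + br y (br z x) + br z (br x y) = 0) \<and>
     (\<forall>x\<in>V. \<forall>y\<in>V. \<forall>z\<in>V. br x (m y z) = m (br x y) z + m y (br x z))"

record ('k, 'a, 'b) poisson_pair =
  scaleP :: "'k \<Rightarrow> 'a \<Rightarrow> 'a"
  carrierP :: "'a set"
  bracketP :: "'a \<Rightarrow> 'a \<Rightarrow> 'a"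
  multP :: "'a \<Rightarrow> 'a \<Rightarrow> 'a"
  scaleQ :: "'k \<Rightarrow> 'b \<Rightarrow> 'b"
  carrierQ :: "'b set"
  bracketQ :: "'b \<Rightarrow> 'b \<Rightarrow> 'b"
  multQ :: "'b \<Rightarrow> 'b \<Rightarrow> 'b"
  rho_bracketP :: "'a \<Rightarrow> 'b \<Rightarrow> 'b"
  rho_multP :: "'a \<Rightarrow> 'b \<Rightarrow> 'b"
  rho_bracketQ :: "'b \<Rightarrow> 'a \<Rightarrow> 'a"
  rho_multQ :: "'b \<Rightarrow> 'a \<Rightarrow> 'a"

definition bowtie_bracket ::
  "('k, 'a::ab_group_add, 'b::ab_group_add) poisson_pair \<Rightarrow> 'a \<times> 'b \<Rightarrow> 'a \<times> 'b \<Rightarrow> 'a \<times> 'b" where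
  "bowtie_bracket M = (\<lambda>(x, u) (y, v).
     (bracketP M x y + rho_bracketQ M u y - rho_bracketQ M v x,
      rho_bracketP M x v - rho_bracketP M y u + bracketQ M u v))"

definition bowtie_poisson_product ::
  "('k, 'a::ab_group_add, 'b::ab_group_add) poisson_pair \<Rightarrow> 'a \<times> 'b \<Rightarrow> 'a \<times> 'b \<Rightarrow> 'a \<times> 'b" where
  "bowtie_poisson_product M = (\<lambda>(x, u) (y, v).
     (multP M x y + rho_multQ M u y + rho_multQ M v x,
      rho_multP M x v + rho_multP M y u + multQ M u v))"

definition poisson_matched_pair ::
  "('k::field, 'a::ab_group_add, 'b::ab_group_add) poisson_pair \<Rightarrow> bool" where
  "poisson_matched_pair M \<longleftrightarrow>
     poisson_algebra (scaleP M) (carrierP M) (bracketP M) (multP M) \<and>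
     poisson_algebra (scaleQ M) (carrierQ M) (bracketQ M) (multQ M) \<and>
     (\<forall>\<rho>\<in>{rho_bracketP M, rho_multP M}.
        bilinear_on (scaleP M) (carrierP M) (scaleQ M) (carrierQ M) (scaleQ M) (carrierQ M) \<rho>) \<and>
     (\<forall>\<rho>\<in>{rho_bracketQ M, rho_multQ M}.
        bilinear_on (scaleQ M) (carrierQ M) (scaleP M) (carrierP M) (scaleP M) (carrierP M) \<rho>) \<and>
     poisson_algebra (\<lambda>c. map_prod (scaleP M c) (scaleQ M c)) (carrierP M \<times> carrierQ M)
       (bowtie_bracket M) (bowtie_poisson_product M)"

definition poisson_pairs_coincide ::
  "('k, 'a, 'b) poisson_pair \<Rightarrow> ('k, 'a, 'b) poisson_pair \<Rightarrow> bool" where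
  "poisson_pairs_coincide M N \<longleftrightarrow>
     scaleP M = scaleP N \<and> carrierP M = carrierP N \<and>
     scaleQ M = scaleQ N \<and> carrierQ M = carrierQ N \<and>
     (\<forall>x\<in>carrierP M. \<forall>y\<in>carrierP M.
        bracketP M x y = bracketP N x y \<and> multP M x y = multP N x y) \<and>
     (\<forall>u\<in>carrierQ M. \<forall>v\<in>carrierQ M.
        bracketQ M u v = bracketQ N u v \<and> multQ M u v = multQ N u v) \<and>
     (\<forall>x\<in>carrierP M. \<forall>v\<in>carrierQ M.
        rho_bracketP M x v = rho_bracketP N x v \<and> rho_multP M x v = rho_multP N x v) \<and>
     (\<forall>v\<in>carrierQ M. \<forall>x\<in>carrierP M.
        rho_bracketQ M v x = rho_bracketQ N v x \<and> rho_multQ M v x = rho_multQ N v x)"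

text \<open>
  The quasiclassical limit of a deformation \<open>Mh\<close> of a commutative matched pair \<open>M\<close>; there
  \<open>leftA M = rightA M\<close> and \<open>leftB M = rightB M\<close>.
\<close>

definition assoc_pair_qcl ::
  "('k, 'a::ab_group_add, 'b::ab_group_add) assoc_pair \<Rightarrow> ('k fps, 'a fps, 'b fps) assoc_pair \<Rightarrow>
   ('k, 'a, 'b) poisson_pair" where
  "assoc_pair_qcl M Mh = \<lparr>
     scaleP = scaleA M, carrierP = carrierA M,
     bracketP = qcl_bracket (multA Mh), multP = multA M,
     scaleQ = scaleB M, carrierQ = carrierB M,
     bracketQ = qcl_bracket (multB Mh), multQ = multB M,
     rho_bracketP = (\<lambda>x v. div_h_mod_h
       (leftA Mh (fps_const x) (fps_const v) - rightA Mh (fps_const x) (fps_const v))),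
     rho_multP = leftA M,
     rho_bracketQ = (\<lambda>v x. div_h_mod_h
       (leftB Mh (fps_const v) (fps_const x) - rightB Mh (fps_const v) (fps_const x))),
     rho_multQ = leftB M \<rparr>"

text \<open>
  The tuple \<open>((A,{,},\<circ>), (A*,[,],\<cdot>), -ad\<^sub>{\<^sub>,\<^sub>}*, R\<^sub>\<circ>*, -ad\<^sub>[\<^sub>,\<^sub>]*, R\<^sub>\<cdot>*)\<close> corresponding to
  \<open>(A, {,}, \<circ>, \<delta>, \<Delta>)\<close>.
\<close>

definition bialgebra_poisson_pair ::
  "('k::field \<Rightarrow> 'a::ab_group_add \<Rightarrow> 'a) \<Rightarrow> ('a \<Rightarrow> 'a \<Rightarrow> 'a) \<Rightarrow> ('a \<Rightarrow> 'a \<Rightarrow> 'a) \<Rightarrow>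
   ('a \<Rightarrow> ('k, 'a) tensor2) \<Rightarrow> ('a \<Rightarrow> ('k, 'a) tensor2) \<Rightarrow> ('k, 'a, 'a \<Rightarrow> 'k) poisson_pair" where
  "bialgebra_poisson_pair s br m \<delta> \<Delta> = \<lparr>
     scaleP = s, carrierP = UNIV, bracketP = br, multP = m,
     scaleQ = func_scale, carrierQ = dual s, bracketQ = dual_op \<delta>, multQ = dual_op \<Delta>,
     rho_bracketP = (\<lambda>x u. - transpose_wrt eval_pairing (dual s) UNIV (\<lambda>y. br x y) u),
     rho_multP = (\<lambda>x. transpose_wrt eval_pairing (dual s) UNIV (\<lambda>y. m y x)),
     rho_bracketQ = (\<lambda>u x.
       - transpose_wrt (\<lambda>x w. eval_pairing w x) UNIV (dual s) (\<lambda>w. dual_op \<delta> u w) x),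
     rho_multQ = (\<lambda>u.
       transpose_wrt (\<lambda>x w. eval_pairing w x) UNIV (dual s) (\<lambda>w. dual_op \<Delta> w u)) \<rparr>"

end

theory Submission
  imports Defs
begin

text \<open>
  A commutative and cocommutative ASI bialgebra \<open>A\<close> is a pair of commutative associative algebras
  \<open>A\<close> and \<open>A*\<close> in duality whose products are linked by one identity,
  \<open>\<langle>u \<cdot> v, x \<circ> y\<rangle> = \<langle>x.v, u.y\<rangle> + \<langle>y.u, v.x\<rangle>\<close>, where \<open>x.v\<close> and \<open>u.y\<close> are the transposed
  multiplications.  In this form the data are symmetric in \<open>A\<close> and \<open>A*\<close>.  The locale \<open>dual_pair\<close>
  records them, and its lemma \<open>swap\<close> turns each fact about \<open>A\<close> into one about \<open>A*\<close>; over a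
  finite-dimensional space the bidual causes no asymmetry.

  The direct sum \<open>A \<oplus> A*\<close> carries an invariant symmetric form, and with the identity above this makes
  the product of the double associative (\<open>assoc_double\<close>).  A coherent derivation \<open>(d, e)\<close> gives the
  derivation \<open>d \<oplus> e*\<close> of the double.  So there are two commuting derivations \<open>D1\<close>, \<open>D2\<close> of a
  commutative associative algebra.  For these, multiplication after \<open>exp (h D1 \<otimes> D2)\<close> is
  associative (\<open>assoc_algebra_deformed_product\<close>), and \<open>D1 a \<odot> D2 b - D1 b \<odot> D2 a\<close> is a Poisson
  bracket (\<open>poisson_algebra_commuting_derivations\<close>).  The first is the product on the sum defined by
  the deformed matched pair, the second the bracket defined by its quasiclassical limit; this
  gives the two matched pairs.

  What remains is to identify them with the matched pairs obtained by duality, that is, to show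
  that the deformed actions are the transposes of the deformed multiplications.  The hypotheses
  \<open>d1 x \<circ> d2 y = e2 (x \<circ> d1 y) = e1 (d2 x \<circ> y)\<close> can be iterated because \<open>d1\<close> and \<open>d2\<close> commute, and
  the result for the \<open>k\<close>-th powers compares the terms of degree \<open>k\<close> in the exponential
  (\<open>pr_actionsA\<close>).  The two hypotheses on \<open>\<Delta>\<close> are the same conditions for the dual product, so the
  actions on the other side need no separate argument.  For the quasiclassical limits only the
  terms of degree 1 matter.
\<close>

section \<open>Convolution sums\<close>

text \<open>
  A coefficient of an iterated Cauchy product is a sum over tuples with a prescribed total.  In this
  form every rearrangement of such sums is a change of variables.
\<close>

definition tuples2 :: "nat \<Rightarrow> (nat \<times> nat) set" where
  "tuples2 n = {(i, j). i + j = n}"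

definition tuples3 :: "nat \<Rightarrow> (nat \<times> nat \<times> nat) set" where
  "tuples3 n = {(i, j, k). i + j + k = n}"

definition tuples4 :: "nat \<Rightarrow> (nat \<times> nat \<times> nat \<times> nat) set" where
  "tuples4 n = {(i, j, k, l). i + j + k + l = n}"

lemma finite_tuples [simp]: "finite (tuples2 n)" "finite (tuples3 n)" "finite (tuples4 n)"
proof -
  have "tuples2 n \<subseteq> {..n} \<times> {..n}" "tuples3 n \<subseteq> {..n} \<times> {..n} \<times> {..n}"
    "tuples4 n \<subseteq> {..n} \<times> {..n} \<times> {..n} \<times> {..n}"
    by (auto simp: tuples2_def tuples3_def tuples4_def)
  then show "finite (tuples2 n)" "finite (tuples3 n)" "finite (tuples4 n)"
    by (simp_all add: finite_subset)
qed

lemma sum_tuples2: "(\<Sum>i\<le>n. g i (n - i)) = (\<Sum>(i, j)\<in>tuples2 n. g i j)"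
  by (rule sum.reindex_bij_witness[of _ fst "\<lambda>i. (i, n - i)"]) (auto simp: tuples2_def)

lemma sum_tuples3:
  "(\<Sum>i\<le>n. \<Sum>j\<le>n - i. g i j (n - i - j)) = (\<Sum>(i, j, k)\<in>tuples3 n. g i j k)"
  unfolding sum.Sigma[OF finite_atMost ballI[OF finite_atMost]]
  by (rule sum.reindex_bij_witness[of _ "\<lambda>(i, j, k). (i, j)" "\<lambda>(i, j). (i, j, n - i - j)"])
    (auto simp: tuples3_def)

lemma sum_Sigma:
  "finite A \<Longrightarrow> (\<And>x. x \<in> A \<Longrightarrow> finite (B x)) \<Longrightarrow>
    sum g (Sigma A B) = (\<Sum>x\<in>A. \<Sum>y\<in>B x. g (x, y))"
  by (simp add: sum.Sigma)

lemma fps_scale_nth: "fps_scale s c F $ n = (\<Sum>(i, j)\<in>tuples2 n. s (c $ i) (F $ j))"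
  by (simp add: fps_scale_def sum_tuples2[of "\<lambda>i j. s (c $ i) (F $ j)"])

lemma fps_bilinear_ext_nth:
  "fps_bilinear_ext f F G $ n = (\<Sum>(i, j, k)\<in>tuples3 n. f (F $ i) (G $ j) $ k)"
  unfolding fps_bilinear_ext_def
  by (simp only: fps_nth_Abs_fps sum_tuples3[of "\<lambda>i j k. f (F $ i) (G $ j) $ k"])

lemma fps_bilinear_ext_swap:
  "fps_bilinear_ext f F G = fps_bilinear_ext (\<lambda>y x. f x y) G F"
proof (rule fps_ext)
  fix n show "fps_bilinear_ext f F G $ n = fps_bilinear_ext (\<lambda>y x. f x y) G F $ n"
    unfolding fps_bilinear_ext_nth
    by (rule sum.reindex_bij_witness[of _ "\<lambda>(j, i, k). (i, j, k)" "\<lambda>(i, j, k). (j, i, k)"])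
      (auto simp: tuples3_def)
qed

lemma fps_bilinear_ext_const_nth:
  "fps_bilinear_ext (\<lambda>x y. fps_const (b x y)) F G $ n = (\<Sum>(i, j)\<in>tuples2 n. b (F $ i) (G $ j))"
proof -
  have "(\<Sum>(i, j)\<in>tuples2 n. b (F $ i) (G $ j))
      = (\<Sum>(i, j, k)\<in>{(i, j, k) \<in> tuples3 n. k = 0}. b (F $ i) (G $ j))"
    by (rule sum.reindex_bij_witness[of _ "\<lambda>(i, j, k). (i, j)" "\<lambda>(i, j). (i, j, 0)"])
      (auto simp: tuples2_def tuples3_def)
  also have "\<dots> = (\<Sum>(i, j, k)\<in>tuples3 n. fps_const (b (F $ i) (G $ j)) $ k)"
    by (rule sum.mono_neutral_cong_left) (auto split: if_splits)
  finally show ?thesis by (simp add: fps_bilinear_ext_nth)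
qed

section \<open>Linear maps on subspaces\<close>

lemma linear_onD:
  assumes "linear_on s V t W f"
  shows "x \<in> V \<Longrightarrow> f x \<in> W" "x \<in> V \<Longrightarrow> y \<in> V \<Longrightarrow> f (x + y) = f x + f y"
    "x \<in> V \<Longrightarrow> f (s c x) = t c (f x)"
  using assms by (auto simp: linear_on_def)

lemma linear_on_sum:
  assumes "module s" "module.subspace s V" "linear_on s V t W f" "\<And>i. i \<in> I \<Longrightarrow> x i \<in> V"
  shows "f (\<Sum>i\<in>I. x i) = (\<Sum>i\<in>I. f (x i))"
proof -
  interpret module s by fact
  have V0: "0 \<in> V" using assms(2) by (rule subspace_0)
  have "f (0 + 0) = f 0 + f 0" using assms(3) V0 unfolding linear_on_def by blast
  then have f0: "f 0 = 0" by simp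
  show ?thesis using assms(4)
  proof (induction I rule: infinite_finite_induct)
    case (insert i I)
    then have "sum x I \<in> V" by (intro subspace_sum[OF assms(2)]) auto
    with insert show ?case by (simp add: linear_onD(2)[OF assms(3)])
  qed (simp_all add: f0)
qed

lemma linear_on_zero:
  assumes "module s" "module.subspace s V" "linear_on s V t W f"
  shows "f 0 = 0"
  using linear_on_sum[OF assms, of "{}"] by simp

lemma linear_on_diff:
  assumes "module s" "module.subspace s V" "linear_on s V t W f" "x \<in> V" "y \<in> V"
  shows "f (x - y) = f x - f y"
proof -
  interpret module s by fact
  have "f ((x - y) + y) = f (x - y) + f y"
    using assms by (intro linear_onD(2)[OF assms(3)] subspace_diff) auto
  then show ?thesis by (simp add: algebra_simps)
qed

lemma linear_on_comp:
  "linear_on s V t W f \<Longrightarrow> linear_on t W r U g \<Longrightarrow> linear_on s V r U (\<lambda>x. g (f x))"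
  by (auto simp: linear_on_def)

lemma linear_on_funpow: "linear_on s V s V f \<Longrightarrow> linear_on s V s V (f ^^ n)"
  by (induction n) (auto simp: linear_on_def)

lemma linear_on_scale_comp:
  assumes "module r" "module.subspace r U" "linear_on s V r U f"
  shows "linear_on s V r U (\<lambda>x. r c (f x))"
proof -
  interpret module r by fact
  show ?thesis
    using assms(2,3) by (auto simp: linear_on_def scale_right_distrib scale_left_commute subspace_scale mult.commute)
qed

lemma linear_on_diff_comp:
  assumes "module r" "module.subspace r U" "linear_on s V r U f" "linear_on s V r U g"
  shows "linear_on s V r U (\<lambda>x. f x - g x)"
proof -
  interpret module r by fact
  show ?thesis
    using assms(2-) by (auto simp: linear_on_def scale_right_diff_distrib subspace_diff algebra_simps)
qed

lemma bilinear_on_swap: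
  "bilinear_on s V t W r U f \<Longrightarrow> bilinear_on t W s V r U (\<lambda>y x. f x y)"
  by (auto simp: bilinear_on_def)

lemma bilinear_on_comp:
  assumes "bilinear_on s V t W r U f" "linear_on s V s V a" "linear_on t W t W b"
  shows "bilinear_on s V t W r U (\<lambda>x y. f (a x) (b y))"
  using assms by (auto simp: bilinear_on_def linear_on_def)

lemma bilinear_on_diff_comp:
  assumes "module r" "module.subspace r U" "bilinear_on s V t W r U f" "bilinear_on s V t W r U g"
  shows "bilinear_on s V t W r U (\<lambda>x y. f x y - g x y)"
  using assms(3,4) unfolding bilinear_on_def
  by (auto intro: linear_on_diff_comp[OF assms(1,2)])

lemma bilinear_on_scale_comp:
  assumes "module r" "module.subspace r U" "bilinear_on s V t W r U f"
  shows "bilinear_on s V t W r U (\<lambda>x y. r c (f x y))"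
  using assms(3) unfolding bilinear_on_def
  by (auto intro: linear_on_scale_comp[OF assms(1,2)])

lemma bilinear_on_cong:
  assumes "\<And>x y. x \<in> V \<Longrightarrow> y \<in> W \<Longrightarrow> f x y = g x y"
    and "module s" "module.subspace s V" "module t" "module.subspace t W"
  shows "bilinear_on s V t W r U f \<longleftrightarrow> bilinear_on s V t W r U g"
proof -
  interpret s: module s by fact
  interpret t: module t by fact
  show ?thesis using assms(1,3,5)
    by (auto simp: bilinear_on_def linear_on_def s.subspace_add s.subspace_scale
        t.subspace_add t.subspace_scale)
qed

lemma bilinear_onD:
  assumes "bilinear_on s V t W r U f"
  shows "x \<in> V \<Longrightarrow> y \<in> W \<Longrightarrow> f x y \<in> U"
    "x \<in> V \<Longrightarrow> x' \<in> V \<Longrightarrow> y \<in> W \<Longrightarrow> f (x + x') y = f x y + f x' y"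
    "x \<in> V \<Longrightarrow> y \<in> W \<Longrightarrow> y' \<in> W \<Longrightarrow> f x (y + y') = f x y + f x y'"
    "x \<in> V \<Longrightarrow> y \<in> W \<Longrightarrow> f (s c x) y = r c (f x y)"
    "x \<in> V \<Longrightarrow> y \<in> W \<Longrightarrow> f x (t c y) = r c (f x y)"
  using assms by (auto simp: bilinear_on_def linear_on_def)

lemma module_map_prod:
  assumes "module s" "module t"
  shows "module (\<lambda>c. map_prod (s c) (t c))"
proof -
  interpret s: module s by fact
  interpret t: module t by fact
  show ?thesis
    by unfold_locales
      (auto simp: s.scale_right_distrib t.scale_right_distrib s.scale_left_distrib t.scale_left_distrib)
qed

lemma subspace_Times:
  assumes "module s" "module t" "module.subspace s V" "module.subspace t W"
  shows "module.subspace (\<lambda>c. map_prod (s c) (t c)) (V \<times> W)"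
proof -
  interpret s: module s by fact
  interpret t: module t by fact
  interpret st: module "\<lambda>c. map_prod (s c) (t c)" using assms(1,2) by (rule module_map_prod)
  show ?thesis
    using assms(3,4)
    by (intro st.subspaceI)
      (auto simp: zero_prod_def s.subspace_0 t.subspace_0 s.subspace_add t.subspace_add
        s.subspace_scale t.subspace_scale)
qed

lemma bilinear_on_Times:
  assumes s: "module s" "module.subspace s V" and t: "module t" "module.subspace t W"
    and mA: "bilinear_on s V s V s V mA" and mB: "bilinear_on t W t W t W mB"
    and lA: "bilinear_on s V t W t W lA" and rA: "bilinear_on s V t W t W rA"
    and lB: "bilinear_on t W s V s V lB" and rB: "bilinear_on t W s V s V rB"
  shows "bilinear_on (\<lambda>c. map_prod (s c) (t c)) (V \<times> W) (\<lambda>c. map_prod (s c) (t c)) (V \<times> W)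
    (\<lambda>c. map_prod (s c) (t c)) (V \<times> W)
    (\<lambda>(x, u) (y, v). (mA x y + lB u y + rB v x, lA x v + rA y u + mB u v))"
proof -
  interpret s: module s by fact
  interpret t: module t by fact
  note mem = bilinear_onD(1)[OF mA] bilinear_onD(1)[OF mB] bilinear_onD(1)[OF lA]
    bilinear_onD(1)[OF rA] bilinear_onD(1)[OF lB] bilinear_onD(1)[OF rB]
  note bil = bilinear_onD(2-5)[OF mA] bilinear_onD(2-5)[OF mB] bilinear_onD(2-5)[OF lA]
    bilinear_onD(2-5)[OF rA] bilinear_onD(2-5)[OF lB] bilinear_onD(2-5)[OF rB]
  show ?thesis
    unfolding bilinear_on_def linear_on_def
    by (auto simp: mem bil s.subspace_add[OF s(2)] t.subspace_add[OF t(2)]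
        s.scale_right_distrib t.scale_right_distrib algebra_simps)
qed

lemma map_prod_funpow:
  fixes f :: "'a \<Rightarrow> 'a" and g :: "'b \<Rightarrow> 'b"
  shows "map_prod f g ^^ n = map_prod (f ^^ n) (g ^^ n)"
  by (induction n) (auto simp: fun_eq_iff)

section \<open>Modules of power series\<close>

lemma power_series_over_nth: "F \<in> power_series_over V \<Longrightarrow> F $ n \<in> V"
  by (simp add: power_series_over_def)

lemma module_fps_scale:
  fixes s :: "'r::comm_ring_1 \<Rightarrow> 'a::ab_group_add \<Rightarrow> 'a"
  assumes "module s"
  shows "module (fps_scale s)"
proof -
  interpret module s by fact
  have assoc: "fps_scale s a (fps_scale s b F) = fps_scale s (a * b) F" for a b F
  proof (rule fps_ext)
    fix n
    have "fps_scale s a (fps_scale s b F) $ n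
        = (\<Sum>((i, m), (j, l))\<in>(SIGMA p:tuples2 n. tuples2 (snd p)). s (a $ i * b $ j) (F $ l))"
      by (simp add: fps_scale_nth scale_sum_right sum_Sigma case_prod_unfold)
    also have "\<dots> = (\<Sum>((m, l), (i, j))\<in>(SIGMA p:tuples2 n. tuples2 (fst p)). s (a $ i * b $ j) (F $ l))"
      by (rule sum.reindex_bij_witness[of _
            "\<lambda>((m, l), (i, j)). ((i, j + l), (j, l))" "\<lambda>((i, m), (j, l)). ((i + j, l), (i, j))"])
        (auto simp: tuples2_def)
    also have "\<dots> = fps_scale s (a * b) F $ n"
      by (simp add: fps_scale_nth fps_mult_nth atLeast0AtMost sum_tuples2[of "\<lambda>i j. a $ i * b $ j" for a b]
          scale_sum_left sum_Sigma case_prod_unfold)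
    finally show "fps_scale s a (fps_scale s b F) $ n = fps_scale s (a * b) F $ n" .
  qed
  show ?thesis
  proof
    fix a b :: "'r fps" and F G :: "'a fps"
    show "fps_scale s a (F + G) = fps_scale s a F + fps_scale s a G"
      by (simp add: fps_eq_iff fps_scale_def scale_right_distrib sum.distrib)
    show "fps_scale s (a + b) F = fps_scale s a F + fps_scale s b F"
      by (simp add: fps_eq_iff fps_scale_def scale_left_distrib sum.distrib)
    show "fps_scale s a (fps_scale s b F) = fps_scale s (a * b) F" by (rule assoc)
    have "(\<Sum>i\<le>n. s (1 $ i) (F $ (n - i))) = (\<Sum>i\<in>{0}. s (1 $ i) (F $ (n - i)))" for n
      by (rule sum.mono_neutral_right) auto
    then show "fps_scale s 1 F = F"
      by (simp add: fps_eq_iff fps_scale_def)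
  qed
qed

lemma subspace_power_series_over:
  fixes s :: "'r::comm_ring_1 \<Rightarrow> 'a::ab_group_add \<Rightarrow> 'a"
  assumes "module s" "module.subspace s V"
  shows "module.subspace (fps_scale s) (power_series_over V)"
proof -
  interpret module s by fact
  interpret h: module "fps_scale s" using assms(1) by (rule module_fps_scale)
  show ?thesis using assms(2)
    by (intro h.subspaceI)
      (auto simp: power_series_over_def fps_scale_def subspace_0 subspace_add
        intro!: subspace_sum subspace_scale)
qed

lemma fps_scale_const_nth:
  assumes "module s"
  shows "fps_scale s (fps_const c) F $ n = s c (F $ n)"
proof -
  interpret module s by fact
  have "(\<Sum>i\<le>n. s (fps_const c $ i) (F $ (n - i))) = (\<Sum>i\<in>{0}. s (fps_const c $ i) (F $ (n - i)))"
    by (rule sum.mono_neutral_right) auto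
  then show ?thesis by (simp add: fps_scale_def)
qed

text \<open>
  The required copy of \<open>V\<close> inside \<open>V[[h]]\<close> consists of the constant series; a series of constant
  series is sent to the series of their constant terms.
\<close>

lemma topologically_free_power_series_over:
  fixes s :: "'k::field \<Rightarrow> 'a::ab_group_add \<Rightarrow> 'a"
  assumes "module s" "module.subspace s V"
  shows "topologically_free (fps_scale s) (power_series_over V)"
proof -
  interpret s: module s by fact
  interpret h: module "fps_scale s" using assms(1) by (rule module_fps_scale)
  let ?s0 = "\<lambda>c. fps_scale s (fps_const c)"
  interpret s0: module ?s0
    by unfold_locales
      (simp_all add: h.scale_right_distrib flip: fps_const_add fps_const_mult h.scale_left_distrib)
  let ?f = "\<lambda>F. Abs_fps (\<lambda>n. F $ n $ 0)"
  have const: "?s0 c (fps_const x) = fps_const (s c x)" for c x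
    by (rule fps_ext) (simp add: fps_scale_const_nth[OF assms(1)])
  have mem: "?f F \<in> power_series_over V" if F: "F \<in> power_series_over (fps_const ` V)" for F
  proof -
    have "F $ n $ 0 \<in> V" for n
      using power_series_over_nth[OF F, of n] by auto
    then show ?thesis by (simp add: power_series_over_def)
  qed
  have "s0.subspace (fps_const ` V)"
    using assms(2)
    by (intro s0.subspaceI)
      (auto simp: const s.subspace_0 s.subspace_add s.subspace_scale
        intro: image_eqI[of _ _ 0] simp flip: fps_const_0_eq_0)
  moreover have "bij_betw ?f (power_series_over (fps_const ` V)) (power_series_over V)"
  proof (rule bij_betw_byWitness[where f' = "\<lambda>G. Abs_fps (\<lambda>n. fps_const (G $ n))"])
    show "\<forall>F\<in>power_series_over (fps_const ` V). Abs_fps (\<lambda>n. fps_const (?f F $ n)) = F"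
    proof
      fix F assume F: "F \<in> power_series_over (fps_const ` V)"
      have "fps_const (F $ n $ 0) = F $ n" for n
        using power_series_over_nth[OF F, of n] by auto
      then show "Abs_fps (\<lambda>n. fps_const (?f F $ n)) = F" by (simp add: fps_eq_iff)
    qed
    show "?f ` power_series_over (fps_const ` V) \<subseteq> power_series_over V"
      using mem by blast
  qed (auto simp: power_series_over_def fps_eq_iff)
  moreover have "linear_on (fps_scale ?s0) (power_series_over (fps_const ` V)) (fps_scale s)
      (power_series_over V) ?f"
    unfolding linear_on_def
  proof (intro conjI ballI allI)
    fix c F assume "F \<in> power_series_over (fps_const ` V)"
    have "(\<Sum>i\<in>I. G i) $ 0 = (\<Sum>i\<in>I. G i $ 0)" for I :: "nat set" and G :: "nat \<Rightarrow> 'a fps"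
      by (induction I rule: infinite_finite_induct) auto
    then show "?f (fps_scale ?s0 c F) = fps_scale s c (?f F)"
      by (simp add: fps_eq_iff fps_scale_const_nth[OF assms(1)] fps_scale_def[of ?s0]
          fps_scale_def[of s c "Abs_fps _"])
  qed (use mem in \<open>auto simp: fps_eq_iff\<close>)
  moreover have "h.subspace (power_series_over V)"
    using assms by (rule subspace_power_series_over)
  ultimately show ?thesis
    unfolding topologically_free_def using h.module_axioms by blast
qed

lemma bilinear_on_fps_bilinear_ext:
  fixes s :: "'k::comm_ring_1 \<Rightarrow> 'a::ab_group_add \<Rightarrow> 'a"
    and t :: "'k \<Rightarrow> 'b::ab_group_add \<Rightarrow> 'b" and r :: "'k \<Rightarrow> 'c::ab_group_add \<Rightarrow> 'c"
  assumes s: "module s" "module.subspace s V" and t: "module t" "module.subspace t W"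
    and r: "module r" "module.subspace r U"
    and f: "\<And>n. bilinear_on s V t W r U (\<lambda>x y. f x y $ n)"
  shows "bilinear_on (fps_scale s) (power_series_over V) (fps_scale t) (power_series_over W)
    (fps_scale r) (power_series_over U) (fps_bilinear_ext f)"
proof -
  \<comment> \<open>Generalised over both modules, because it serves the second argument too, after an exchange.\<close>
  have lin: "linear_on (fps_scale s) (power_series_over V) (fps_scale r) (power_series_over U)
      (\<lambda>F. fps_bilinear_ext f F G)"
    if s: "module s" "module.subspace s V" and f: "\<And>n. bilinear_on s V t W r U (\<lambda>x y. f x y $ n)"
      and G: "G \<in> power_series_over W"
    for s :: "'k \<Rightarrow> 'e::ab_group_add \<Rightarrow> 'e" and V and t :: "'k \<Rightarrow> 'd::ab_group_add \<Rightarrow> 'd" and W f G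
  proof -
    interpret s: module s by fact
    interpret r: module r by fact
    have fx: "linear_on s V r U (\<lambda>x. f x y $ n)" if "y \<in> W" for y n
      using f that by (simp add: bilinear_on_def)
    note G' = power_series_over_nth[OF G]
    show ?thesis
      unfolding linear_on_def
    proof (intro conjI ballI allI)
      fix F assume F: "F \<in> power_series_over V"
      note F' = power_series_over_nth[OF F]
      show "fps_bilinear_ext f F G \<in> power_series_over U"
        using linear_onD(1)[OF fx] F' G'
        by (auto simp: power_series_over_def fps_bilinear_ext_nth case_prod_unfold
            intro!: r.subspace_sum[OF r(2)])
      fix c
      show "fps_bilinear_ext f (fps_scale s c F) G = fps_scale r c (fps_bilinear_ext f F G)"
      proof (rule fps_ext)
        fix n
        have "fps_bilinear_ext f (fps_scale s c F) G $ n
            = (\<Sum>(i, j, k)\<in>tuples3 n. \<Sum>(p, q)\<in>tuples2 i. r (c $ p) (f (F $ q) (G $ j) $ k))"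
          unfolding fps_bilinear_ext_nth fps_scale_nth case_prod_unfold
          by (intro sum.cong refl)
            (simp add: linear_on_sum[OF s fx] G' F' s.subspace_scale[OF s(2)] linear_onD(3)[OF fx])
        also have "\<dots> = (\<Sum>((i, j, k), (p, q))\<in>(SIGMA x:tuples3 n. tuples2 (fst x)).
            r (c $ p) (f (F $ q) (G $ j) $ k))"
          by (simp add: sum_Sigma case_prod_unfold)
        also have "\<dots> = (\<Sum>((p, m), (q, j, k))\<in>(SIGMA x:tuples2 n. tuples3 (snd x)).
            r (c $ p) (f (F $ q) (G $ j) $ k))"
          by (rule sum.reindex_bij_witness[of _
                "\<lambda>((p, m), (q, j, k)). ((p + q, j, k), (p, q))"
                "\<lambda>((i, j, k), (p, q)). ((p, q + j + k), (q, j, k))"])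
            (auto simp: tuples2_def tuples3_def)
        also have "\<dots> = fps_scale r c (fps_bilinear_ext f F G) $ n"
          unfolding fps_bilinear_ext_nth fps_scale_nth
          by (simp add: sum_Sigma case_prod_unfold r.scale_sum_right)
        finally show "fps_bilinear_ext f (fps_scale s c F) G $ n
            = fps_scale r c (fps_bilinear_ext f F G) $ n" .
      qed
      fix F1 assume F1: "F1 \<in> power_series_over V"
      show "fps_bilinear_ext f (F + F1) G = fps_bilinear_ext f F G + fps_bilinear_ext f F1 G"
        by (rule fps_ext)
          (simp add: fps_bilinear_ext_nth case_prod_unfold sum.distrib
            linear_onD(2)[OF fx] F' G' power_series_over_nth[OF F1])
    qed
  qed
  show ?thesis
    unfolding bilinear_on_def
  proof (intro conjI ballI)
    fix F :: "'a fps" assume F: "F \<in> power_series_over V"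
    have "linear_on (fps_scale t) (power_series_over W) (fps_scale r) (power_series_over U)
      (\<lambda>G. fps_bilinear_ext (\<lambda>y x. f x y) G F)"
      by (rule lin[OF t _ F]) (rule bilinear_on_swap[OF f])
    moreover have "fps_bilinear_ext f F = (\<lambda>G. fps_bilinear_ext (\<lambda>y x. f x y) G F)"
      by (rule ext) (rule fps_bilinear_ext_swap)
    ultimately show "linear_on (fps_scale t) (power_series_over W) (fps_scale r) (power_series_over U)
      (fps_bilinear_ext f F)"
      by (simp only:)
  qed (rule lin[OF s f])
qed

text \<open>
  A bilinear extension is determined by its values on constants, so associativity is
  a family of identities between constants, one for each power of \<open>h\<close>.
\<close>

lemma fps_bilinear_ext_assoc:
  assumes s: "module s" "module.subspace s V"
    and f: "\<And>n. bilinear_on s V s V s V (\<lambda>x y. f x y $ n)"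
    and assoc: "\<And>n x y z. x \<in> V \<Longrightarrow> y \<in> V \<Longrightarrow> z \<in> V \<Longrightarrow>
      (\<Sum>(q, k)\<in>tuples2 n. f (f x y $ k) z $ q) = (\<Sum>(q, k)\<in>tuples2 n. f x (f y z $ k) $ q)"
    and FGH: "F \<in> power_series_over V" "G \<in> power_series_over V" "H \<in> power_series_over V"
  shows "fps_bilinear_ext f (fps_bilinear_ext f F G) H = fps_bilinear_ext f F (fps_bilinear_ext f G H)"
proof (rule fps_ext)
  fix n
  interpret s: module s by fact
  note mem = FGH[THEN power_series_over_nth]
  have lin1: "linear_on s V s V (\<lambda>x. f x y $ n)" and lin2: "linear_on s V s V (\<lambda>x. f y x $ n)"
    if "y \<in> V" for y n
    using f[of n] that by (auto simp: bilinear_on_def)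
  have mem2: "f x y $ n \<in> V" if "x \<in> V" "y \<in> V" for x y n
    using bilinear_onD(1)[OF f that] .
  have "fps_bilinear_ext f (fps_bilinear_ext f F G) H $ n
      = (\<Sum>(p, l, q)\<in>tuples3 n. \<Sum>(i, j, k)\<in>tuples3 p. f (f (F $ i) (G $ j) $ k) (H $ l) $ q)"
    unfolding fps_bilinear_ext_nth case_prod_unfold
    by (intro sum.cong refl linear_on_sum[OF s lin1] mem mem2)
  also have "\<dots> = (\<Sum>((i, j, l, e), (q, k))\<in>(SIGMA x:tuples4 n. tuples2 (snd (snd (snd x)))).
      f (f (F $ i) (G $ j) $ k) (H $ l) $ q)"
    unfolding case_prod_unfold
    by (subst sum.Sigma, simp, simp, rule sum.reindex_bij_witness[of _
          "\<lambda>((i, j, l, e), (q, k)). ((i + j + k, l, q), (i, j, k))"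
          "\<lambda>((p, l, q), (i, j, k)). ((i, j, l, q + k), (q, k))"])
      (auto simp: tuples2_def tuples3_def tuples4_def)
  also have "\<dots> = (\<Sum>((i, j, l, e), (q, k))\<in>(SIGMA x:tuples4 n. tuples2 (snd (snd (snd x)))).
      f (F $ i) (f (G $ j) (H $ l) $ k) $ q)"
    using assoc[unfolded case_prod_unfold] mem by (simp add: sum_Sigma case_prod_unfold)
  also have "\<dots> = (\<Sum>(i, p, q)\<in>tuples3 n. \<Sum>(j, l, k)\<in>tuples3 p. f (F $ i) (f (G $ j) (H $ l) $ k) $ q)"
    unfolding case_prod_unfold
    by (subst sum.Sigma, simp, simp, rule sum.reindex_bij_witness[of _
          "\<lambda>((i, p, q), (j, l, k)). ((i, j, l, q + k), (q, k))"
          "\<lambda>((i, j, l, e), (q, k)). ((i, j + l + k, q), (j, l, k))"])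
      (auto simp: tuples2_def tuples3_def tuples4_def)
  also have "\<dots> = fps_bilinear_ext f F (fps_bilinear_ext f G H) $ n"
    unfolding fps_bilinear_ext_nth case_prod_unfold
    by (intro sum.cong refl linear_on_sum[OF s lin2, symmetric] mem mem2)
  finally show "fps_bilinear_ext f (fps_bilinear_ext f F G) H $ n
      = fps_bilinear_ext f F (fps_bilinear_ext f G H) $ n" .
qed

lemma deformation_nth:
  "fps_bilinear_ext (\<lambda>x y. divided_power_series r (\<lambda>i. g i x y)) F G $ n
    = (\<Sum>(i, j, k)\<in>tuples3 n. r (inverse (fact k)) (g k (F $ i) (G $ j)))"
  by (simp add: fps_bilinear_ext_nth divided_power_series_def)

lemma bilinear_on_deformation:
  assumes s: "module s" "module.subspace s V" and t: "module t" "module.subspace t W"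
    and r: "module r" "module.subspace r U"
    and g: "\<And>k. bilinear_on s V t W r U (g k)"
  shows "bilinear_on (fps_scale s) (power_series_over V) (fps_scale t) (power_series_over W)
    (fps_scale r) (power_series_over U)
    (fps_bilinear_ext (\<lambda>x y. divided_power_series r (\<lambda>i. g i x y)))"
  by (rule bilinear_on_fps_bilinear_ext[OF s t r])
    (simp add: divided_power_series_def bilinear_on_scale_comp[OF r g])

text \<open>
  A term that involves a coefficient of positive degree of one of the arguments vanishes by
  bilinearity.
\<close>

lemma deformation_const:
  assumes "module s" "module.subspace s V" "module t" "module.subspace t W" "module r"
    and g: "\<And>k. bilinear_on s V t W r U (g k)" and x: "x \<in> V" and y: "y \<in> W"
  shows "fps_bilinear_ext (\<lambda>x y. divided_power_series r (\<lambda>k. g k x y)) (fps_const x) (fps_const y)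
    = divided_power_series r (\<lambda>k. g k x y)"
proof (rule fps_ext)
  fix n
  interpret s: module s by fact
  interpret t: module t by fact
  interpret r: module r by fact
  have zero1: "g k 0 z = 0" if "z \<in> W" for k z
    using g[of k] that by (intro linear_on_zero[OF assms(1,2)]) (auto simp: bilinear_on_def)
  have zero2: "g k z 0 = 0" if "z \<in> V" for k z
    using g[of k] that by (intro linear_on_zero[OF assms(3,4)]) (auto simp: bilinear_on_def)
  have "(\<Sum>(i, j, k)\<in>{(0, 0, n)}. r (inverse (fact k)) (g k (fps_const x $ i) (fps_const y $ j)))
      = (\<Sum>(i, j, k)\<in>tuples3 n. r (inverse (fact k)) (g k (fps_const x $ i) (fps_const y $ j)))"
    by (rule sum.mono_neutral_left)
      (use s.subspace_0[OF assms(2)] t.subspace_0[OF assms(4)] in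
        \<open>auto simp: tuples3_def zero1 zero2 x y split: if_splits intro: finite_tuples(2)[unfolded tuples3_def]\<close>)
  then show "fps_bilinear_ext (\<lambda>x y. divided_power_series r (\<lambda>k. g k x y)) (fps_const x) (fps_const y) $ n
    = divided_power_series r (\<lambda>k. g k x y) $ n"
    by (simp add: deformation_nth) (simp add: divided_power_series_def)
qed

lemma div_h_divided_power_series:
  assumes "module r"
  shows "div_h_mod_h (divided_power_series r a - divided_power_series r b) = a 1 - b 1"
proof -
  interpret r: module r by fact
  show ?thesis by (simp add: div_h_mod_h_def divided_power_series_def)
qed

section \<open>Algebra structures on carriers\<close>

lemma assoc_algebraD:
  assumes "assoc_algebra s V m"
  shows "module s" "module.subspace s V" "bilinear_on s V s V s V m"
    "\<And>x y z. x \<in> V \<Longrightarrow> y \<in> V \<Longrightarrow> z \<in> V \<Longrightarrow> m (m x y) z = m x (m y z)"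
  using assms by (auto simp: assoc_algebra_def)

lemma assoc_algebra_cong:
  assumes "\<And>x y. x \<in> V \<Longrightarrow> y \<in> V \<Longrightarrow> m x y = m' x y" and "assoc_algebra s V m"
  shows "assoc_algebra s V m'"
proof -
  note s = assoc_algebraD(1,2)[OF assms(2)] and bil = assoc_algebraD(3)[OF assms(2)]
  have "bilinear_on s V s V s V m'"
    using bilinear_on_cong[of V V m m', OF assms(1) s s] bil by blast
  then show ?thesis
    unfolding assoc_algebra_def
    using s assms(1) assoc_algebraD(4)[OF assms(2)] bilinear_onD(1)[OF bil] by auto
qed

lemma poisson_algebra_cong:
  assumes "\<And>x y. x \<in> V \<Longrightarrow> y \<in> V \<Longrightarrow> m x y = m' x y"
    and "\<And>x y. x \<in> V \<Longrightarrow> y \<in> V \<Longrightarrow> br x y = br' x y" and P: "poisson_algebra s V br m"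
  shows "poisson_algebra s V br' m'"
proof -
  have alg: "assoc_algebra s V m" and bil: "bilinear_on s V s V s V br"
    using P by (auto simp: poisson_algebra_def)
  note s = assoc_algebraD(1,2)[OF alg]
  have bil': "bilinear_on s V s V s V br'"
    using bilinear_on_cong[of V V br br', OF assms(2) s s] bil by blast
  show ?thesis
    using P bil' assoc_algebra_cong[OF assms(1) alg] bilinear_onD(1)[OF assoc_algebraD(3)[OF alg]]
      bilinear_onD(1)[OF bil]
    unfolding poisson_algebra_def by (simp add: assms(1,2)[symmetric])
qed

lemma assoc_matched_pair_coincide:
  assumes co: "assoc_pairs_coincide M N" and N: "assoc_matched_pair N"
  shows "assoc_matched_pair M"
proof -
  have algA: "assoc_algebra (scaleA N) (carrierA N) (multA N)"
    and algB: "assoc_algebra (scaleB N) (carrierB N) (multB N)"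
    using N by (auto simp: assoc_matched_pair_def)
  note A = assoc_algebraD(1,2)[OF algA] and B = assoc_algebraD(1,2)[OF algB]
  have eq: "scaleA M = scaleA N" "carrierA M = carrierA N" "scaleB M = scaleB N" "carrierB M = carrierB N"
    "\<And>x y. x \<in> carrierA N \<Longrightarrow> y \<in> carrierA N \<Longrightarrow> multA N x y = multA M x y"
    "\<And>u v. u \<in> carrierB N \<Longrightarrow> v \<in> carrierB N \<Longrightarrow> multB N u v = multB M u v"
    "\<And>x v. x \<in> carrierA N \<Longrightarrow> v \<in> carrierB N \<Longrightarrow> leftA N x v = leftA M x v"
    "\<And>x v. x \<in> carrierA N \<Longrightarrow> v \<in> carrierB N \<Longrightarrow> rightA N x v = rightA M x v"
    "\<And>v x. v \<in> carrierB N \<Longrightarrow> x \<in> carrierA N \<Longrightarrow> leftB N v x = leftB M v x"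
    "\<And>v x. v \<in> carrierB N \<Longrightarrow> x \<in> carrierA N \<Longrightarrow> rightB N v x = rightB M v x"
    using co by (auto simp: assoc_pairs_coincide_def)
  have "assoc_algebra (\<lambda>c. map_prod (scaleA N c) (scaleB N c)) (carrierA N \<times> carrierB N)
      (bowtie_product M)"
    by (rule assoc_algebra_cong[of _ "bowtie_product N"])
      (use N in \<open>auto simp: bowtie_product_def eq assoc_matched_pair_def\<close>)
  then show ?thesis
    using N assoc_algebra_cong[OF eq(5) algA] assoc_algebra_cong[OF eq(6) algB]
      bilinear_on_cong[OF eq(7) A B] bilinear_on_cong[OF eq(8) A B]
      bilinear_on_cong[OF eq(9) B A] bilinear_on_cong[OF eq(10) B A]
    unfolding assoc_matched_pair_def eq(1-4) by simp
qed

lemma poisson_matched_pair_coincide: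
  assumes co: "poisson_pairs_coincide M N" and N: "poisson_matched_pair N"
  shows "poisson_matched_pair M"
proof -
  have algA: "poisson_algebra (scaleP N) (carrierP N) (bracketP N) (multP N)"
    and algB: "poisson_algebra (scaleQ N) (carrierQ N) (bracketQ N) (multQ N)"
    using N by (auto simp: poisson_matched_pair_def)
  have A: "module (scaleP N)" "module.subspace (scaleP N) (carrierP N)"
    and B: "module (scaleQ N)" "module.subspace (scaleQ N) (carrierQ N)"
    using algA algB by (auto simp: poisson_algebra_def assoc_algebra_def)
  have eq: "scaleP M = scaleP N" "carrierP M = carrierP N" "scaleQ M = scaleQ N" "carrierQ M = carrierQ N"
    "\<And>x y. x \<in> carrierP N \<Longrightarrow> y \<in> carrierP N \<Longrightarrow> multP N x y = multP M x y"
    "\<And>u v. u \<in> carrierQ N \<Longrightarrow> v \<in> carrierQ N \<Longrightarrow> multQ N u v = multQ M u v"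
    "\<And>x y. x \<in> carrierP N \<Longrightarrow> y \<in> carrierP N \<Longrightarrow> bracketP N x y = bracketP M x y"
    "\<And>u v. u \<in> carrierQ N \<Longrightarrow> v \<in> carrierQ N \<Longrightarrow> bracketQ N u v = bracketQ M u v"
    "\<And>x v. x \<in> carrierP N \<Longrightarrow> v \<in> carrierQ N \<Longrightarrow> rho_multP N x v = rho_multP M x v"
    "\<And>x v. x \<in> carrierP N \<Longrightarrow> v \<in> carrierQ N \<Longrightarrow> rho_bracketP N x v = rho_bracketP M x v"
    "\<And>v x. v \<in> carrierQ N \<Longrightarrow> x \<in> carrierP N \<Longrightarrow> rho_multQ N v x = rho_multQ M v x"
    "\<And>v x. v \<in> carrierQ N \<Longrightarrow> x \<in> carrierP N \<Longrightarrow> rho_bracketQ N v x = rho_bracketQ M v x"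
    using co by (auto simp: poisson_pairs_coincide_def)
  have "poisson_algebra (\<lambda>c. map_prod (scaleP N c) (scaleQ N c)) (carrierP N \<times> carrierQ N)
      (bowtie_bracket M) (bowtie_poisson_product M)"
    by (rule poisson_algebra_cong[of _ "bowtie_poisson_product N" _ "bowtie_bracket N"])
      (use N in \<open>auto simp: bowtie_bracket_def bowtie_poisson_product_def eq poisson_matched_pair_def\<close>)
  then show ?thesis
    using N poisson_algebra_cong[OF eq(5,7) algA] poisson_algebra_cong[OF eq(6,8) algB]
      bilinear_on_cong[OF eq(9) A B] bilinear_on_cong[OF eq(10) A B]
      bilinear_on_cong[OF eq(11) B A] bilinear_on_cong[OF eq(12) B A]
    unfolding poisson_matched_pair_def eq(1-4) by simp
qed

section \<open>Commuting derivations\<close>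

definition derivation_on ::
  "('k::comm_ring_1 \<Rightarrow> 'a::ab_group_add \<Rightarrow> 'a) \<Rightarrow> 'a set \<Rightarrow> ('a \<Rightarrow> 'a \<Rightarrow> 'a) \<Rightarrow> ('a \<Rightarrow> 'a) \<Rightarrow> bool"
  where "derivation_on s V m D \<longleftrightarrow>
    linear_on s V s V D \<and> (\<forall>x\<in>V. \<forall>y\<in>V. D (m x y) = m (D x) y + m x (D y))"

text \<open>
  For the divided powers \<open>D\<^sup>n / n!\<close> the Leibniz rule has no binomial coefficients.  Multiplied by
  \<open>n + 1 = i + j\<close>, the sum for \<open>n + 1\<close> splits into two, and each of them is a shift of the sum that
  arises when \<open>D\<close> is applied to the sum for \<open>n\<close>.
\<close>

lemma derivation_on_leibniz:
  fixes s :: "'k::field_char_0 \<Rightarrow> 'a::ab_group_add \<Rightarrow> 'a"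
  assumes alg: "assoc_algebra s V m" and D: "derivation_on s V m D" and x: "x \<in> V" and y: "y \<in> V"
  shows "s (inverse (fact n)) ((D ^^ n) (m x y))
    = (\<Sum>(i, j)\<in>tuples2 n. s (inverse (fact i) * inverse (fact j)) (m ((D ^^ i) x) ((D ^^ j) y)))"
proof (induction n)
  case 0
  interpret module s using assoc_algebraD(1)[OF alg] .
  have "tuples2 0 = {(0, 0)}" by (auto simp: tuples2_def)
  then show ?case by simp
next
  case (Suc n)
  note s = assoc_algebraD(1,2)[OF alg]
  interpret module s using s(1) .
  have lin: "linear_on s V s V D" and der: "D (m a b) = m (D a) b + m a (D b)"
    if "a \<in> V" "b \<in> V" for a b
    using D that by (auto simp: derivation_on_def)
  note lin = lin[OF x x]
  have DV: "(D ^^ i) a \<in> V" if "a \<in> V" for i a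
    using linear_onD(1)[OF linear_on_funpow[OF lin] that] .
  have mV: "m a b \<in> V" if "a \<in> V" "b \<in> V" for a b
    using bilinear_onD(1)[OF assoc_algebraD(3)[OF alg] that] .
  define g where "g i j = s (inverse (fact i) * inverse (fact j)) (m ((D ^^ i) x) ((D ^^ j) y))" for i j
  have step: "(of_nat (Suc i) :: 'k) * (inverse (fact (Suc i)) * c) = inverse (fact i) * c" for i c
  proof -
    have "(of_nat (Suc i) :: 'k) \<noteq> 0" by (rule of_nat_neq_0)
    then show ?thesis by (simp only: fact_Suc of_nat_mult nonzero_inverse_mult_distrib
          fact_nonzero inverse_mult_distrib mult.assoc[symmetric] right_inverse) simp
  qed
  have Dg: "D (g i j) = s (of_nat (Suc i)) (g (Suc i) j) + s (of_nat (Suc j)) (g i (Suc j))" for i j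
  proof -
    have "D (g i j) = s (inverse (fact i) * inverse (fact j)) (m ((D ^^ Suc i) x) ((D ^^ j) y))
        + s (inverse (fact i) * inverse (fact j)) (m ((D ^^ i) x) ((D ^^ Suc j) y))"
      by (simp add: g_def linear_onD(3)[OF lin] mV DV x y der scale_right_distrib)
    then show ?thesis
      unfolding g_def scale_scale step mult.commute[of "inverse (fact i)" "inverse (fact (Suc j))"]
      by (simp only: mult.commute)
  qed
  have l: "(\<Sum>(i, j)\<in>tuples2 (Suc n). s (of_nat i) (g i j))
      = (\<Sum>(i, j)\<in>tuples2 n. s (of_nat (Suc i)) (g (Suc i) j))"
  proof -
    have "(\<Sum>(i, j)\<in>tuples2 (Suc n). s (of_nat i) (g i j))
        = (\<Sum>(i, j)\<in>{p \<in> tuples2 (Suc n). fst p \<noteq> 0}. s (of_nat i) (g i j))"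
      by (rule sum.mono_neutral_right) (auto intro!: gr0I)
    also have "\<dots> = (\<Sum>(i, j)\<in>tuples2 n. s (of_nat (Suc i)) (g (Suc i) j))"
      by (rule sum.reindex_bij_witness[of _ "\<lambda>(i, j). (Suc i, j)" "\<lambda>(i, j). (i - 1, j)"])
        (auto simp: tuples2_def simp del: of_nat_Suc)
    finally show ?thesis .
  qed
  have r: "(\<Sum>(i, j)\<in>tuples2 (Suc n). s (of_nat j) (g i j))
      = (\<Sum>(i, j)\<in>tuples2 n. s (of_nat (Suc j)) (g i (Suc j)))"
  proof -
    have "(\<Sum>(i, j)\<in>tuples2 (Suc n). s (of_nat j) (g i j))
        = (\<Sum>(i, j)\<in>{p \<in> tuples2 (Suc n). snd p \<noteq> 0}. s (of_nat j) (g i j))"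
      by (rule sum.mono_neutral_right) (auto intro!: gr0I)
    also have "\<dots> = (\<Sum>(i, j)\<in>tuples2 n. s (of_nat (Suc j)) (g i (Suc j)))"
      by (rule sum.reindex_bij_witness[of _ "\<lambda>(i, j). (i, Suc j)" "\<lambda>(i, j). (i, j - 1)"])
        (auto simp: tuples2_def simp del: of_nat_Suc)
    finally show ?thesis .
  qed
  have cancel: "a = b" if "c \<noteq> 0" "s c a = s c b" for a b c
  proof -
    have "s (inverse c) (s c a) = s (inverse c) (s c b)" using that by simp
    then show ?thesis using that(1) by simp
  qed
  have nz: "(of_nat (Suc n) :: 'k) \<noteq> 0" by (rule of_nat_neq_0)
  have "s (of_nat (Suc n)) (s (inverse (fact (Suc n))) ((D ^^ Suc n) (m x y)))
      = D (s (inverse (fact n)) ((D ^^ n) (m x y)))"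
    using step[of n 1]
    by (simp only: mult_1_right scale_scale funpow.simps comp_apply linear_onD(3)[OF lin DV[OF mV[OF x y]]])
  also have "\<dots> = (\<Sum>(i, j)\<in>tuples2 n. D (g i j))"
    unfolding Suc.IH g_def case_prod_unfold
    by (intro linear_on_sum[OF s lin] subspace_scale[OF s(2)] mV DV x y)
  also have "\<dots> = (\<Sum>(i, j)\<in>tuples2 (Suc n). s (of_nat i) (g i j))
      + (\<Sum>(i, j)\<in>tuples2 (Suc n). s (of_nat j) (g i j))"
    unfolding l r unfolding Dg case_prod_unfold by
    (rule sum.distrib)
  also have "\<dots> = s (of_nat (Suc n)) (\<Sum>(i, j)\<in>tuples2 (Suc n). g i j)"
    unfolding scale_sum_right sum.distrib[symmetric]
    by (rule sum.cong) (auto simp: tuples2_def simp flip: scale_left_distrib of_nat_add)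
  finally show ?case
    unfolding g_def by (rule cancel[OF nz])
qed

text \<open>
  Both bracketings of a triple product have the coefficient
  \<open>\<Sum> (D1\<^sup>r\<^sup>+\<^sup>k x) (D1\<^sup>t D2\<^sup>k y) (D2\<^sup>r\<^sup>+\<^sup>t z) / (k! r! t!)\<close>, by the Leibniz rule: the deformed product is
  \<open>m\<close> applied after \<open>exp (h D1 \<otimes> D2)\<close>.
\<close>

lemma assoc_algebra_deformed_product:
  fixes s :: "'k::field_char_0 \<Rightarrow> 'a::ab_group_add \<Rightarrow> 'a"
  assumes alg: "assoc_algebra s V m" and D1: "derivation_on s V m D1" and D2: "derivation_on s V m D2"
    and comm: "\<And>x. x \<in> V \<Longrightarrow> D1 (D2 x) = D2 (D1 x)"
  shows "assoc_algebra (fps_scale s) (power_series_over V) (deformed_product s m D1 D2)"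
proof -
  note s = assoc_algebraD(1,2)[OF alg] and bil = assoc_algebraD(3)[OF alg]
    and assoc = assoc_algebraD(4)[OF alg]
  interpret module s using s(1) .
  have lin1: "linear_on s V s V (D1 ^^ i)" and lin2: "linear_on s V s V (D2 ^^ i)" for i
    using D1 D2 by (auto simp: derivation_on_def intro: linear_on_funpow)
  note D1V = linear_onD(1)[OF lin1] and D2V = linear_onD(1)[OF lin2]
  note mV = bilinear_onD(1)[OF bil]
  have comm1: "D1 ((D2 ^^ i) x) = (D2 ^^ i) (D1 x)" if "x \<in> V" for i x
    using that D2V by (induction i) (auto simp: comm)
  have comm': "(D1 ^^ i) ((D2 ^^ j) x) = (D2 ^^ j) ((D1 ^^ i) x)" if "x \<in> V" for i j x
    using that D1V by (induction i) (auto simp: comm1)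
  have linm1: "linear_on s V s V (\<lambda>x. m x y)" and linm2: "linear_on s V s V (m y)" if "y \<in> V" for y
    using bil that by (auto simp: bilinear_on_def)
  define f where "f x y = divided_power_series s (\<lambda>i. m ((D1 ^^ i) x) ((D2 ^^ i) y))" for x y
  have fn: "f x y $ n = s (inverse (fact n)) (m ((D1 ^^ n) x) ((D2 ^^ n) y))" for x y n
    by (simp add: f_def divided_power_series_def)
  have fbil: "bilinear_on s V s V s V (\<lambda>x y. f x y $ n)" for n
    unfolding fn by (intro bilinear_on_scale_comp[OF s] bilinear_on_comp[OF bil] lin1 lin2)
  define T where "T x y z k i j =
      s (inverse (fact k) * (inverse (fact i) * inverse (fact j)))
        (m (m ((D1 ^^ (i + k)) x) ((D1 ^^ j) ((D2 ^^ k) y))) ((D2 ^^ (i + j)) z))" for x y z k i j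
  have "(\<Sum>(q, k)\<in>tuples2 n. f (f x y $ k) z $ q) = (\<Sum>(q, k)\<in>tuples2 n. f x (f y z $ k) $ q)"
    if x: "x \<in> V" and y: "y \<in> V" and z: "z \<in> V" for n x y z
  proof -
    have left: "f (f x y $ k) z $ q = (\<Sum>(i, j)\<in>tuples2 q. T x y z k i j)" for k q
    proof -
      have "f (f x y $ k) z $ q = s (inverse (fact k))
          (m (s (inverse (fact q)) ((D1 ^^ q) (m ((D1 ^^ k) x) ((D2 ^^ k) y)))) ((D2 ^^ q) z))"
        by (simp add: fn linear_onD(3)[OF lin1] linear_onD(3)[OF linm1] D1V D2V mV x y z
            scale_left_commute mult.commute)
      also have "\<dots> = s (inverse (fact k)) (\<Sum>(i, j)\<in>tuples2 q. s (inverse (fact i) * inverse (fact j))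
          (m (m ((D1 ^^ i) ((D1 ^^ k) x)) ((D1 ^^ j) ((D2 ^^ k) y))) ((D2 ^^ q) z)))"
        unfolding derivation_on_leibniz[OF alg D1 D1V[OF x] D2V[OF y]] case_prod_unfold
        by (subst linear_on_sum[OF s linm1]; (intro subspace_scale[OF s(2)] mV D1V D2V x y z)?)
          (simp add: linear_onD(3)[OF linm1] D1V D2V mV x y z)
      also have "\<dots> = (\<Sum>(i, j)\<in>tuples2 q. T x y z k i j)"
        unfolding scale_sum_right
        by (rule sum.cong) (auto simp: tuples2_def T_def funpow_add)
      finally show ?thesis .
    qed
    have right: "f x (f y z $ k) $ q = (\<Sum>(i, j)\<in>tuples2 q. T x y z i j k)" for k q
    proof -
      have "f x (f y z $ k) $ q = s (inverse (fact k))
          (m ((D1 ^^ q) x) (s (inverse (fact q)) ((D2 ^^ q) (m ((D1 ^^ k) y) ((D2 ^^ k) z)))))"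
        by (simp add: fn linear_onD(3)[OF lin2] linear_onD(3)[OF linm2] D1V D2V mV x y z
            scale_left_commute mult.commute)
      also have "\<dots> = s (inverse (fact k)) (\<Sum>(i, j)\<in>tuples2 q. s (inverse (fact i) * inverse (fact j))
          (m ((D1 ^^ q) x) (m ((D2 ^^ i) ((D1 ^^ k) y)) ((D2 ^^ j) ((D2 ^^ k) z)))))"
        unfolding derivation_on_leibniz[OF alg D2 D1V[OF y] D2V[OF z]] case_prod_unfold
        by (subst linear_on_sum[OF s linm2]; (intro subspace_scale[OF s(2)] mV D1V D2V x y z)?)
          (simp add: linear_onD(3)[OF linm2] D1V D2V mV x y z)
      also have "\<dots> = (\<Sum>(i, j)\<in>tuples2 q. T x y z i j k)"
        unfolding scale_sum_right
        by (rule sum.cong) (auto simp: tuples2_def T_def funpow_add comm' assoc D1V D2V mV x y z ac_simps)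
      finally show ?thesis .
    qed
    have "(\<Sum>(q, k)\<in>tuples2 n. f (f x y $ k) z $ q)
        = (\<Sum>(k, i, j)\<in>tuples3 n. T x y z k i j)"
      unfolding left case_prod_unfold
      by (subst sum.Sigma, simp, simp, rule sum.reindex_bij_witness[of _
            "\<lambda>(k, i, j). ((i + j, k), (i, j))" "\<lambda>((q, k), (i, j)). (k, i, j)"])
        (auto simp: tuples2_def tuples3_def)
    also have "\<dots> = (\<Sum>(q, k)\<in>tuples2 n. f x (f y z $ k) $ q)"
      unfolding right case_prod_unfold
      by (subst sum.Sigma, simp, simp, rule sum.reindex_bij_witness[of _
            "\<lambda>((q, k), (i, j)). (i, j, k)" "\<lambda>(i, j, k). ((i + j, k), (i, j))"])
        (auto simp: tuples2_def tuples3_def)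
    finally show ?thesis .
  qed
  note A = fps_bilinear_ext_assoc[OF s fbil this]
  have "deformed_product s m D1 D2 = fps_bilinear_ext f"
    by (simp add: deformed_product_def f_def[abs_def])
  then show ?thesis
    unfolding assoc_algebra_def
    using A bilinear_on_fps_bilinear_ext[OF s s s fbil] module_fps_scale[OF s(1)]
      subspace_power_series_over[OF s] by auto
qed

text \<open>
  The Jacobi sum expands by the Leibniz rule into triple products, which cancel in pairs because \<open>D1\<close>
  and \<open>D2\<close> commute.
\<close>

lemma poisson_algebra_commuting_derivations:
  fixes s :: "'k::field_char_0 \<Rightarrow> 'a::ab_group_add \<Rightarrow> 'a"
  assumes alg: "assoc_algebra s V m" and mcomm: "\<And>x y. x \<in> V \<Longrightarrow> y \<in> V \<Longrightarrow> m x y = m y x"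
    and D1: "derivation_on s V m D1" and D2: "derivation_on s V m D2"
    and comm: "\<And>x. x \<in> V \<Longrightarrow> D1 (D2 x) = D2 (D1 x)"
  shows "poisson_algebra s V (\<lambda>x y. m (D1 x) (D2 y) - m (D1 y) (D2 x)) m"
proof -
  note s = assoc_algebraD(1,2)[OF alg] and bil = assoc_algebraD(3)[OF alg]
    and assoc = assoc_algebraD(4)[OF alg]
  interpret module s using s(1) .
  have lin1: "linear_on s V s V D1" and lin2: "linear_on s V s V D2"
    and der1: "\<And>x y. x \<in> V \<Longrightarrow> y \<in> V \<Longrightarrow> D1 (m x y) = m (D1 x) y + m x (D1 y)"
    and der2: "\<And>x y. x \<in> V \<Longrightarrow> y \<in> V \<Longrightarrow> D2 (m x y) = m (D2 x) y + m x (D2 y)"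
    using D1 D2 by (auto simp: derivation_on_def)
  have linm1: "linear_on s V s V (\<lambda>x. m x y)" and linm2: "linear_on s V s V (m y)" if "y \<in> V" for y
    using bil that by (auto simp: bilinear_on_def)
  note mem = linear_onD(1)[OF lin1] linear_onD(1)[OF lin2] bilinear_onD(1)[OF bil]
    subspace_add[OF s(2)] subspace_diff[OF s(2)]
  note dist = linear_onD(2)[OF lin1] linear_onD(2)[OF lin2] linear_on_diff[OF s lin1] linear_on_diff[OF s lin2]
    linear_onD(2)[OF linm1] linear_onD(2)[OF linm2] linear_on_diff[OF s linm1] linear_on_diff[OF s linm2]
  have lcomm: "m x (m y z) = m y (m x z)" if "x \<in> V" "y \<in> V" "z \<in> V" for x y z
    using that assoc mcomm by metis
  have "bilinear_on s V s V s V (\<lambda>x y. m (D1 x) (D2 y))"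
    by (rule bilinear_on_comp[OF bil lin1 lin2])
  from bilinear_on_diff_comp[OF s this bilinear_on_swap[OF this]]
  have "bilinear_on s V s V s V (\<lambda>x y. m (D1 x) (D2 y) - m (D1 y) (D2 x))" .
  moreover have "m (D1 x) (D2 (m y z)) - m (D1 (m y z)) (D2 x)
      = m (m (D1 x) (D2 y) - m (D1 y) (D2 x)) z + m y (m (D1 x) (D2 z) - m (D1 z) (D2 x))"
    if "x \<in> V" "y \<in> V" "z \<in> V" for x y z
    using that by (simp add: der1 der2 dist mem assoc mcomm lcomm)
  moreover have
    "m (D1 x) (D2 (m (D1 y) (D2 z) - m (D1 z) (D2 y))) - m (D1 (m (D1 y) (D2 z) - m (D1 z) (D2 y))) (D2 x)
    + (m (D1 y) (D2 (m (D1 z) (D2 x) - m (D1 x) (D2 z))) - m (D1 (m (D1 z) (D2 x) - m (D1 x) (D2 z))) (D2 y))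
    + (m (D1 z) (D2 (m (D1 x) (D2 y) - m (D1 y) (D2 x))) - m (D1 (m (D1 x) (D2 y) - m (D1 y) (D2 x))) (D2 z)) = 0"
    if "x \<in> V" "y \<in> V" "z \<in> V" for x y z
    using that by (simp add: der1 der2 dist mem assoc mcomm lcomm comm)
  ultimately show ?thesis
    unfolding poisson_algebra_def using alg mcomm by auto
qed

section \<open>The double of a pair of algebras in duality\<close>

text \<open>
  Here \<open>lA x\<close> is the transpose of the multiplication by \<open>x\<close> and \<open>lB u\<close> that of the multiplication by
  \<open>u\<close>.  The last axiom is the first compatibility condition of an ASI bialgebra, evaluated at
  \<open>u \<otimes> v\<close>.  Carriers are kept on both sides to make the axioms symmetric.
\<close>

locale dual_pair =
  fixes s :: "'k::field \<Rightarrow> 'a::ab_group_add \<Rightarrow> 'a" and V :: "'a set"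
    and t :: "'k \<Rightarrow> 'b::ab_group_add \<Rightarrow> 'b" and W :: "'b set"
    and pr :: "'b \<Rightarrow> 'a \<Rightarrow> 'k"
    and mA :: "'a \<Rightarrow> 'a \<Rightarrow> 'a" and mB :: "'b \<Rightarrow> 'b \<Rightarrow> 'b"
    and lA :: "'a \<Rightarrow> 'b \<Rightarrow> 'b" and lB :: "'b \<Rightarrow> 'a \<Rightarrow> 'a"
  assumes algA: "assoc_algebra s V mA" and algB: "assoc_algebra t W mB"
    and commA: "x \<in> V \<Longrightarrow> y \<in> V \<Longrightarrow> mA x y = mA y x"
    and commB: "u \<in> W \<Longrightarrow> v \<in> W \<Longrightarrow> mB u v = mB v u"
    and pairing: "bilinear_on t W s V (*) UNIV pr"
    and nondegA: "x \<in> V \<Longrightarrow> (\<And>w. w \<in> W \<Longrightarrow> pr w x = 0) \<Longrightarrow> x = 0"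
    and nondegB: "w \<in> W \<Longrightarrow> (\<And>x. x \<in> V \<Longrightarrow> pr w x = 0) \<Longrightarrow> w = 0"
    and lA_closed: "x \<in> V \<Longrightarrow> v \<in> W \<Longrightarrow> lA x v \<in> W"
    and lB_closed: "u \<in> W \<Longrightarrow> x \<in> V \<Longrightarrow> lB u x \<in> V"
    and pr_lA: "x \<in> V \<Longrightarrow> v \<in> W \<Longrightarrow> y \<in> V \<Longrightarrow> pr (lA x v) y = pr v (mA x y)"
    and pr_lB: "u \<in> W \<Longrightarrow> x \<in> V \<Longrightarrow> w \<in> W \<Longrightarrow> pr w (lB u x) = pr (mB u w) x"
    and compat: "x \<in> V \<Longrightarrow> y \<in> V \<Longrightarrow> u \<in> W \<Longrightarrow> v \<in> W \<Longrightarrow>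
      pr (mB u v) (mA x y) = pr (lA x v) (lB u y) + pr (lA y u) (lB v x)"
begin

lemma swap: "dual_pair t W s V (\<lambda>x w. pr w x) mB mA lB lA"
  by unfold_locales
    (simp_all add: algA algB commA commB nondegA nondegB lA_closed lB_closed pr_lA pr_lB compat
      bilinear_on_swap[OF pairing])

lemmas modA = assoc_algebraD(1,2)[OF algA] and modB = assoc_algebraD(1,2)[OF algB]
lemmas bilA = assoc_algebraD(3)[OF algA] and bilB = assoc_algebraD(3)[OF algB]
lemmas closedA = bilinear_onD(1)[OF bilA] and closedB = bilinear_onD(1)[OF bilB]

sublocale A: module s by (rule modA)
sublocale B: module t by (rule modB)

lemmas subA = A.subspace_add[OF modA(2)] A.subspace_scale[OF modA(2)] A.subspace_diff[OF modA(2)]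
  A.subspace_0[OF modA(2)]
lemmas subB = B.subspace_add[OF modB(2)] B.subspace_scale[OF modB(2)] B.subspace_diff[OF modB(2)]
  B.subspace_0[OF modB(2)]

lemma lin_pr: "w \<in> W \<Longrightarrow> linear_on s V (*) UNIV (pr w)"
  "x \<in> V \<Longrightarrow> linear_on t W (*) UNIV (\<lambda>w. pr w x)"
  using pairing by (auto simp: bilinear_on_def)

lemmas pr_simps = bilinear_onD(2-5)[OF pairing]
lemmas pr_diff = linear_on_diff[OF modA lin_pr(1)] linear_on_diff[OF modB lin_pr(2)]

lemma eqA: "x \<in> V \<Longrightarrow> y \<in> V \<Longrightarrow> (\<And>w. w \<in> W \<Longrightarrow> pr w x = pr w y) \<Longrightarrow> x = y"
  using nondegA[of "x - y"] by (simp add: pr_diff subA)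

lemma eqB: "u \<in> W \<Longrightarrow> v \<in> W \<Longrightarrow> (\<And>x. x \<in> V \<Longrightarrow> pr u x = pr v x) \<Longrightarrow> u = v"
  using nondegB[of "u - v"] by (simp add: pr_diff subB)

lemma bilinear_lA: "bilinear_on s V t W t W lA"
  unfolding bilinear_on_def linear_on_def
  by (intro conjI ballI allI eqB)
    (simp_all add: lA_closed pr_lA subA subB pr_simps closedA bilinear_onD(2-5)[OF bilA])

lemma bilinear_lB: "bilinear_on t W s V s V lB"
  by (rule dual_pair.bilinear_lA[OF swap])

definition double :: "('k, 'a, 'b) assoc_pair" where
  "double = \<lparr>scaleA = s, carrierA = V, multA = mA, scaleB = t, carrierB = W, multB = mB,
     leftA = lA, rightA = lA, leftB = lB, rightB = lB\<rparr>"

abbreviation mult_double (infixl "\<odot>" 70) where "mult_double \<equiv> bowtie_product double"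

lemma mult_double: "(x, u) \<odot> (y, v) = (mA x y + lB u y + lB v x, lA x v + lA y u + mB u v)"
  by (simp add: bowtie_product_def double_def)

definition form :: "'a \<times> 'b \<Rightarrow> 'a \<times> 'b \<Rightarrow> 'k" where
  "form = (\<lambda>(x, u) (y, v). pr u y + pr v x)"

lemma double_closed: "a \<in> V \<times> W \<Longrightarrow> b \<in> V \<times> W \<Longrightarrow> a \<odot> b \<in> V \<times> W"
  by (cases a; cases b) (auto simp: mult_double subA subB closedA closedB lA_closed lB_closed)

lemma double_comm: "a \<in> V \<times> W \<Longrightarrow> b \<in> V \<times> W \<Longrightarrow> a \<odot> b = b \<odot> a"
  by (cases a; cases b) (auto simp: mult_double commA commB)

lemma form_eq:
  assumes "a \<in> V \<times> W" "b \<in> V \<times> W" "\<And>c. c \<in> V \<times> W \<Longrightarrow> form a c = form b c"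
  shows "a = b"
proof -
  obtain x u y v where ab: "a = (x, u)" "b = (y, v)" by fastforce
  have mem: "x \<in> V" "u \<in> W" "y \<in> V" "v \<in> W" using assms(1,2) ab by auto
  have pr0: "w \<in> W \<Longrightarrow> pr w 0 = 0" "z \<in> V \<Longrightarrow> pr 0 z = 0" for w z
    using linear_on_zero[OF modA lin_pr(1)] linear_on_zero[OF modB lin_pr(2)] by auto
  have "x = y"
  proof (rule eqA)
    fix w assume "w \<in> W"
    then show "pr w x = pr w y"
      using assms(3)[of "(0, w)"] by (simp add: form_def ab pr0 mem subA)
  qed (fact mem)+
  moreover have "u = v"
  proof (rule eqB)
    fix z assume "z \<in> V"
    then show "pr u z = pr v z"
      using assms(3)[of "(z, 0)"] by (simp add: form_def ab pr0 mem subB)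
  qed (fact mem)+
  ultimately show ?thesis using ab by simp
qed

lemma form_invariant:
  assumes "a \<in> V \<times> W" "b \<in> V \<times> W" "c \<in> V \<times> W"
  shows "form (a \<odot> b) c = form a (b \<odot> c)"
proof -
  obtain x u y v z w where "a = (x, u)" "b = (y, v)" "c = (z, w)" by (cases a; cases b; cases c) blast
  then show ?thesis using assms
    by (simp add: form_def mult_double subA subB pr_simps pr_lA pr_lB closedA closedB lA_closed lB_closed
        commA commB)
qed

text \<open>
  The form is symmetric and the product invariant, so this is associativity of the product tested
  against a fourth element.  If all four arguments lie in one summand, both sides vanish; if exactly
  three do, it is associativity of that summand; if two lie in each, both sides are
  \<open>\<langle>u \<cdot> v, x \<circ> y\<rangle>\<close> by the compatibility condition.
\<close>

lemma form_four:
  assumes "a \<in> V \<times> W" "b \<in> V \<times> W" "c \<in> V \<times> W" "d \<in> V \<times> W"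
  shows "form (a \<odot> b) (c \<odot> d) = form (b \<odot> c) (a \<odot> d)"
proof -
  obtain x1 u1 x2 u2 x3 u3 x4 u4 where abcd: "a = (x1, u1)" "b = (x2, u2)" "c = (x3, u3)" "d = (x4, u4)"
    by (cases a; cases b; cases c; cases d) blast
  have A3: "pr (lA z u) (mA x y) = pr u (mA x (mA y z))"
    if "x \<in> V" "y \<in> V" "z \<in> V" "u \<in> W" for x y z u
    using that by (simp add: pr_lA closedA commA[of z] assoc_algebraD(4)[OF algA])
  have B3: "pr (mB u v) (lB w x) = pr (mB u (mB v w)) x"
    if "u \<in> W" "v \<in> W" "w \<in> W" "x \<in> V" for u v w x
    using that by (simp add: pr_lB closedB commB[of w] assoc_algebraD(4)[OF algB])
  have lcA: "mA x (mA y z) = mA y (mA x z)" if "x \<in> V" "y \<in> V" "z \<in> V" for x y z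
    using that assoc_algebraD(4)[OF algA] commA by metis
  have lcB: "mB x (mB y z) = mB y (mB x z)" if "x \<in> W" "y \<in> W" "z \<in> W" for x y z
    using that assoc_algebraD(4)[OF algB] commB by metis
  have split: "pr (lA x v) (lB u y) = pr (mB u v) (mA x y) - pr (lA y u) (lB v x)"
    if "x \<in> V" "y \<in> V" "u \<in> W" "v \<in> W" for x y u v
    using compat[OF that] by simp
  \<comment> \<open>The mixed products \<open>\<langle>x.v, u.y\<rangle>\<close> come in pairs that sum to \<open>\<langle>u \<cdot> v, x \<circ> y\<rangle>\<close>; each instance of
    \<open>split\<close> removes one member of a pair, four for each side of the equation.\<close>
  show ?thesis using assms
    by (simp add: abcd form_def mult_double subA subB pr_simps closedA closedB lA_closed lB_closed
        A3 B3 commA commB lcA lcB split[of x1 x4 u3 u2] split[of x2 x4 u3 u1] split[of x1 x3 u4 u2]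
        split[of x2 x3 u4 u1] split[of x3 x4 u1 u2] split[of x2 x4 u1 u3] split[of x3 x1 u4 u2]
        split[of x2 x1 u4 u3])
qed

lemma assoc_double: "assoc_algebra (\<lambda>c. map_prod (s c) (t c)) (V \<times> W) (bowtie_product double)"
  unfolding assoc_algebra_def
proof (intro conjI ballI)
  show "bilinear_on (\<lambda>c. map_prod (s c) (t c)) (V \<times> W) (\<lambda>c. map_prod (s c) (t c)) (V \<times> W)
      (\<lambda>c. map_prod (s c) (t c)) (V \<times> W) (bowtie_product double)"
    using bilinear_on_Times[OF modA modB bilA bilB bilinear_lA bilinear_lA bilinear_lB bilinear_lB]
    by (simp add: bowtie_product_def double_def)
  fix a b c assume abc: "a \<in> V \<times> W" "b \<in> V \<times> W" "c \<in> V \<times> W"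
  note mem = abc double_closed
  show "a \<odot> b \<odot> c = a \<odot> (b \<odot> c)"
  proof (rule form_eq)
    fix d assume d: "d \<in> V \<times> W"
    have "form (a \<odot> b \<odot> c) d = form (b \<odot> c) (a \<odot> d)"
      using abc d by (metis form_invariant form_four double_closed)
    also have "\<dots> = form (a \<odot> (b \<odot> c)) d"
      using abc d by (metis form_invariant double_comm double_closed)
    finally show "form (a \<odot> b \<odot> c) d = form (a \<odot> (b \<odot> c)) d" .
  qed (simp_all only: mem)
qed (rule module_map_prod modA modB subspace_Times)+

end

section \<open>Derivations of the double\<close>

context dual_pair
begin

text \<open>
  Paired with an element of \<open>V\<close>, the product rule for the action of \<open>A\<close> on \<open>B\<close> becomes the coherence
  identity, because \<open>dB\<close> is the transpose of \<open>eA\<close>.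
\<close>

lemma derivation_lA:
  assumes lin: "linear_on s V s V dA" "linear_on t W t W dB"
    and eA: "\<And>x. x \<in> V \<Longrightarrow> eA x \<in> V"
    and pr_dB: "\<And>v x. v \<in> W \<Longrightarrow> x \<in> V \<Longrightarrow> pr (dB v) x = pr v (eA x)"
    and coh: "\<And>x y. x \<in> V \<Longrightarrow> y \<in> V \<Longrightarrow> mA x (eA y) = mA (dA x) y + eA (mA x y)"
    and x: "x \<in> V" and v: "v \<in> W"
  shows "dB (lA x v) = lA (dA x) v + lA x (dB v)"
  by (rule eqB)
    (simp_all add: x v linear_onD(1)[OF lin(1)] linear_onD(1)[OF lin(2)] eA lA_closed subB pr_simps
      pr_lA pr_dB coh closedA)

lemma derivation_lB:
  assumes lin: "linear_on s V s V dA" "linear_on t W t W dB"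
    and eB: "\<And>v. v \<in> W \<Longrightarrow> eB v \<in> W"
    and pr_eB: "\<And>v x. v \<in> W \<Longrightarrow> x \<in> V \<Longrightarrow> pr (eB v) x = pr v (dA x)"
    and coh: "\<And>u v. u \<in> W \<Longrightarrow> v \<in> W \<Longrightarrow> mB u (eB v) = mB (dB u) v + eB (mB u v)"
    and v: "v \<in> W" and x: "x \<in> V"
  shows "dA (lB v x) = lB (dB v) x + lB v (dA x)"
  by (rule dual_pair.derivation_lA[OF swap lin(2,1) eB _ coh v x]) (simp_all add: pr_eB)

lemma derivation_double:
  assumes dA: "derivation_on s V mA dA" and dB: "derivation_on t W mB dB"
    and lA: "\<And>x v. x \<in> V \<Longrightarrow> v \<in> W \<Longrightarrow> dB (lA x v) = lA (dA x) v + lA x (dB v)"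
    and lB: "\<And>v x. v \<in> W \<Longrightarrow> x \<in> V \<Longrightarrow> dA (lB v x) = lB (dB v) x + lB v (dA x)"
  shows "derivation_on (\<lambda>c. map_prod (s c) (t c)) (V \<times> W) (bowtie_product double) (map_prod dA dB)"
proof -
  have linA: "linear_on s V s V dA" and linB: "linear_on t W t W dB"
    and derA: "\<And>x y. x \<in> V \<Longrightarrow> y \<in> V \<Longrightarrow> dA (mA x y) = mA (dA x) y + mA x (dA y)"
    and derB: "\<And>x y. x \<in> W \<Longrightarrow> y \<in> W \<Longrightarrow> dB (mB x y) = mB (dB x) y + mB x (dB y)"
    using dA dB by (auto simp: derivation_on_def)
  have "linear_on (\<lambda>c. map_prod (s c) (t c)) (V \<times> W) (\<lambda>c. map_prod (s c) (t c)) (V \<times> W) (map_prod dA dB)"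
    using linA linB by (auto simp: linear_on_def)
  then show ?thesis
    unfolding derivation_on_def
    by (auto simp: mult_double linear_onD[OF linA] linear_onD[OF linB] subA subB derA derB lA lB
        closedA closedB lA_closed lB_closed algebra_simps)
qed

section \<open>The topological pairing\<close>

text \<open>
  For the evaluation pairing this is the pairing of \<open>A[[h]]\<close> with its topological dual.
\<close>

definition pairing_h :: "'b fps \<Rightarrow> 'a fps \<Rightarrow> 'k fps" where
  "pairing_h = fps_bilinear_ext (\<lambda>u x. fps_const (pr u x))"

lemma pairing_h_nth: "pairing_h U X $ n = (\<Sum>(i, j)\<in>tuples2 n. pr (U $ i) (X $ j))"
  by (simp add: pairing_h_def fps_bilinear_ext_const_nth)

lemma pairing_h_const:
  assumes U: "U \<in> power_series_over W" and x: "x \<in> V"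
  shows "pairing_h U (fps_const x) $ n = pr (U $ n) x"
proof -
  have pr0: "w \<in> W \<Longrightarrow> pr w 0 = 0" for w
    using linear_on_zero[OF modA lin_pr(1)] .
  have "(\<Sum>(i, j)\<in>{(n, 0)}. pr (U $ i) (fps_const x $ j)) = pairing_h U (fps_const x) $ n"
    unfolding pairing_h_nth
    by (rule sum.mono_neutral_left) (auto simp: tuples2_def pr0 power_series_over_nth[OF U] split: if_splits
        intro: finite_tuples(1)[unfolded tuples2_def])
  then show ?thesis by simp
qed

text \<open>
  The coefficients of a series are recovered from its pairings with constant series.
\<close>

lemma pairing_h_nondegB:
  assumes "U \<in> power_series_over W" "U' \<in> power_series_over W"
    and "\<And>X. X \<in> power_series_over V \<Longrightarrow> pairing_h U X = pairing_h U' X"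
  shows "U = U'"
proof (rule fps_ext)
  fix n
  show "U $ n = U' $ n"
  proof (rule eqB)
    fix x assume x: "x \<in> V"
    then have "fps_const x \<in> power_series_over V"
      by (auto simp: power_series_over_def subA)
    then show "pr (U $ n) x = pr (U' $ n) x"
      using assms x by (metis pairing_h_const)
  qed (use assms power_series_over_nth in auto)
qed

lemma pairing_h_swap: "dual_pair.pairing_h (\<lambda>x w. pr w x) = (\<lambda>X U. pairing_h U X)"
  unfolding pairing_h_def dual_pair.pairing_h_def[OF swap]
  by (intro ext) (rule fps_bilinear_ext_swap)

end

lemma transpose_wrt_eqI:
  assumes "w \<in> S" "\<And>v. v \<in> T \<Longrightarrow> pr w v = pr u (f v)"
    and "\<And>w'. w' \<in> S \<Longrightarrow> (\<And>v. v \<in> T \<Longrightarrow> pr w' v = pr w v) \<Longrightarrow> w' = w"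
  shows "transpose_wrt pr S T f u = w"
  unfolding transpose_wrt_def
proof (rule the_equality)
  show "w \<in> S \<and> (\<forall>v\<in>T. pr w v = pr u (f v))" using assms(1,2) by auto
  fix w' assume "w' \<in> S \<and> (\<forall>v\<in>T. pr w' v = pr u (f v))"
  then show "w' = w" using assms(2) by (intro assms(3)) auto
qed

section \<open>Deformation of the double\<close>

text \<open>
  In the bialgebra case \<open>(dA, eA)\<close> is a coherent derivation, \<open>dB\<close> is the transpose of \<open>eA\<close>, and \<open>eB\<close>
  is the transpose of \<open>dA\<close>.  The conditions \<open>coherentA\<close> and \<open>admissibleA\<close> restrict the product, and
  \<open>coherentB\<close> and \<open>admissibleB\<close> restrict the coproduct; written this way they have the same shape,
  and the data are again symmetric.
\<close>

locale coherent_dual_pair = dual_pair s V t W pr mA mB lA lB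
  for s :: "'k::field_char_0 \<Rightarrow> 'a::ab_group_add \<Rightarrow> 'a" and V :: "'a set"
    and t :: "'k \<Rightarrow> 'b::ab_group_add \<Rightarrow> 'b" and W :: "'b set"
    and pr mA mB lA lB +
  fixes dA1 dA2 eA1 eA2 :: "'a \<Rightarrow> 'a" and dB1 dB2 eB1 eB2 :: "'b \<Rightarrow> 'b"
  assumes derA: "derivation_on s V mA dA1" "derivation_on s V mA dA2"
    and derB: "derivation_on t W mB dB1" "derivation_on t W mB dB2"
    and dA_comm: "x \<in> V \<Longrightarrow> dA1 (dA2 x) = dA2 (dA1 x)"
    and dB_comm: "v \<in> W \<Longrightarrow> dB1 (dB2 v) = dB2 (dB1 v)"
    and eA_closed: "x \<in> V \<Longrightarrow> eA1 x \<in> V" "x \<in> V \<Longrightarrow> eA2 x \<in> V"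
    and eB_closed: "v \<in> W \<Longrightarrow> eB1 v \<in> W" "v \<in> W \<Longrightarrow> eB2 v \<in> W"
    and pr_dB: "v \<in> W \<Longrightarrow> x \<in> V \<Longrightarrow> pr (dB1 v) x = pr v (eA1 x)"
      "v \<in> W \<Longrightarrow> x \<in> V \<Longrightarrow> pr (dB2 v) x = pr v (eA2 x)"
    and pr_eB: "v \<in> W \<Longrightarrow> x \<in> V \<Longrightarrow> pr (eB1 v) x = pr v (dA1 x)"
      "v \<in> W \<Longrightarrow> x \<in> V \<Longrightarrow> pr (eB2 v) x = pr v (dA2 x)"
    and coherentA: "x \<in> V \<Longrightarrow> y \<in> V \<Longrightarrow> mA x (eA1 y) = mA (dA1 x) y + eA1 (mA x y)"
      "x \<in> V \<Longrightarrow> y \<in> V \<Longrightarrow> mA x (eA2 y) = mA (dA2 x) y + eA2 (mA x y)"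
    and coherentB: "u \<in> W \<Longrightarrow> v \<in> W \<Longrightarrow> mB u (eB1 v) = mB (dB1 u) v + eB1 (mB u v)"
      "u \<in> W \<Longrightarrow> v \<in> W \<Longrightarrow> mB u (eB2 v) = mB (dB2 u) v + eB2 (mB u v)"
    and admissibleA: "x \<in> V \<Longrightarrow> y \<in> V \<Longrightarrow> mA (dA1 x) (dA2 y) = eA2 (mA x (dA1 y))"
      "x \<in> V \<Longrightarrow> y \<in> V \<Longrightarrow> mA (dA1 x) (dA2 y) = eA1 (mA (dA2 x) y)"
    and admissibleB: "u \<in> W \<Longrightarrow> v \<in> W \<Longrightarrow> mB (dB1 u) (dB2 v) = eB2 (mB u (dB1 v))"
      "u \<in> W \<Longrightarrow> v \<in> W \<Longrightarrow> mB (dB1 u) (dB2 v) = eB1 (mB (dB2 u) v)"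
begin

lemma swap_coherent: "coherent_dual_pair t W s V (\<lambda>x w. pr w x) mB mA lB lA dB1 dB2 eB1 eB2 dA1 dA2 eA1 eA2"
  by (intro coherent_dual_pair.intro swap, unfold_locales)
    ((rule pr_eB[symmetric] pr_dB[symmetric]; assumption)
      | fact derA derB dA_comm dB_comm eA_closed eB_closed coherentA coherentB admissibleA admissibleB)+

lemma lin_dA: "linear_on s V s V dA1" "linear_on s V s V dA2"
  using derA by (auto simp: derivation_on_def)

lemma lin_dB: "linear_on t W t W dB1" "linear_on t W t W dB2"
  using derB by (auto simp: derivation_on_def)

lemmas dA_closed = lin_dA[THEN linear_onD(1)] and dB_closed = lin_dB[THEN linear_onD(1)]

lemmas dA_pow = lin_dA[THEN linear_on_funpow] and dB_pow = lin_dB[THEN linear_on_funpow]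

lemmas dA_pow_closed = dA_pow[THEN linear_onD(1)] and dB_pow_closed = dB_pow[THEN linear_onD(1)]

abbreviation "D1 \<equiv> map_prod dA1 dB1"
abbreviation "D2 \<equiv> map_prod dA2 dB2"

lemma derivation_D1:
  "derivation_on (\<lambda>c. map_prod (s c) (t c)) (V \<times> W) (bowtie_product double) D1"
  by (intro derivation_double derA derB derivation_lA[of dA1 dB1 eA1] derivation_lB[of dA1 dB1 eB1]
      lin_dA lin_dB eA_closed eB_closed pr_dB pr_eB coherentA coherentB)

lemma derivation_D2:
  "derivation_on (\<lambda>c. map_prod (s c) (t c)) (V \<times> W) (bowtie_product double) D2"
  by (intro derivation_double derA derB derivation_lA[of dA2 dB2 eA2] derivation_lB[of dA2 dB2 eB2]
      lin_dA lin_dB eA_closed eB_closed pr_dB pr_eB coherentA coherentB)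

definition deformation :: "('k fps, 'a fps, 'b fps) assoc_pair" where
  "deformation = assoc_pair_deformation double D1 D2"

lemma deformation_simps:
  "scaleA deformation = fps_scale s" "carrierA deformation = power_series_over V"
  "scaleB deformation = fps_scale t" "carrierB deformation = power_series_over W"
  "multA deformation =
    fps_bilinear_ext (\<lambda>x y. divided_power_series s (\<lambda>k. mA ((dA1 ^^ k) x) ((dA2 ^^ k) y)))"
  "multB deformation =
    fps_bilinear_ext (\<lambda>u v. divided_power_series t (\<lambda>k. mB ((dB1 ^^ k) u) ((dB2 ^^ k) v)))"
  "leftA deformation =
    fps_bilinear_ext (\<lambda>x v. divided_power_series t (\<lambda>k. lA ((dA1 ^^ k) x) ((dB2 ^^ k) v)))"
  "rightA deformation =
    fps_bilinear_ext (\<lambda>x v. divided_power_series t (\<lambda>k. lA ((dA2 ^^ k) x) ((dB1 ^^ k) v)))"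
  "leftB deformation =
    fps_bilinear_ext (\<lambda>v x. divided_power_series s (\<lambda>k. lB ((dB1 ^^ k) v) ((dA2 ^^ k) x)))"
  "rightB deformation =
    fps_bilinear_ext (\<lambda>v x. divided_power_series s (\<lambda>k. lB ((dB2 ^^ k) v) ((dA1 ^^ k) x)))"
  by (simp_all add: deformation_def assoc_pair_deformation_def double_def map_prod_funpow Let_def)

lemma bilinear_deformation:
  "bilinear_on (fps_scale s) (power_series_over V) (fps_scale s) (power_series_over V)
    (fps_scale s) (power_series_over V) (multA deformation)"
  "bilinear_on (fps_scale t) (power_series_over W) (fps_scale t) (power_series_over W)
    (fps_scale t) (power_series_over W) (multB deformation)"
  "bilinear_on (fps_scale s) (power_series_over V) (fps_scale t) (power_series_over W)
    (fps_scale t) (power_series_over W) (leftA deformation)"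
  "bilinear_on (fps_scale s) (power_series_over V) (fps_scale t) (power_series_over W)
    (fps_scale t) (power_series_over W) (rightA deformation)"
  "bilinear_on (fps_scale t) (power_series_over W) (fps_scale s) (power_series_over V)
    (fps_scale s) (power_series_over V) (leftB deformation)"
  "bilinear_on (fps_scale t) (power_series_over W) (fps_scale s) (power_series_over V)
    (fps_scale s) (power_series_over V) (rightB deformation)"
  unfolding deformation_simps
  by (intro bilinear_on_deformation modA modB bilinear_on_comp[OF bilA] bilinear_on_comp[OF bilB]
      bilinear_on_comp[OF bilinear_lA] bilinear_on_comp[OF bilinear_lB] dA_pow dB_pow)+

text \<open>
  A pair of series in \<open>V[[h]] \<oplus> W[[h]]\<close> as a series in \<open>(V \<oplus> W)[[h]]\<close>; it carries the product of the
  deformed matched pair to the deformation of the double along \<open>D1\<close> and \<open>D2\<close>.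
\<close>

definition merge :: "'a fps \<times> 'b fps \<Rightarrow> ('a \<times> 'b) fps" where
  "merge p = Abs_fps (\<lambda>n. (fst p $ n, snd p $ n))"

lemma merge_bowtie:
  "merge (bowtie_product deformation p q)
    = deformed_product (\<lambda>c. map_prod (s c) (t c)) (bowtie_product double) D1 D2 (merge p) (merge q)"
proof (rule fps_ext)
  fix n
  obtain X U Y Z where pq: "p = (X, U)" "q = (Y, Z)" by fastforce
  have "rightB deformation Z X =
      fps_bilinear_ext (\<lambda>x v. divided_power_series s (\<lambda>k. lB ((dB2 ^^ k) v) ((dA1 ^^ k) x))) X Z"
    "rightA deformation Y U =
      fps_bilinear_ext (\<lambda>u y. divided_power_series t (\<lambda>k. lA ((dA2 ^^ k) y) ((dB1 ^^ k) u))) U Y"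
    unfolding deformation_simps by (rule fps_bilinear_ext_swap)+
  then show "merge (bowtie_product deformation p q) $ n
    = deformed_product (\<lambda>c. map_prod (s c) (t c)) (bowtie_product double) D1 D2 (merge p) (merge q) $ n"
    unfolding deformed_product_def deformation_nth
    by (intro prod_eqI)
      (simp_all add: merge_def bowtie_product_def[of deformation] pq fst_sum snd_sum case_prod_unfold
        deformation_simps deformation_nth map_prod_funpow mult_double A.scale_right_distrib
        B.scale_right_distrib sum.distrib)
qed

lemma assoc_matched_pair_deformation: "assoc_matched_pair deformation"
proof -
  let ?st = "\<lambda>c. map_prod (fps_scale s c) (fps_scale t c)"
  let ?C = "power_series_over V \<times> power_series_over W"
  have A: "module (fps_scale s)" "module.subspace (fps_scale s) (power_series_over V)"
    and B: "module (fps_scale t)" "module.subspace (fps_scale t) (power_series_over W)"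
    by (rule module_fps_scale subspace_power_series_over modA modB)+
  have dbl: "assoc_algebra (fps_scale (\<lambda>c. map_prod (s c) (t c))) (power_series_over (V \<times> W))
      (deformed_product (\<lambda>c. map_prod (s c) (t c)) (bowtie_product double) D1 D2)"
    by (rule assoc_algebra_deformed_product[OF assoc_double derivation_D1 derivation_D2])
      (auto simp: dA_comm dB_comm)
  have merge_mem: "merge p \<in> power_series_over (V \<times> W)" if "p \<in> ?C" for p
    using that by (auto simp: merge_def power_series_over_def)
  have merge_inj: "merge p = merge q \<Longrightarrow> p = q" for p q
    by (auto simp: merge_def fps_eq_iff intro!: prod_eqI)
  have bil: "bilinear_on ?st ?C ?st ?C ?st ?C (bowtie_product deformation)"
    using bilinear_on_Times[OF A B bilinear_deformation] by (simp add: bowtie_product_def)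
  have assoc: "bowtie_product deformation (bowtie_product deformation p q) r
      = bowtie_product deformation p (bowtie_product deformation q r)"
    if "p \<in> ?C" "q \<in> ?C" "r \<in> ?C" for p q r
    by (rule merge_inj) (simp add: merge_bowtie assoc_algebraD(4)[OF dbl] merge_mem that)
  have "assoc_algebra ?st ?C (bowtie_product deformation)"
    unfolding assoc_algebra_def
    using bil assoc module_map_prod[OF A(1) B(1)] subspace_Times[OF A(1) B(1) A(2) B(2)] by blast
  moreover have "assoc_algebra (fps_scale s) (power_series_over V) (multA deformation)"
    using assoc_algebra_deformed_product[OF algA derA dA_comm]
    by (simp add: deformation_simps deformed_product_def)
  moreover have "assoc_algebra (fps_scale t) (power_series_over W) (multB deformation)"
    using assoc_algebra_deformed_product[OF algB derB dB_comm]
    by (simp add: deformation_simps deformed_product_def)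
  ultimately show ?thesis
    unfolding assoc_matched_pair_def using bilinear_deformation by (simp add: deformation_simps)
qed

text \<open>
  In the inductive step one factor \<open>dA1\<close> (or \<open>dA2\<close>) has to be moved past a power of the other
  derivation, which is where their commutation is used.
\<close>

lemma admissibleA_pow:
  assumes "x \<in> V" "y \<in> V"
  shows "mA ((dA1 ^^ k) x) ((dA2 ^^ k) y) = (eA2 ^^ k) (mA x ((dA1 ^^ k) y))"
    "mA ((dA1 ^^ k) x) ((dA2 ^^ k) y) = (eA1 ^^ k) (mA ((dA2 ^^ k) x) y)"
proof -
  have c1: "dA1 ((dA2 ^^ i) z) = (dA2 ^^ i) (dA1 z)" if "z \<in> V" for i z
    using that by (induction i) (auto simp: dA_comm dA_pow_closed)
  have c2: "dA2 ((dA1 ^^ i) z) = (dA1 ^^ i) (dA2 z)" if "z \<in> V" for i z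
    using that by (induction i) (auto simp: dA_comm[symmetric] dA_pow_closed)
  show "mA ((dA1 ^^ k) x) ((dA2 ^^ k) y) = (eA2 ^^ k) (mA x ((dA1 ^^ k) y))" using assms
  proof (induction k arbitrary: y)
    case (Suc k)
    have "mA ((dA1 ^^ Suc k) x) ((dA2 ^^ Suc k) y) = eA2 (mA ((dA1 ^^ k) x) ((dA2 ^^ k) (dA1 y)))"
      using Suc.prems by (simp add: admissibleA(1) dA_pow_closed c1)
    also have "\<dots> = (eA2 ^^ Suc k) (mA x ((dA1 ^^ Suc k) y))"
      using Suc by (simp add: dA_closed funpow_swap1)
    finally show ?case .
  qed simp
  show "mA ((dA1 ^^ k) x) ((dA2 ^^ k) y) = (eA1 ^^ k) (mA ((dA2 ^^ k) x) y)" using assms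
  proof (induction k arbitrary: x)
    case (Suc k)
    have "mA ((dA1 ^^ Suc k) x) ((dA2 ^^ Suc k) y) = eA1 (mA ((dA1 ^^ k) (dA2 x)) ((dA2 ^^ k) y))"
      using Suc.prems by (simp add: admissibleA(2) dA_pow_closed c2)
    also have "\<dots> = (eA1 ^^ Suc k) (mA ((dA2 ^^ Suc k) x) y)"
      using Suc by (simp add: dA_closed funpow_swap1)
    finally show ?case .
  qed simp
qed

lemma pr_dB_pow:
  assumes "v \<in> W" "x \<in> V"
  shows "pr ((dB1 ^^ k) v) x = pr v ((eA1 ^^ k) x)" "pr ((dB2 ^^ k) v) x = pr v ((eA2 ^^ k) x)"
proof -
  show "pr ((dB1 ^^ k) v) x = pr v ((eA1 ^^ k) x)" using assms
    by (induction k arbitrary: x) (auto simp: pr_dB dB_pow_closed eA_closed funpow_swap1[of eA1])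
  show "pr ((dB2 ^^ k) v) x = pr v ((eA2 ^^ k) x)" using assms
    by (induction k arbitrary: x) (auto simp: pr_dB dB_pow_closed eA_closed funpow_swap1[of eA2])
qed

text \<open>
  The term of degree \<open>k\<close> of a deformed action is the transpose of the term of degree \<open>k\<close> of the deformed
  multiplication: the power of \<open>dB\<close> is transposed to a power of \<open>eA\<close>, which admissibility then absorbs.
\<close>

lemma pr_actionsA:
  assumes "x \<in> V" "v \<in> W" "y \<in> V"
  shows "pr (lA ((dA1 ^^ k) x) ((dB2 ^^ k) v)) y = pr v (mA ((dA1 ^^ k) y) ((dA2 ^^ k) x))"
    "pr (lA ((dA2 ^^ k) x) ((dB1 ^^ k) v)) y = pr v (mA ((dA1 ^^ k) x) ((dA2 ^^ k) y))"
proof -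
  show "pr (lA ((dA1 ^^ k) x) ((dB2 ^^ k) v)) y = pr v (mA ((dA1 ^^ k) y) ((dA2 ^^ k) x))"
    using assms
    by (simp add: pr_lA dA_pow_closed dB_pow_closed pr_dB_pow closedA admissibleA_pow(1) commA[of _ y])
  show "pr (lA ((dA2 ^^ k) x) ((dB1 ^^ k) v)) y = pr v (mA ((dA1 ^^ k) x) ((dA2 ^^ k) y))"
    using assms
    by (simp add: pr_lA dA_pow_closed dB_pow_closed pr_dB_pow closedA admissibleA_pow(2))
qed

text \<open>
  Bilinear extensions of termwise transposes are transposes for the topological pairing.
\<close>

lemma pairing_h_adjoint:
  assumes f: "\<And>k x v. x \<in> V \<Longrightarrow> v \<in> W \<Longrightarrow> f k x v \<in> W"
    and g: "\<And>k x y. x \<in> V \<Longrightarrow> y \<in> V \<Longrightarrow> g k x y \<in> V"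
    and adj: "\<And>k x v y. x \<in> V \<Longrightarrow> v \<in> W \<Longrightarrow> y \<in> V \<Longrightarrow> pr (f k x v) y = pr v (g k x y)"
    and X: "X \<in> power_series_over V" and U: "U \<in> power_series_over W" and Y: "Y \<in> power_series_over V"
  shows "pairing_h (fps_bilinear_ext (\<lambda>x v. divided_power_series t (\<lambda>k. f k x v)) X U) Y
    = pairing_h U (fps_bilinear_ext (\<lambda>x y. divided_power_series s (\<lambda>k. g k x y)) X Y)"
proof (rule fps_ext)
  fix n
  note mem = power_series_over_nth[OF X] power_series_over_nth[OF U] power_series_over_nth[OF Y]
  have sum1: "pr (\<Sum>i\<in>I. w i) y = (\<Sum>i\<in>I. pr (w i) y)" if "\<And>i. i \<in> I \<Longrightarrow> w i \<in> W" "y \<in> V"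
    for I :: "(nat \<times> nat \<times> nat) set" and w y
    using linear_on_sum[OF modB lin_pr(2)] that by blast
  have sum2: "pr w (\<Sum>i\<in>I. y i) = (\<Sum>i\<in>I. pr w (y i))" if "\<And>i. i \<in> I \<Longrightarrow> y i \<in> V" "w \<in> W"
    for I :: "(nat \<times> nat \<times> nat) set" and w y
    using linear_on_sum[OF modA lin_pr(1)] that by blast
  have "pairing_h (fps_bilinear_ext (\<lambda>x v. divided_power_series t (\<lambda>k. f k x v)) X U) Y $ n
      = (\<Sum>(p, q)\<in>tuples2 n. \<Sum>(i, j, k)\<in>tuples3 p. inverse (fact k) * pr (U $ j) (g k (X $ i) (Y $ q)))"
    unfolding pairing_h_nth deformation_nth case_prod_unfold
    by (intro sum.cong refl, subst sum1) (simp_all add: mem f subB pr_simps adj)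
  also have "\<dots> = (\<Sum>(j, p)\<in>tuples2 n. \<Sum>(i, q, k)\<in>tuples3 p. inverse (fact k) * pr (U $ j) (g k (X $ i) (Y $ q)))"
    unfolding case_prod_unfold
    by (subst (1 2) sum.Sigma, simp, simp, simp, simp, rule sum.reindex_bij_witness[of _
          "\<lambda>((j, p), (i, q, k)). ((i + j + k, q), (i, j, k))"
          "\<lambda>((p, q), (i, j, k)). ((j, i + q + k), (i, q, k))"])
      (auto simp: tuples2_def tuples3_def)
  also have "\<dots> = pairing_h U (fps_bilinear_ext (\<lambda>x y. divided_power_series s (\<lambda>k. g k x y)) X Y) $ n"
    unfolding pairing_h_nth deformation_nth case_prod_unfold
    by (intro sum.cong refl, subst sum2) (simp_all add: mem g subA pr_simps)
  finally show "pairing_h (fps_bilinear_ext (\<lambda>x v. divided_power_series t (\<lambda>k. f k x v)) X U) Y $ n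
    = pairing_h U (fps_bilinear_ext (\<lambda>x y. divided_power_series s (\<lambda>k. g k x y)) X Y) $ n" .
qed

lemma pairing_h_actionsA:
  assumes X: "X \<in> power_series_over V" and U: "U \<in> power_series_over W" and Y: "Y \<in> power_series_over V"
  shows "pairing_h (leftA deformation X U) Y = pairing_h U (multA deformation Y X)"
    "pairing_h (rightA deformation X U) Y = pairing_h U (multA deformation X Y)"
proof -
  have "multA deformation Y X =
      fps_bilinear_ext (\<lambda>x y. divided_power_series s (\<lambda>k. mA ((dA1 ^^ k) y) ((dA2 ^^ k) x))) X Y"
    unfolding deformation_simps by (rule fps_bilinear_ext_swap)
  then show "pairing_h (leftA deformation X U) Y = pairing_h U (multA deformation Y X)"
    unfolding deformation_simps(7)
    by (simp only:) (rule pairing_h_adjoint; simp add: pr_actionsA(1) lA_closed closedA dA_pow_closed dB_pow_closed X U Y)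
  show "pairing_h (rightA deformation X U) Y = pairing_h U (multA deformation X Y)"
    unfolding deformation_simps
    by (intro pairing_h_adjoint) (simp_all add: pr_actionsA(2) lA_closed closedA dA_pow_closed dB_pow_closed X U Y)
qed

lemma pairing_h_actionsB:
  assumes U: "U \<in> power_series_over W" and X: "X \<in> power_series_over V" and Z: "Z \<in> power_series_over W"
  shows "pairing_h Z (leftB deformation U X) = pairing_h (multB deformation Z U) X"
    "pairing_h Z (rightB deformation U X) = pairing_h (multB deformation U Z) X"
proof -
  interpret sw: coherent_dual_pair t W s V "\<lambda>x w. pr w x" mB mA lB lA dB1 dB2 eB1 eB2 dA1 dA2 eA1 eA2
    by (rule swap_coherent)
  note sw = sw.pairing_h_actionsA[OF U X Z, unfolded pairing_h_swap]
  show "pairing_h Z (leftB deformation U X) = pairing_h (multB deformation Z U) X"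
    using sw(1) by (simp only: deformation_simps sw.deformation_simps)
  show "pairing_h Z (rightB deformation U X) = pairing_h (multB deformation U Z) X"
    using sw(2) by (simp only: deformation_simps sw.deformation_simps)
qed

lemma pairing_h_nondegA:
  assumes "X \<in> power_series_over V" "X' \<in> power_series_over V"
    and "\<And>U. U \<in> power_series_over W \<Longrightarrow> pairing_h U X = pairing_h U X'"
  shows "X = X'"
  using dual_pair.pairing_h_nondegB[OF swap, unfolded pairing_h_swap] assms by blast

lemma deformation_closed:
  "X \<in> power_series_over V \<Longrightarrow> U \<in> power_series_over W \<Longrightarrow> leftA deformation X U \<in> power_series_over W"
  "X \<in> power_series_over V \<Longrightarrow> U \<in> power_series_over W \<Longrightarrow> rightA deformation X U \<in> power_series_over W"
  "U \<in> power_series_over W \<Longrightarrow> X \<in> power_series_over V \<Longrightarrow> leftB deformation U X \<in> power_series_over V"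
  "U \<in> power_series_over W \<Longrightarrow> X \<in> power_series_over V \<Longrightarrow> rightB deformation U X \<in> power_series_over V"
  using bilinear_deformation(3-)[THEN bilinear_onD(1)] by auto

text \<open>
  The deformed actions satisfy the defining property of the transposes, which are unique because the
  topological pairing is nondegenerate.
\<close>

lemma duality_pair_coincides:
  assumes mBh: "\<And>U Z. U \<in> power_series_over W \<Longrightarrow> Z \<in> power_series_over W \<Longrightarrow>
    mBh U Z = multB deformation U Z"
  shows "assoc_pairs_coincide
    (duality_pair (fps_scale s) (power_series_over V) (multA deformation)
      (fps_scale t) (power_series_over W) mBh pairing_h) deformation"
proof -
  have "transpose_wrt pairing_h (power_series_over W) (power_series_over V) (\<lambda>Y. multA deformation Y X) U
      = leftA deformation X U"
    "transpose_wrt pairing_h (power_series_over W) (power_series_over V) (\<lambda>Y. multA deformation X Y) U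
      = rightA deformation X U"
    if "X \<in> power_series_over V" "U \<in> power_series_over W" for X U
    using that by (auto intro!: transpose_wrt_eqI deformation_closed pairing_h_actionsA intro: pairing_h_nondegB)
  moreover have
    "transpose_wrt (\<lambda>X Z. pairing_h Z X) (power_series_over V) (power_series_over W) (\<lambda>Z. mBh Z U) X
      = leftB deformation U X"
    "transpose_wrt (\<lambda>X Z. pairing_h Z X) (power_series_over V) (power_series_over W) (\<lambda>Z. mBh U Z) X
      = rightB deformation U X"
    if "X \<in> power_series_over V" "U \<in> power_series_over W" for X U
    using that
    by (auto simp: mBh intro!: transpose_wrt_eqI deformation_closed pairing_h_actionsB intro: pairing_h_nondegA)
  ultimately show ?thesis
    by (simp add: assoc_pairs_coincide_def duality_pair_def deformation_simps(1-4) mBh)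
qed

section \<open>The quasiclassical limit\<close>

abbreviation "qcl \<equiv> assoc_pair_qcl double deformation"

lemma qcl_simps:
  "scaleP qcl = s" "carrierP qcl = V" "scaleQ qcl = t" "carrierQ qcl = W"
  "multP qcl = mA" "multQ qcl = mB" "rho_multP qcl = lA" "rho_multQ qcl = lB"
  "bracketP qcl = qcl_bracket (multA deformation)" "bracketQ qcl = qcl_bracket (multB deformation)"
  by (simp_all add: assoc_pair_qcl_def double_def)

lemma qcl_brackets:
  "x \<in> V \<Longrightarrow> y \<in> V \<Longrightarrow>
    qcl_bracket (multA deformation) x y = mA (dA1 x) (dA2 y) - mA (dA1 y) (dA2 x)"
  "u \<in> W \<Longrightarrow> v \<in> W \<Longrightarrow>
    qcl_bracket (multB deformation) u v = mB (dB1 u) (dB2 v) - mB (dB1 v) (dB2 u)"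
  "x \<in> V \<Longrightarrow> v \<in> W \<Longrightarrow> rho_bracketP qcl x v = lA (dA1 x) (dB2 v) - lA (dA2 x) (dB1 v)"
  "v \<in> W \<Longrightarrow> x \<in> V \<Longrightarrow> rho_bracketQ qcl v x = lB (dB1 v) (dA2 x) - lB (dB2 v) (dA1 x)"
proof -
  have b: "bilinear_on s V s V s V (\<lambda>x y. mA ((dA1 ^^ k) x) ((dA2 ^^ k) y))"
    "bilinear_on t W t W t W (\<lambda>u v. mB ((dB1 ^^ k) u) ((dB2 ^^ k) v))"
    "bilinear_on s V t W t W (\<lambda>x v. lA ((dA1 ^^ k) x) ((dB2 ^^ k) v))"
    "bilinear_on s V t W t W (\<lambda>x v. lA ((dA2 ^^ k) x) ((dB1 ^^ k) v))"
    "bilinear_on t W s V s V (\<lambda>v x. lB ((dB1 ^^ k) v) ((dA2 ^^ k) x))"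
    "bilinear_on t W s V s V (\<lambda>v x. lB ((dB2 ^^ k) v) ((dA1 ^^ k) x))" for k
    by (intro bilinear_on_comp[OF bilA] bilinear_on_comp[OF bilB] bilinear_on_comp[OF bilinear_lA]
        bilinear_on_comp[OF bilinear_lB] dA_pow dB_pow)+
  note c = deformation_const[OF modA modA modA(1) b(1)] deformation_const[OF modB modB modB(1) b(2)]
    deformation_const[OF modA modB modB(1) b(3)] deformation_const[OF modA modB modB(1) b(4)]
    deformation_const[OF modB modA modA(1) b(5)] deformation_const[OF modB modA modA(1) b(6)]
  note d = div_h_divided_power_series[OF modA(1)] div_h_divided_power_series[OF modB(1)]
  show "x \<in> V \<Longrightarrow> y \<in> V \<Longrightarrow>
      qcl_bracket (multA deformation) x y = mA (dA1 x) (dA2 y) - mA (dA1 y) (dA2 x)"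
    "u \<in> W \<Longrightarrow> v \<in> W \<Longrightarrow>
      qcl_bracket (multB deformation) u v = mB (dB1 u) (dB2 v) - mB (dB1 v) (dB2 u)"
    "x \<in> V \<Longrightarrow> v \<in> W \<Longrightarrow> rho_bracketP qcl x v = lA (dA1 x) (dB2 v) - lA (dA2 x) (dB1 v)"
    "v \<in> W \<Longrightarrow> x \<in> V \<Longrightarrow> rho_bracketQ qcl v x = lB (dB1 v) (dA2 x) - lB (dB2 v) (dA1 x)"
    by (simp_all add: qcl_bracket_def assoc_pair_qcl_def deformation_simps c d)
qed

lemma pr_rho_bracketP:
  assumes "x \<in> V" "v \<in> W" "y \<in> V"
  shows "pr (rho_bracketP qcl x v) y = - pr v (qcl_bracket (multA deformation) x y)"
  using assms pr_actionsA[OF assms, of 1]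
  by (simp add: qcl_brackets pr_diff lA_closed dA_closed dB_closed closedA)

lemma pr_rho_bracketQ:
  assumes "v \<in> W" "x \<in> V" "w \<in> W"
  shows "pr w (rho_bracketQ qcl v x) = - pr (qcl_bracket (multB deformation) v w) x"
  using assms coherent_dual_pair.pr_actionsA[OF swap_coherent assms, of 1]
  by (simp add: qcl_brackets pr_diff lB_closed dA_closed dB_closed closedB)

text \<open>
  The bracket on \<open>V \<oplus> W\<close> assembled from the components of the quasiclassical limit is
  \<open>D1 a \<odot> D2 b - D1 b \<odot> D2 a\<close>; on the two summands it restricts to the brackets given by the restricted
  derivations.
\<close>

lemma poisson_matched_pair_qcl: "poisson_matched_pair qcl"
proof -
  have A: "poisson_algebra s V (qcl_bracket (multA deformation)) mA"
    by (rule poisson_algebra_cong[OF refl _ poisson_algebra_commuting_derivations[OF algA commA derA dA_comm]])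
      (simp add: qcl_brackets)
  have B: "poisson_algebra t W (qcl_bracket (multB deformation)) mB"
    by (rule poisson_algebra_cong[OF refl _ poisson_algebra_commuting_derivations[OF algB commB derB dB_comm]])
      (simp add: qcl_brackets)
  have "poisson_algebra (\<lambda>c. map_prod (s c) (t c)) (V \<times> W)
      (\<lambda>a b. D1 a \<odot> D2 b - D1 b \<odot> D2 a) (bowtie_product double)"
    by (rule poisson_algebra_commuting_derivations[OF assoc_double double_comm derivation_D1 derivation_D2])
      (auto simp: dA_comm dB_comm)
  then have AB: "poisson_algebra (\<lambda>c. map_prod (s c) (t c)) (V \<times> W)
      (bowtie_bracket qcl) (bowtie_poisson_product qcl)"
    by (rule poisson_algebra_cong[rotated 2])
      (auto simp: mult_double bowtie_bracket_def bowtie_poisson_product_def qcl_simps qcl_brackets)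
  have "bilinear_on s V t W t W (rho_bracketP qcl)"
    by (subst bilinear_on_cong[OF _ modA modB], erule (1) qcl_brackets(3))
      (intro bilinear_on_diff_comp[OF modB] bilinear_on_comp[OF bilinear_lA] lin_dA lin_dB)
  moreover have "bilinear_on t W s V s V (rho_bracketQ qcl)"
    by (subst bilinear_on_cong[OF _ modB modA], erule (1) qcl_brackets(4))
      (intro bilinear_on_diff_comp[OF modA] bilinear_on_comp[OF bilinear_lB] lin_dA lin_dB)
  ultimately show ?thesis
    unfolding poisson_matched_pair_def using A B AB
    by (simp add: qcl_simps bilinear_lA bilinear_lB)
qed

end

section \<open>The dual space\<close>

lemma module_func_scale: "module (func_scale :: 'k::field \<Rightarrow> ('x \<Rightarrow> 'k) \<Rightarrow> 'x \<Rightarrow> 'k)"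
proof -
  interpret vector_space "func_scale :: 'k \<Rightarrow> ('x \<Rightarrow> 'k) \<Rightarrow> 'x \<Rightarrow> 'k"
    by (rule vector_space_func_scale)
  show ?thesis by (rule module_axioms)
qed

lemma vector_space_imp_module: "vector_space s \<Longrightarrow> module s"
  by (simp add: module_def vector_space_def)

lemma vector_space_mult: "vector_space ((*) :: 'k::field \<Rightarrow> 'k \<Rightarrow> 'k)"
  by unfold_locales (auto simp: algebra_simps)

lemma linear_iff_linear_on:
  assumes "vector_space s" "vector_space t"
  shows "Vector_Spaces.linear s t f \<longleftrightarrow> linear_on s UNIV t UNIV f"
  using assms by (auto simp: Vector_Spaces.linear_iff linear_on_def)

lemma dual_iff:
  assumes "vector_space s"
  shows "u \<in> dual s \<longleftrightarrow> linear_on s UNIV (*) UNIV u"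
  by (simp add: dual_def linear_iff_linear_on[OF assms vector_space_mult])

lemma subspace_dual:
  assumes s: "vector_space s"
  shows "module.subspace func_scale (dual s)"
proof -
  interpret f: module "func_scale :: _ \<Rightarrow> (_ \<Rightarrow> 'a) \<Rightarrow> _" by (rule module_func_scale)
  show ?thesis
    by (rule f.subspaceI)
      (auto simp: dual_iff[OF s] linear_on_def func_scale_def algebra_simps)
qed

lemma eval_pairing_bilinear:
  assumes s: "vector_space s"
  shows "bilinear_on func_scale (dual s) s UNIV (*) UNIV eval_pairing"
  by (auto simp: bilinear_on_def linear_on_def eval_pairing_def dual_iff[OF s] func_scale_def)

lemma dual_separates:
  fixes s :: "'k::field \<Rightarrow> 'a::ab_group_add \<Rightarrow> 'a"
  assumes s: "vector_space s" and x: "\<And>u. u \<in> dual s \<Longrightarrow> u x = 0"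
  shows "x = 0"
proof (rule ccontr)
  assume "x \<noteq> 0"
  interpret vector_space_pair s "(*) :: 'k \<Rightarrow> 'k \<Rightarrow> 'k"
    by (rule vector_space_pair.intro[OF s vector_space_mult])
  have "vs1.independent {x}" using \<open>x \<noteq> 0\<close> by (simp add: vs1.dependent_single)
  then obtain u where "Vector_Spaces.linear s (*) u" "u x = (1::'k)"
    using linear_independent_extend[of "{x}" "\<lambda>_. 1"] by auto
  then show False using x[of u] by (simp add: dual_def)
qed

text \<open>
  The point is \<open>\<Sum>\<^sub>b \<phi>(b*) b\<close>, the sum over the basis with its dual basis.  Finite dimension enters only
  here, through the finiteness of this sum.
\<close>

lemma bidual_evaluation:
  fixes s :: "'k::field \<Rightarrow> 'a::ab_group_add \<Rightarrow> 'a"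
  assumes fd: "finite_dimensional_vector_space s Basis"
    and \<phi>: "linear_on func_scale (dual s) (*) UNIV \<phi>"
  obtains x where "\<And>w. w \<in> dual s \<Longrightarrow> w x = \<phi> w"
proof -
  interpret finite_dimensional_vector_space s Basis by fact
  have s: "vector_space s" by unfold_locales
  define c where "c b y = representation Basis y b" for b y
  have span: "y \<in> span Basis" for y by (simp add: span_Basis)
  have c: "c b \<in> dual s" for b
    unfolding dual_iff[OF s] linear_on_def c_def
    by (simp add: representation_add representation_scale independent_Basis span_Basis)
  have expand: "y = (\<Sum>b\<in>Basis. s (c b y) b)" for y
    unfolding c_def
    by (rule sum_representation_eq[symmetric]) (auto simp: independent_Basis span_Basis finite_Basis)
  have sum_apply: "(\<Sum>b\<in>B. F b) y = (\<Sum>b\<in>B. F b y)" for B and F :: "'a \<Rightarrow> 'a \<Rightarrow> 'k" and y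
    by (induction B rule: infinite_finite_induct) auto
  have w: "w = (\<Sum>b\<in>Basis. func_scale (w b) (c b))" if "w \<in> dual s" for w
  proof
    fix y
    have lin: "linear_on s UNIV (*) UNIV w" using that by (simp add: dual_iff[OF s])
    have "w y = w (\<Sum>b\<in>Basis. s (c b y) b)" using expand[of y] by simp
    also have "\<dots> = (\<Sum>b\<in>Basis. w (s (c b y) b))"
      by (rule linear_on_sum[OF vector_space_imp_module[OF s] subspace_UNIV lin]) simp
    also have "\<dots> = (\<Sum>b\<in>Basis. func_scale (w b) (c b)) y"
      by (simp add: linear_onD(3)[OF lin] func_scale_def mult.commute sum_apply)
    finally show "w y = (\<Sum>b\<in>Basis. func_scale (w b) (c b)) y" .
  qed
  interpret f: module "func_scale :: 'k \<Rightarrow> ('a \<Rightarrow> 'k) \<Rightarrow> _" by (rule module_func_scale)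
  show thesis
  proof (rule that[of "\<Sum>b\<in>Basis. s (\<phi> (c b)) b"])
    fix w assume wd: "w \<in> dual s"
    then have lin: "linear_on s UNIV (*) UNIV w" by (simp add: dual_iff[OF s])
    have "w (\<Sum>b\<in>Basis. s (\<phi> (c b)) b) = (\<Sum>b\<in>Basis. w b * \<phi> (c b))"
      by (subst linear_on_sum[OF vector_space_imp_module[OF s] subspace_UNIV lin])
        (simp_all add: linear_onD(3)[OF lin] mult.commute)
    also have "\<dots> = \<phi> (\<Sum>b\<in>Basis. func_scale (w b) (c b))"
      by (subst linear_on_sum[OF module_func_scale subspace_dual[OF s] \<phi>])
        (simp_all add: f.subspace_scale[OF subspace_dual[OF s]] c linear_onD(3)[OF \<phi>])
    finally show "w (\<Sum>b\<in>Basis. s (\<phi> (c b)) b) = \<phi> w" using w[OF wd] by simp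
  qed
qed

lemma transpose_eval:
  assumes s: "vector_space s" and f: "linear_on s UNIV s UNIV f" and u: "u \<in> dual s"
  shows "transpose_wrt eval_pairing (dual s) UNIV f u = (\<lambda>x. u (f x))"
proof (rule transpose_wrt_eqI)
  show "(\<lambda>x. u (f x)) \<in> dual s"
    using f u linear_on_comp unfolding dual_iff[OF s] by blast
qed (auto simp: eval_pairing_def)

lemma transpose_bidual:
  fixes s :: "'k::field \<Rightarrow> 'a::ab_group_add \<Rightarrow> 'a"
  assumes fd: "finite_dimensional_vector_space s Basis"
    and f: "linear_on func_scale (dual s) func_scale (dual s) f" and w: "w \<in> dual s"
  shows "w (transpose_wrt (\<lambda>x w. eval_pairing w x) UNIV (dual s) f x) = f w x"
proof -
  have s: "vector_space s"
    using fd by (simp add: finite_dimensional_vector_space_def)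
  have "linear_on func_scale (dual s) (*) UNIV (\<lambda>w. f w x)"
    using f by (auto simp: linear_on_def func_scale_def)
  then obtain y where y: "\<And>w. w \<in> dual s \<Longrightarrow> w y = f w x"
    by (rule bidual_evaluation[OF fd]) blast
  have "transpose_wrt (\<lambda>x w. eval_pairing w x) UNIV (dual s) f x = y"
  proof (rule transpose_wrt_eqI)
    fix z assume z: "\<And>w. w \<in> dual s \<Longrightarrow> eval_pairing w z = eval_pairing w y"
    have "z - y = 0"
    proof (rule dual_separates[OF s])
      fix u assume u: "u \<in> dual s"
      interpret module s using vector_space_imp_module[OF s] .
      have "linear_on s UNIV (*) UNIV u" using u by (simp add: dual_iff[OF s])
      from linear_on_diff[OF module_axioms subspace_UNIV this]
      show "u (z - y) = 0" using z[OF u] by (simp add: eval_pairing_def)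
    qed
    then show "z = y" by simp
  qed (auto simp: eval_pairing_def y)
  then show ?thesis using y[OF w] by simp
qed

section \<open>The dual algebra of a coalgebra\<close>

lemma bilinear_form_functionals:
  assumes "vector_space s" "u \<in> dual s" "v \<in> dual s"
  shows "bilinear_form s (\<lambda>x y. u x * v y)"
  using assms(2,3)
  by (auto simp: bilinear_form_def bilinear_on_def linear_on_def dual_iff[OF assms(1)] algebra_simps)

text \<open>
  An element of the tensor square is a function on all maps in two variables; it is linear on bilinear forms
  since a pure tensor is an evaluation.
\<close>

lemma tensor_square_linear:
  fixes s :: "'k::field \<Rightarrow> 'a::ab_group_add \<Rightarrow> 'a"
  assumes s: "vector_space s" and T: "T \<in> tensor_square s"
    and \<beta>: "bilinear_form s \<beta>" and \<gamma>: "bilinear_form s \<gamma>"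
  shows "T (\<lambda>x y. \<beta> x y + \<gamma> x y) = T \<beta> + T \<gamma>" "T (\<lambda>x y. c * \<beta> x y) = c * T \<beta>"
proof -
  interpret fs: vector_space "func_scale :: 'k \<Rightarrow> (('a \<Rightarrow> 'a \<Rightarrow> 'k) \<Rightarrow> 'k) \<Rightarrow> _"
    by (rule vector_space_func_scale)
  have b: "bilinear_form s (\<lambda>x y. \<beta> x y + \<gamma> x y)" "bilinear_form s (\<lambda>x y. c * \<beta> x y)"
    using \<beta> \<gamma> by (auto simp: bilinear_form_def bilinear_on_def linear_on_def algebra_simps)
  have "T (\<lambda>x y. \<beta> x y + \<gamma> x y) = T \<beta> + T \<gamma> \<and> T (\<lambda>x y. c * \<beta> x y) = c * T \<beta>"
    using T unfolding tensor_square_def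
  proof (induction rule: fs.span_induct_alt)
    case base
    then show ?case by simp
  next
    case (step a p T)
    then obtain x y where "p = pure_tensor s x y" by blast
    then show ?case
      using step(2) b \<beta> \<gamma> by (simp add: func_scale_def pure_tensor_def algebra_simps)
  qed
  then show "T (\<lambda>x y. \<beta> x y + \<gamma> x y) = T \<beta> + T \<gamma>" "T (\<lambda>x y. c * \<beta> x y) = c * T \<beta>" by auto
qed

lemma functional_tensor_map:
  assumes "vector_space s" "u \<in> dual s" "v \<in> dual s"
  shows "functional_tensor u v (tensor_map s f g T) = functional_tensor (\<lambda>x. u (f x)) (\<lambda>x. v (g x)) T"
  using bilinear_form_functionals[OF assms] by (simp add: functional_tensor_def tensor_map_def)

lemma functional_tensor_flip:
  fixes u v :: "'a \<Rightarrow> 'k::field"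
  shows "functional_tensor u v (tensor_flip T) = functional_tensor v u T"
  by (simp add: functional_tensor_def tensor_flip_def mult.commute)

text \<open>
  Associativity at \<open>u\<close>, \<open>v\<close>, \<open>w\<close> is coassociativity tested against the trilinear form \<open>u \<otimes> v \<otimes> w\<close>.
\<close>

lemma assoc_algebra_dual_op:
  fixes s :: "'k::field \<Rightarrow> 'a::ab_group_add \<Rightarrow> 'a"
  assumes "coassoc_coalgebra s \<Delta>"
  shows "assoc_algebra func_scale (dual s) (dual_op \<Delta>)"
proof -
  have s: "vector_space s" and \<Delta>: "linear_on s UNIV func_scale (tensor_square s) \<Delta>"
    and coassoc: "\<And>x \<gamma>. trilinear_form s \<gamma> \<Longrightarrow>
        \<Delta> x (\<lambda>a b. \<Delta> a (\<lambda>p q. \<gamma> p q b)) = \<Delta> x (\<lambda>a b. \<Delta> b (\<lambda>p q. \<gamma> a p q))"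
    using assms by (auto simp: coassoc_coalgebra_def)
  note T = linear_onD(1)[OF \<Delta> UNIV_I]
  note bf = bilinear_form_functionals[OF s]
  note lin = tensor_square_linear[OF s T]
  have closed: "dual_op \<Delta> u v \<in> dual s" for u v
    using linear_onD(2,3)[OF \<Delta>]
    by (auto simp: dual_iff[OF s] linear_on_def dual_op_def functional_tensor_def func_scale_def)
  have add1: "dual_op \<Delta> (u + u') v = dual_op \<Delta> u v + dual_op \<Delta> u' v"
    and add2: "dual_op \<Delta> v (u + u') = dual_op \<Delta> v u + dual_op \<Delta> v u'"
    if "u \<in> dual s" "u' \<in> dual s" "v \<in> dual s" for u u' v
    using lin(1)[OF bf[OF that(1,3)] bf[OF that(2,3)]] lin(1)[OF bf[OF that(3,1)] bf[OF that(3,2)]]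
    by (auto simp: dual_op_def functional_tensor_def distrib_left distrib_right)
  have scale1: "dual_op \<Delta> (func_scale c u) v = func_scale c (dual_op \<Delta> u v)"
    and scale2: "dual_op \<Delta> v (func_scale c u) = func_scale c (dual_op \<Delta> v u)"
    if "u \<in> dual s" "v \<in> dual s" for c u v
    using lin(2)[OF bf[OF that] bf[OF that]] lin(2)[OF bf[OF that(2,1)] bf[OF that]]
    by (auto simp: dual_op_def functional_tensor_def func_scale_def mult.assoc mult.left_commute)
  have "bilinear_on func_scale (dual s) func_scale (dual s) func_scale (dual s) (dual_op \<Delta>)"
    using closed add1 add2 scale1 scale2 by (auto simp: bilinear_on_def linear_on_def)
  moreover have "dual_op \<Delta> (dual_op \<Delta> u v) w = dual_op \<Delta> u (dual_op \<Delta> v w)"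
    if uvw: "u \<in> dual s" "v \<in> dual s" "w \<in> dual s" for u v w
  proof
    fix x
    have tri: "trilinear_form s (\<lambda>a b c. u a * v b * w c)"
      using uvw
      by (auto simp: trilinear_form_def bilinear_form_def bilinear_on_def linear_on_def dual_iff[OF s]
          algebra_simps)
    have "\<Delta> a (\<lambda>p q. u p * v q) * w b = \<Delta> a (\<lambda>p q. u p * v q * w b)" for a b
      using lin(2)[OF bf[OF uvw(1,2)] bf[OF uvw(1,2)], of a "w b"] by (simp add: mult.commute)
    moreover have "u a * \<Delta> b (\<lambda>p q. v p * w q) = \<Delta> b (\<lambda>p q. u a * v p * w q)" for a b
      using lin(2)[OF bf[OF uvw(2,3)] bf[OF uvw(2,3)], of b "u a"] by (simp add: mult.assoc)
    ultimately show "dual_op \<Delta> (dual_op \<Delta> u v) w x = dual_op \<Delta> u (dual_op \<Delta> v w) x"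
      using coassoc[OF tri, of x] by (simp add: dual_op_def functional_tensor_def)
  qed
  ultimately show ?thesis
    unfolding assoc_algebra_def using module_func_scale subspace_dual[OF s] by blast
qed

lemma dual_op_commute:
  assumes "\<And>x. \<Delta> x = tensor_flip (\<Delta> x)"
  shows "dual_op \<Delta> u v = dual_op \<Delta> v u"
  unfolding dual_op_def by (subst (1) assms) (simp add: functional_tensor_flip)

section \<open>ASI bialgebras as pairs of algebras in duality\<close>

text \<open>
  Commutativity and cocommutativity make the left and the right actions equal.
\<close>

lemma asi_assoc_pair_eq:
  assumes "comm_cocomm_asi_bialgebra s m \<Delta>" and "M = asi_assoc_pair s m \<Delta>"
  shows "M = \<lparr>scaleA = s, carrierA = UNIV, multA = m, scaleB = func_scale, carrierB = dual s,
    multB = dual_op \<Delta>, leftA = leftA M, rightA = leftA M, leftB = leftB M, rightB = leftB M\<rparr>"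
proof -
  have "m x y = m y x" "dual_op \<Delta> u v = dual_op \<Delta> v u" for x y u v
    using assms(1) by (auto simp: comm_cocomm_asi_bialgebra_def intro: dual_op_commute)
  then have "(\<lambda>y. m y x) = m x" "(\<lambda>w. dual_op \<Delta> w u) = dual_op \<Delta> u" for x u by blast+
  then show ?thesis by (simp add: assms(2) asi_assoc_pair_def duality_pair_def)
qed

text \<open>
  The compatibility axiom comes from the condition on \<open>\<Delta>(x \<circ> y)\<close>: its two terms evaluated at \<open>u \<otimes> v\<close> are
  dual products with one factor moved by a transposed multiplication.
\<close>

lemma dual_pair_asi:
  fixes s :: "'k::field_char_0 \<Rightarrow> 'a::ab_group_add \<Rightarrow> 'a"
  assumes fd: "finite_dimensional_vector_space s Basis" and asi: "comm_cocomm_asi_bialgebra s m \<Delta>"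
    and M: "M = asi_assoc_pair s m \<Delta>"
  shows "dual_pair s UNIV func_scale (dual s) eval_pairing m (dual_op \<Delta>) (leftA M) (leftB M)"
proof -
  have s: "vector_space s"
    using fd by (simp add: finite_dimensional_vector_space_def)
  have alg: "assoc_algebra s UNIV m" and coalg: "coassoc_coalgebra s \<Delta>"
    and mcomm: "\<And>x y. m x y = m y x" and cocomm: "\<And>x. \<Delta> x = tensor_flip (\<Delta> x)"
    and \<Delta>m: "\<And>x y. \<Delta> (m x y) =
        tensor_map s id (\<lambda>z. m x z) (\<Delta> y) + tensor_map s (\<lambda>z. m z y) id (\<Delta> x)"
    using asi by (auto simp: comm_cocomm_asi_bialgebra_def asi_bialgebra_def)
  note algB = assoc_algebra_dual_op[OF coalg]
  note closedB = bilinear_onD(1)[OF assoc_algebraD(3)[OF algB]]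
  have comm: "dual_op \<Delta> u v = dual_op \<Delta> v u" for u v
    by (rule dual_op_commute) (rule cocomm)
  have lin: "linear_on s UNIV s UNIV (\<lambda>y. m y x)" for x
    using assoc_algebraD(3)[OF alg] by (simp add: bilinear_on_def)
  have linB: "linear_on func_scale (dual s) func_scale (dual s) (\<lambda>w. dual_op \<Delta> w u)" if "u \<in> dual s" for u
    using assoc_algebraD(3)[OF algB] that by (simp add: bilinear_on_def)
  have lA: "leftA M x v = (\<lambda>y. v (m x y))" if "v \<in> dual s" for x v
    using transpose_eval[OF s lin that] by (simp add: M asi_assoc_pair_def duality_pair_def mcomm[of x])
  have comp: "(\<lambda>y. v (m x y)) \<in> dual s" if "v \<in> dual s" for x v
    using that linear_on_comp[OF lin[of x]] unfolding dual_iff[OF s] mcomm[of x] by blast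
  then have lA_closed: "leftA M x v \<in> dual s" if "v \<in> dual s" for x v
    using that by (simp add: lA)
  have lB: "w (leftB M u x) = dual_op \<Delta> u w x" if "u \<in> dual s" "w \<in> dual s" for u w x
    using transpose_bidual[OF fd linB[OF that(1)] that(2)]
    by (simp add: M asi_assoc_pair_def duality_pair_def comm[of u w])
  show ?thesis
  proof
    fix x y and u v :: "'a \<Rightarrow> 'k"
    assume uv: "u \<in> dual s" "v \<in> dual s"
    have "dual_op \<Delta> u v (m x y) = dual_op \<Delta> u (leftA M x v) y + dual_op \<Delta> (leftA M y u) v x"
      using functional_tensor_map[OF s uv, of id "\<lambda>z. m x z" "\<Delta> y"]
        functional_tensor_map[OF s uv, of "\<lambda>z. m z y" id "\<Delta> x"]
      unfolding dual_op_def \<Delta>m lA[OF uv(1)] lA[OF uv(2)]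
      by (simp add: functional_tensor_def mcomm[of y])
    then show "eval_pairing (dual_op \<Delta> u v) (m x y) =
        eval_pairing (leftA M x v) (leftB M u y) + eval_pairing (leftA M y u) (leftB M v x)"
      by (simp add: eval_pairing_def lB uv lA_closed comm[of v])
  qed (auto simp: alg algB mcomm comm eval_pairing_bilinear[OF s] comp lA lB eval_pairing_def
      intro: dual_separates[OF s])
qed

text \<open>
  Each identity for \<open>\<Delta>\<close>, evaluated at \<open>u \<otimes> v\<close>, is an identity for the dual product: the coderivation
  rule makes the transpose of \<open>e\<close> a derivation, and the coherence and admissibility conditions for \<open>\<Delta>\<close>
  become those for the product on \<open>A*\<close>.
\<close>

lemma coherent_dual_pair_asi:
  fixes s :: "'k::field_char_0 \<Rightarrow> 'a::ab_group_add \<Rightarrow> 'a"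
  assumes fd: "finite_dimensional_vector_space s Basis" and asi: "comm_cocomm_asi_bialgebra s m \<Delta>"
    and de: "coherent_derivation s m \<Delta> d1 e1" "coherent_derivation s m \<Delta> d2 e2"
    and dcomm: "d1 \<circ> d2 = d2 \<circ> d1" and ecomm: "e1 \<circ> e2 = e2 \<circ> e1"
    and adm: "\<And>x y. m (d1 x) (d2 y) = e2 (m x (d1 y))" "\<And>x y. m (d1 x) (d2 y) = e1 (m (d2 x) y)"
      "\<And>x. tensor_map s e1 e2 (\<Delta> x) = tensor_map s id e1 (\<Delta> (d2 x))"
      "\<And>x. tensor_map s e1 e2 (\<Delta> x) = tensor_map s e2 id (\<Delta> (d1 x))"
    and M: "M = asi_assoc_pair s m \<Delta>"
  shows "coherent_dual_pair s UNIV func_scale (dual s) eval_pairing m (dual_op \<Delta>) (leftA M) (leftB M)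
    d1 d2 e1 e2 (transpose_wrt eval_pairing (dual s) UNIV e1) (transpose_wrt eval_pairing (dual s) UNIV e2)
    (\<lambda>u x. u (d1 x)) (\<lambda>u x. u (d2 x))"
proof -
  have s: "vector_space s"
    using fd by (simp add: finite_dimensional_vector_space_def)
  interpret dual_pair s UNIV func_scale "dual s" eval_pairing m "dual_op \<Delta>" "leftA M" "leftB M"
    by (rule dual_pair_asi[OF fd asi M])
  have lin: "linear_on s UNIV s UNIV d1" "linear_on s UNIV s UNIV e1"
    "linear_on s UNIV s UNIV d2" "linear_on s UNIV s UNIV e2"
    using de by (auto simp: coherent_derivation_def derivation_def coderivation_def
        linear_iff_linear_on[OF s s])
  have comp: "(\<lambda>x. u (f x)) \<in> dual s" if "u \<in> dual s" "linear_on s UNIV s UNIV f" for u f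
    using that linear_on_comp unfolding dual_iff[OF s] by blast
  have tr: "transpose_wrt eval_pairing (dual s) UNIV f u = (\<lambda>x. u (f x))"
    if "u \<in> dual s" "linear_on s UNIV s UNIV f" for u f
    using transpose_eval[OF s] that by blast
  have der: "derivation_on s UNIV m d" if "coherent_derivation s m \<Delta> d e" for d e
    using that
    by (auto simp: coherent_derivation_def derivation_def derivation_on_def linear_iff_linear_on[OF s s])
  have ft: "dual_op (\<lambda>x. tensor_map s f g (\<Delta> (h x))) u v = (\<lambda>x. dual_op \<Delta> (\<lambda>y. u (f y)) (\<lambda>y. v (g y)) (h x))"
    if "u \<in> dual s" "v \<in> dual s" for f g h u v
    using functional_tensor_map[OF s that] by (simp add: dual_op_def)
  have dadd: "dual_op (\<lambda>x. F x + G x) u v = dual_op F u v + dual_op G u v" for F G u v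
    by (simp add: dual_op_def functional_tensor_def fun_eq_iff)
  have derB: "derivation_on func_scale (dual s) (dual_op \<Delta>) (transpose_wrt eval_pairing (dual s) UNIV e)"
    if de: "coherent_derivation s m \<Delta> d e" and lin: "linear_on s UNIV s UNIV e" for d e
    unfolding derivation_on_def linear_on_def
  proof (intro conjI ballI allI)
    fix u v and c assume uv: "u \<in> dual s" "v \<in> dual s"
    have "\<Delta> (e x) = tensor_map s e id (\<Delta> x) + tensor_map s id e (\<Delta> x)" for x
      using de by (simp add: coherent_derivation_def coderivation_def)
    then have "dual_op (\<lambda>x. \<Delta> (e x)) u v
      = dual_op (\<lambda>x. tensor_map s e id (\<Delta> x) + tensor_map s id e (\<Delta> x)) u v" by simp
    also have "\<dots> = dual_op \<Delta> (\<lambda>x. u (e x)) v + dual_op \<Delta> u (\<lambda>x. v (e x))"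
      using ft[OF uv, of e id "\<lambda>x. x"] ft[OF uv, of id e "\<lambda>x. x"] by (simp add: dadd)
    finally show "transpose_wrt eval_pairing (dual s) UNIV e (dual_op \<Delta> u v) =
      dual_op \<Delta> (transpose_wrt eval_pairing (dual s) UNIV e u) v +
      dual_op \<Delta> u (transpose_wrt eval_pairing (dual s) UNIV e v)"
      by (simp add: tr uv lin closedB) (simp add: dual_op_def)
    show "transpose_wrt eval_pairing (dual s) UNIV e (u + v) =
      transpose_wrt eval_pairing (dual s) UNIV e u + transpose_wrt eval_pairing (dual s) UNIV e v"
      by (simp add: tr uv lin subB fun_eq_iff)
    show "transpose_wrt eval_pairing (dual s) UNIV e (func_scale c u) =
      func_scale c (transpose_wrt eval_pairing (dual s) UNIV e u)"
      by (simp add: tr uv lin subB) (simp add: func_scale_def)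
    show "transpose_wrt eval_pairing (dual s) UNIV e u \<in> dual s"
      by (simp add: tr uv lin comp)
  qed
  have cohB: "dual_op \<Delta> u (\<lambda>x. v (d x)) =
      dual_op \<Delta> (\<lambda>x. u (e x)) v + (\<lambda>x. dual_op \<Delta> u v (d x))"
    if de: "coherent_derivation s m \<Delta> d e" and uv: "u \<in> dual s" "v \<in> dual s" for d e u v
  proof -
    have "tensor_map s id d (\<Delta> x) = tensor_map s e id (\<Delta> x) + \<Delta> (d x)" for x
      using de by (simp add: coherent_derivation_def)
    then have "dual_op (\<lambda>x. tensor_map s id d (\<Delta> x)) u v
      = dual_op (\<lambda>x. tensor_map s e id (\<Delta> x) + \<Delta> (d x)) u v" by simp
    then show ?thesis
      using ft[OF uv, of e id "\<lambda>x. x"] ft[OF uv, of id d "\<lambda>x. x"] by (simp add: dadd) (simp add: dual_op_def)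
  qed
  have admB: "dual_op \<Delta> (\<lambda>x. u (e1 x)) (\<lambda>x. v (e2 x)) = (\<lambda>x. dual_op \<Delta> u (\<lambda>x. v (e1 x)) (d2 x))"
    "dual_op \<Delta> (\<lambda>x. u (e1 x)) (\<lambda>x. v (e2 x)) = (\<lambda>x. dual_op \<Delta> (\<lambda>x. u (e2 x)) v (d1 x))"
    if uv: "u \<in> dual s" "v \<in> dual s" for u v
  proof -
    have "dual_op (\<lambda>x. tensor_map s e1 e2 (\<Delta> x)) u v = dual_op (\<lambda>x. tensor_map s id e1 (\<Delta> (d2 x))) u v"
      by (simp add: adm(3))
    then show "dual_op \<Delta> (\<lambda>x. u (e1 x)) (\<lambda>x. v (e2 x)) = (\<lambda>x. dual_op \<Delta> u (\<lambda>x. v (e1 x)) (d2 x))"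
      using ft[OF uv, of e1 e2 "\<lambda>x. x"] by (simp add: ft[OF uv])
    have "dual_op (\<lambda>x. tensor_map s e1 e2 (\<Delta> x)) u v = dual_op (\<lambda>x. tensor_map s e2 id (\<Delta> (d1 x))) u v"
      by (simp add: adm(4))
    then show "dual_op \<Delta> (\<lambda>x. u (e1 x)) (\<lambda>x. v (e2 x)) = (\<lambda>x. dual_op \<Delta> (\<lambda>x. u (e2 x)) v (d1 x))"
      using ft[OF uv, of e1 e2 "\<lambda>x. x"] by (simp add: ft[OF uv])
  qed
  show ?thesis
  proof (intro coherent_dual_pair.intro dual_pair_axioms coherent_dual_pair_axioms.intro)
    show "d1 (d2 x) = d2 (d1 x)" for x using dcomm by (simp add: fun_eq_iff)
    show "transpose_wrt eval_pairing (dual s) UNIV e1 (transpose_wrt eval_pairing (dual s) UNIV e2 v) =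
      transpose_wrt eval_pairing (dual s) UNIV e2 (transpose_wrt eval_pairing (dual s) UNIV e1 v)"
      if "v \<in> dual s" for v
      using ecomm that by (simp add: tr lin comp) (simp add: fun_eq_iff)
    show "m x (e1 y) = m (d1 x) y + e1 (m x y)" "m x (e2 y) = m (d2 x) y + e2 (m x y)" for x y
      using de by (auto simp: coherent_derivation_def)
    show "m (d1 x) (d2 y) = e2 (m x (d1 y))" "m (d1 x) (d2 y) = e1 (m (d2 x) y)" for x y
      by (rule adm)+
    show "dual_op \<Delta> (transpose_wrt eval_pairing (dual s) UNIV e1 u) (transpose_wrt eval_pairing (dual s) UNIV e2 v)
        = (\<lambda>x. dual_op \<Delta> u (transpose_wrt eval_pairing (dual s) UNIV e1 v) (d2 x))"
      "dual_op \<Delta> (transpose_wrt eval_pairing (dual s) UNIV e1 u) (transpose_wrt eval_pairing (dual s) UNIV e2 v)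
        = (\<lambda>x. dual_op \<Delta> (transpose_wrt eval_pairing (dual s) UNIV e2 u) v (d1 x))"
      if "u \<in> dual s" "v \<in> dual s" for u v
      using admB[OF that] by (simp_all only: tr lin that)
  qed (use de in \<open>auto simp: der derB lin tr comp cohB closedB eval_pairing_def\<close>)
qed

section \<open>Comparison with the deformed coproduct\<close>

lemma deformed_coproduct_nth:
  "deformed_coproduct s \<Delta> e1 e2 X $ n =
    (\<Sum>(i, k)\<in>tuples2 n. func_scale (inverse (fact k)) (tensor_map s (e1 ^^ k) (e2 ^^ k) (\<Delta> (X $ i))))"
  by (simp add: deformed_coproduct_def fps_linear_ext_def divided_power_series_def
      sum_tuples2[of "\<lambda>i k. func_scale (inverse (fact k)) (tensor_map s (e1 ^^ k) (e2 ^^ k) (\<Delta> (X $ i)))"])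

lemma functional_tensor_sum:
  fixes T :: "'i \<Rightarrow> ('k::field, 'a) tensor2"
  shows "functional_tensor u v (\<Sum>i\<in>I. T i) = (\<Sum>i\<in>I. functional_tensor u v (T i))"
  by (induction I rule: infinite_finite_induct) (auto simp: functional_tensor_def)

text \<open>
  The transpose of \<open>(e1\<^sup>k \<otimes> e2\<^sup>k) \<Delta>\<close> sends \<open>u \<otimes> v\<close> to the dual product of \<open>u \<circ> e1\<^sup>k\<close> and \<open>v \<circ> e2\<^sup>k\<close>, so the
  topological dual of the deformed coproduct is the deformation of the dual product along the
  transposes.
\<close>

lemma fps_dual_op_deformed_coproduct:
  fixes s :: "'k::field_char_0 \<Rightarrow> 'a::ab_group_add \<Rightarrow> 'a"
  assumes dp: "dual_pair s UNIV func_scale (dual s) eval_pairing m (dual_op \<Delta>) lA lB"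
    and e: "linear_on s UNIV s UNIV e1" "linear_on s UNIV s UNIV e2"
    and s: "vector_space s"
    and UZ: "U \<in> power_series_over (dual s)" "Z \<in> power_series_over (dual s)"
  shows "fps_dual_op s (deformed_coproduct s \<Delta> e1 e2) U Z =
    fps_bilinear_ext (\<lambda>u v. divided_power_series func_scale
      (\<lambda>k. dual_op \<Delta> (\<lambda>x. u ((e1 ^^ k) x)) (\<lambda>x. v ((e2 ^^ k) x)))) U Z"
proof -
  interpret dual_pair s UNIV func_scale "dual s" eval_pairing m "dual_op \<Delta>" lA lB by (rule dp)
  let ?W = "fps_bilinear_ext (\<lambda>u v. divided_power_series func_scale
      (\<lambda>k. dual_op \<Delta> (\<lambda>x. u ((e1 ^^ k) x)) (\<lambda>x. v ((e2 ^^ k) x)))) U Z"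
  note mem = UZ[THEN power_series_over_nth]
  have sum_apply: "(\<Sum>b\<in>B. F b) y = (\<Sum>b\<in>B. F b y)" for B :: "'c set" and F :: "'c \<Rightarrow> 'd \<Rightarrow> 'k" and y
    by (induction B rule: infinite_finite_induct) auto
  have comp: "(\<lambda>x. u ((f ^^ k) x)) \<in> dual s" if "u \<in> dual s" "linear_on s UNIV s UNIV f" for u f k
    using that(1) linear_on_comp[OF linear_on_funpow[OF that(2)]] unfolding dual_iff[OF s] by blast
  have Wmem: "?W \<in> power_series_over (dual s)"
    by (auto simp: power_series_over_def deformation_nth
        intro!: B.subspace_sum[OF modB(2)] subB closedB comp mem e)
  have pair: "fps_pairing ?W X = fps_pairing (fps_functional_tensor U Z) (deformed_coproduct s \<Delta> e1 e2 X)" for X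
  proof (rule fps_ext)
    fix n
    have "fps_pairing ?W X $ n = (\<Sum>(p, l)\<in>tuples2 n. \<Sum>(i, j, k)\<in>tuples3 p. inverse (fact k) *
        functional_tensor (U $ i) (Z $ j) (tensor_map s (e1 ^^ k) (e2 ^^ k) (\<Delta> (X $ l))))"
      unfolding fps_pairing_def fps_bilinear_ext_const_nth deformation_nth eval_pairing_def case_prod_unfold
      by (simp add: sum_apply func_scale_def dual_op_def functional_tensor_map[OF s mem])
    also have "\<dots> = (\<Sum>(p, q)\<in>tuples2 n. \<Sum>(i, j)\<in>tuples2 p. \<Sum>(l, k)\<in>tuples2 q. inverse (fact k) *
        functional_tensor (U $ i) (Z $ j) (tensor_map s (e1 ^^ k) (e2 ^^ k) (\<Delta> (X $ l))))"
      unfolding case_prod_unfold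
      by (simp only: sum.cartesian_product case_prod_unfold, subst (1 2) sum.Sigma, simp, simp, simp, simp,
          rule sum.reindex_bij_witness[of _
          "\<lambda>((p, q), ((i, j), (l, k))). ((p + k, l), (i, j, k))"
          "\<lambda>((p, l), (i, j, k)). ((i + j, l + k), ((i, j), (l, k)))"])
        (auto simp: tuples2_def tuples3_def)
    also have "\<dots> = fps_pairing (fps_functional_tensor U Z) (deformed_coproduct s \<Delta> e1 e2 X) $ n"
      unfolding fps_pairing_def fps_functional_tensor_def fps_bilinear_ext_const_nth eval_pairing_def
        deformed_coproduct_nth case_prod_unfold
      by (simp add: sum_apply functional_tensor_sum) (simp add: functional_tensor_def func_scale_def)
    finally show "fps_pairing ?W X $ n
      = fps_pairing (fps_functional_tensor U Z) (deformed_coproduct s \<Delta> e1 e2 X) $ n" .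
  qed
  have pairing_h: "pairing_h = fps_pairing" by (simp add: pairing_h_def fps_pairing_def)
  show ?thesis
    unfolding fps_dual_op_def
  proof (rule the_equality)
    fix W assume "W \<in> power_series_over (dual s) \<and> (\<forall>X. fps_pairing W X =
        fps_pairing (fps_functional_tensor U Z) (deformed_coproduct s \<Delta> e1 e2 X))"
    then show "W = ?W"
      using pair Wmem by (intro pairing_h_nondegB) (auto simp: pairing_h)
  qed (use pair Wmem in auto)
qed

lemma dual_op_qcl_cobracket:
  fixes s :: "'k::field_char_0 \<Rightarrow> 'a::ab_group_add \<Rightarrow> 'a"
  assumes s: "vector_space s" and \<Delta>: "linear_on s UNIV func_scale (tensor_square s) \<Delta>"
    and uv: "u \<in> dual s" "v \<in> dual s"
  shows "dual_op (qcl_cobracket (deformed_coproduct s \<Delta> e1 e2)) u v =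
    dual_op \<Delta> (\<lambda>x. u (e1 x)) (\<lambda>x. v (e2 x)) - dual_op \<Delta> (\<lambda>x. v (e1 x)) (\<lambda>x. u (e2 x))"
proof
  fix x
  interpret s: module s using vector_space_imp_module[OF s] .
  have \<Delta>0: "\<Delta> 0 = 0"
    by (rule linear_on_zero[OF s.module_axioms s.subspace_UNIV \<Delta>])
  have t1: "tuples2 1 = {(0, 1), (1, 0)}" by (auto simp: tuples2_def)
  have "deformed_coproduct s \<Delta> e1 e2 (fps_const x) $ 1 = tensor_map s e1 e2 (\<Delta> x)"
    unfolding deformed_coproduct_nth t1 by (simp add: \<Delta>0 func_scale_def tensor_map_def fun_eq_iff)
  then have "qcl_cobracket (deformed_coproduct s \<Delta> e1 e2) x
      = tensor_map s e1 e2 (\<Delta> x) - tensor_flip (tensor_map s e1 e2 (\<Delta> x))"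
    by (simp add: qcl_cobracket_def div_h_mod_h_def fps_tensor_flip_def)
  moreover have "functional_tensor u v (S - T) = functional_tensor u v S - functional_tensor u v T"
    for S T :: "('k, 'a) tensor2"
    by (simp add: functional_tensor_def)
  ultimately show "dual_op (qcl_cobracket (deformed_coproduct s \<Delta> e1 e2)) u v x =
    (dual_op \<Delta> (\<lambda>x. u (e1 x)) (\<lambda>x. v (e2 x)) - dual_op \<Delta> (\<lambda>x. v (e1 x)) (\<lambda>x. u (e2 x))) x"
    by (simp add: dual_op_def functional_tensor_flip functional_tensor_map[OF s uv]
        functional_tensor_map[OF s uv(2,1)])
qed

theorem corollary3p21:
  fixes s :: "'k::field_char_0 \<Rightarrow> 'a::ab_group_add \<Rightarrow> 'a"
    and Basis :: "'a set"
    and m :: "'a \<Rightarrow> 'a \<Rightarrow> 'a"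
    and \<Delta> :: "'a \<Rightarrow> ('k, 'a) tensor2"
    and d1 d2 e1 e2 :: "'a \<Rightarrow> 'a"
  assumes "finite_dimensional_vector_space s Basis"
    and "comm_cocomm_asi_bialgebra s m \<Delta>"
    and "coherent_derivation s m \<Delta> d1 e1"
    and "coherent_derivation s m \<Delta> d2 e2"
    and "d1 \<circ> d2 = d2 \<circ> d1"
    and "e1 \<circ> e2 = e2 \<circ> e1"
    and "\<And>x y. m (d1 x) (d2 y) = e2 (m x (d1 y))"
    and "\<And>x y. m (d1 x) (d2 y) = e1 (m (d2 x) y)"
    and "\<And>x. tensor_map s e1 e2 (\<Delta> x) = tensor_map s id e1 (\<Delta> (d2 x))"
    and "\<And>x. tensor_map s e1 e2 (\<Delta> x) = tensor_map s e2 id (\<Delta> (d1 x))"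
    and mh: "mh = deformed_product s m d1 d2"
    and \<Delta>h: "\<Delta>h = deformed_coproduct s \<Delta> e1 e2"
    and M: "M = asi_assoc_pair s m \<Delta>"
    and Mh: "Mh = assoc_pair_deformation M
      (map_prod d1 (transpose_wrt eval_pairing (dual s) UNIV e1))
      (map_prod d2 (transpose_wrt eval_pairing (dual s) UNIV e2))"
    and PM: "PM = bialgebra_poisson_pair s (qcl_bracket mh) m (qcl_cobracket \<Delta>h) \<Delta>"
  shows "topologically_free_assoc_matched_pair (fps_asi_assoc_pair s mh \<Delta>h)
       \<and> assoc_pairs_coincide (fps_asi_assoc_pair s mh \<Delta>h) Mh
       \<and> poisson_matched_pair PM
       \<and> poisson_pairs_coincide PM (assoc_pair_qcl M Mh)"
proof -
  let ?tr = "transpose_wrt eval_pairing (dual s) UNIV"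
  have s: "vector_space s"
    using assms(1) by (simp add: finite_dimensional_vector_space_def)
  have \<Delta>: "linear_on s UNIV func_scale (tensor_square s) \<Delta>"
    using assms(2) by (simp add: comm_cocomm_asi_bialgebra_def asi_bialgebra_def coassoc_coalgebra_def)
  have e: "linear_on s UNIV s UNIV e1" "linear_on s UNIV s UNIV e2"
    using assms(3,4) by (auto simp: coherent_derivation_def coderivation_def linear_iff_linear_on[OF s s])
  \<comment> \<open>Opaque names for the actions: \<open>M_eq\<close> below would otherwise rewrite \<open>M\<close> inside its own right-hand
    side.\<close>
  define l where "l = leftA M"
  define r where "r = leftB M"
  interpret coherent_dual_pair s UNIV func_scale "dual s" eval_pairing m "dual_op \<Delta>" l r
    d1 d2 e1 e2 "?tr e1" "?tr e2" "\<lambda>u x. u (d1 x)" "\<lambda>u x. u (d2 x)"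
    unfolding l_def r_def by (rule coherent_dual_pair_asi[OF assms(1-10) M])
  have M_eq: "M = double"
    unfolding double_def unfolding l_def r_def by (rule asi_assoc_pair_eq[OF assms(2) M])
  have Mh_eq: "Mh = deformation"
    by (simp add: Mh M_eq deformation_def)
  have mh_eq: "mh = multA deformation"
    by (simp add: mh deformed_product_def deformation_simps)
  have tr: "(?tr e1 ^^ k) u = (\<lambda>x. u ((e1 ^^ k) x))" "(?tr e2 ^^ k) u = (\<lambda>x. u ((e2 ^^ k) x))"
    if "u \<in> dual s" for u k
    using pr_dB_pow[OF that UNIV_I] by (auto simp: eval_pairing_def)
  have dual_op_eq: "fps_dual_op s \<Delta>h U Z = multB deformation U Z"
    if "U \<in> power_series_over (dual s)" "Z \<in> power_series_over (dual s)" for U Z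
    using that[THEN power_series_over_nth]
    unfolding \<Delta>h fps_dual_op_deformed_coproduct[OF dual_pair_axioms e s that]
    by (simp add: fps_eq_iff deformation_simps deformation_nth tr)
  have coincide: "assoc_pairs_coincide (fps_asi_assoc_pair s mh \<Delta>h) Mh"
    using duality_pair_coincides[of "fps_dual_op s \<Delta>h", OF dual_op_eq]
    by (simp add: fps_asi_assoc_pair_def Mh_eq mh_eq pairing_h_def fps_pairing_def)
  then have "assoc_matched_pair (fps_asi_assoc_pair s mh \<Delta>h)"
    by (rule assoc_matched_pair_coincide) (simp add: Mh_eq assoc_matched_pair_deformation)
  then have free: "topologically_free_assoc_matched_pair (fps_asi_assoc_pair s mh \<Delta>h)"
    by (simp add: topologically_free_assoc_matched_pair_def fps_asi_assoc_pair_def duality_pair_def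
        topologically_free_power_series_over modA modB)
  have bil: "bilinear_on s UNIV s UNIV s UNIV (qcl_bracket mh)"
    "bilinear_on func_scale (dual s) func_scale (dual s) func_scale (dual s) (qcl_bracket (multB deformation))"
    using poisson_matched_pair_qcl
    by (auto simp: poisson_matched_pair_def poisson_algebra_def qcl_simps mh_eq)
  \<comment> \<open>Degree 1 in \<open>h\<close>: the antisymmetrised coproduct is dual to the antisymmetrised product.\<close>
  have bracketQ: "dual_op (qcl_cobracket \<Delta>h) u v = qcl_bracket (multB deformation) u v"
    if "u \<in> dual s" "v \<in> dual s" for u v
    using that tr[of _ 1] by (simp add: \<Delta>h dual_op_qcl_cobracket[OF s \<Delta>] qcl_brackets)
  have linP: "linear_on s UNIV s UNIV (qcl_bracket mh x)" for x
    using bil(1) by (simp add: bilinear_on_def)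
  have "bilinear_on func_scale (dual s) func_scale (dual s) func_scale (dual s) (dual_op (qcl_cobracket \<Delta>h))"
    using bilinear_on_cong[of "dual s" "dual s" "dual_op (qcl_cobracket \<Delta>h)", OF bracketQ modB modB] bil(2)
    by blast
  then have linQ: "linear_on func_scale (dual s) func_scale (dual s) (dual_op (qcl_cobracket \<Delta>h) u)"
    if "u \<in> dual s" for u
    using that by (simp add: bilinear_on_def)
  have rhoP: "- ?tr (qcl_bracket mh x) u = rho_bracketP qcl x u" if "u \<in> dual s" for x u
    unfolding transpose_eval[OF s linP that]
    using pr_rho_bracketP[OF UNIV_I that UNIV_I] by (auto simp: eval_pairing_def mh_eq)
  have rhoQ: "- transpose_wrt (\<lambda>x w. eval_pairing w x) UNIV (dual s) (dual_op (qcl_cobracket \<Delta>h) u) x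
      = rho_bracketQ qcl u x" (is "- ?y = _") if "u \<in> dual s" for u x
  proof (rule eqA)
    fix w assume w: "w \<in> dual s"
    have "eval_pairing w (- ?y) = - w ?y"
      using linear_on_diff[OF modA lin_pr(1)[OF w] UNIV_I UNIV_I, of 0 ?y]
        linear_on_zero[OF modA lin_pr(1)[OF w]] by (simp add: eval_pairing_def)
    also have "\<dots> = eval_pairing w (rho_bracketQ qcl u x)"
      using transpose_bidual[OF assms(1) linQ[OF that] w] pr_rho_bracketQ[OF that UNIV_I w]
      by (simp add: eval_pairing_def bracketQ that w)
    finally show "eval_pairing w (- ?y) = eval_pairing w (rho_bracketQ qcl u x)" .
  qed simp_all
  have lr: "?tr (\<lambda>y. m y x) = l x"
    "transpose_wrt (\<lambda>x w. eval_pairing w x) UNIV (dual s) (\<lambda>w. dual_op \<Delta> w u) = r u" for x u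
    by (simp_all add: l_def r_def M asi_assoc_pair_def duality_pair_def)
  have qcl: "poisson_pairs_coincide PM (assoc_pair_qcl M Mh)"
    unfolding poisson_pairs_coincide_def Mh_eq M_eq[symmetric] 
    using rhoP rhoQ bracketQ lr
    by (simp add: PM bialgebra_poisson_pair_def M_eq qcl_simps mh_eq)
  then have "poisson_matched_pair PM"
    by (rule poisson_matched_pair_coincide) (simp add: M_eq Mh_eq poisson_matched_pair_qcl)
  then show ?thesis using free coincide qcl by blast
qed

end
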